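(* Let $G$ be a second countable locally compact group of type I, with fixed Plancherel data $(\nu,(\pi_\xi)_{\xi\in\widehat G},(D_\xi)_{\xi\in\widehat G})$ as described in the context. For every symbol $A\in L^2(G)\otimes\big(\mathscr B_1^\oplus(\widehat G)\cap\mathscr B_2^\oplus(\widehat G)\big)$, put $$\mathrm{ker}_A(x,y)=\Delta(y)^{-\frac12}\int_{\widehat G}\mathrm{Tr}\Big(A(x,\xi)D_\xi^{\frac12}\pi_\xi(xy^{-1})^*\Big)\,d\xi .$$ Then $\mathrm{ker}_A$ is a square integrable function on $G\times G$, and the operator $\mathsf{Op}(A):L^2(G)\to L^2(G)$ given by $$[\mathsf{Op}(A)u](x)=\int_G\int_{\widehat G}\mathrm{Tr}\Big(A(x,\xi)D_\xi^{\frac12}\pi_\xi(xy^{-1})^*\Big)\Delta(y)^{-\frac12}u(y)\,d\xi\,dy$$ is a Hilbert-Schmidt operator with integral kernel $\mathrm{ker}_A$ and Hilbert-Schmidt norm $$\|\mathsf{Op}(A)\|_{\mathbb B_2}=\|A\|_{\mathscr B_2^\oplus}.$$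
   Context: $G$ is a (Hausdorff) second countable locally compact group of type I, with a fixed left Haar measure $\mu$, $d\mu(x)=dx$, and modular function $\Delta:G\to(0,\infty)$ normalized by $\mu(Ex)=\Delta(x)\mu(E)$; thus $\int_G f(y)\,dy=\int_G\Delta(x)f(yx)\,dy=\int_G\Delta(y)^{-1}f(y^{-1})\,dy$. $L^p(G)$ refers to the left Haar measure. $\widehat G$ is the unitary dual (classes of irreducible unitary representations) with the Mackey Borel structure. For a Hilbert space $\mathcal H$, $\mathbb B_1(\mathcal H)$ and $\mathbb B_2(\mathcal H)$ are the trace-class and Hilbert-Schmidt operators, with norms $\|\cdot\|_{\mathbb B_1},\|\cdot\|_{\mathbb B_2}$. Plancherel data: by the (known) non-unimodular Plancherel theorem of Tatsuuma and Duflo-Moore, one fixes a $\sigma$-finite Plancherel measure $\nu$ on $\widehat G$ (write $d\xi=d\nu(\xi)$), a measurable field $(\pi_\xi)_{\xi\in\widehat G}$ of irreducible unitary representations with $\pi_\xi\in\xi$ acting on a separable Hilbert space $\mathcal H_\xi$, and a measurable field $(D_\xi)_{\xi\in\widehat G}$ of densely defined positive self-adjoint operators on $\mathcal H_\xi$ with dense image (Duflo-Moore operators), satisfying for $\nu$-almost every $\xi$ the semi-invariance condition $\pi_\xi(x)D_\xi\pi_\xi(x)^*=\Delta(x)^{-1}D_\xi$ for all $x\in G$, and such that: (1) for $f\in L^1(G)\cap L^2(G)$, the operator $\widehat f(\xi)=(\mathcal Pf)(\xi)=\pi_\xi(f)D_\xi^{1/2}$, where $\pi_\xi(f)=\int_G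 f(y)\pi_\xi(y)\,dy$, extends to a Hilbert-Schmidt operator for $\nu$-a.e. $\xi$, $\|f\|_2^2=\int_{\widehat G}\|\widehat f(\xi)\|_{\mathbb B_2}^2\,d\xi$, and $\mathcal P$ extends uniquely to a unitary operator $\mathcal P:L^2(G)\to\int_{\widehat G}^\oplus\mathbb B_2(\mathcal H_\xi)\,d\xi$; (2) if $F\in\int_{\widehat G}^\oplus\mathbb B_2(\mathcal H_\xi)\,d\xi$ is such that $F(\xi)D_\xi^{1/2}$ extends to a trace-class operator for $\nu$-a.e. $\xi$ and $\int_{\widehat G}\|F(\xi)D_\xi^{1/2}\|_{\mathbb B_1}d\xi<\infty$, then $(\mathcal P^{-1}F)(x)=\int_{\widehat G}\mathrm{Tr}\big(F(\xi)D_\xi^{1/2}\pi_\xi(x)^*\big)\,d\xi$ for almost every $x$. Spaces: $\mathscr B_2^\oplus(\widehat G)=\int_{\widehat G}^\oplus\mathbb B_2(\mathcal H_\xi)\,d\xi$. $\mathscr B_1^\oplus(\widehat G)=\int_{\widehat G}^\oplus\mathbb B_1(\mathcal H_\xi)D_\xi^{-1/2}\,d\xi$ is the space of measurable fields $F$ such that $F(\xi)D_\xi^{1/2}$ extends to a trace-class operator for a.e. $\xi$ and $\int_{\widehat G}\|F(\xi)D_\xi^{1/2}\|_{\mathbb B_1}d\xi<\infty$. $\mathscr B_2^\oplus(G\times\widehat G)=L^2(G)\otimes\mathscr B_2^\oplus(\widehat G)$ (Hilbert space tensor product), with inner product $\langle A,B\rangle_{\mathscr B_2^\oplus}=\int_G\int_{\widehat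 G}\mathrm{Tr}[A(x,\xi)B(x,\xi)^*]\,d\xi\,dx$. The space $L^2(G)\otimes\big(\mathscr B_1^\oplus(\widehat G)\cap\mathscr B_2^\oplus(\widehat G)\big)$ is regarded as the subspace of $\mathscr B_2^\oplus(G\times\widehat G)$ spanned by elementary tensors. In traces, $A(x,\xi)D_\xi^{1/2}$ denotes its trace-class extension. *)

theory Defs
  imports "HOL-Analysis.Analysis"
begin

text \<open>
  The group is written additively, since \<^class>\<open>topological_group_add\<close> is the library's class of
  (not necessarily commutative) topological groups: \<open>x + y\<close> is the product \<open>xy\<close>, \<open>- x\<close> is \<open>x\<close>
  inverse, and \<open>x - y = x + (- y)\<close> is the product of \<open>x\<close> with the inverse of \<open>y\<close>.
\<close>

section \<open>Complex Hilbert spaces\<close>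

text \<open>Inner products are linear in the first argument.\<close>

class chilbert_space = banach + real_inner +
  fixes scaleC :: "complex \<Rightarrow> 'a \<Rightarrow> 'a" (infixr "*\<^sub>C" 75)
    and cinner :: "'a \<Rightarrow> 'a \<Rightarrow> complex"
  assumes scaleC_add_right: "a *\<^sub>C (x + y) = a *\<^sub>C x + a *\<^sub>C y"
    and scaleC_add_left: "(a + b) *\<^sub>C x = a *\<^sub>C x + b *\<^sub>C x"
    and scaleC_scaleC: "a *\<^sub>C b *\<^sub>C x = (a * b) *\<^sub>C x"
    and scaleR_scaleC: "r *\<^sub>R x = complex_of_real r *\<^sub>C x"
    and cinner_commute: "cinner x y = cnj (cinner y x)"
    and cinner_add_left: "cinner (x + y) z = cinner x z + cinner y z"
    and cinner_scaleC_left: "cinner (a *\<^sub>C x) y = a * cinner x y"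
    and inner_eq_Re_cinner: "inner x y = Re (cinner x y)"

instantiation complex :: chilbert_space
begin
definition "scaleC_complex (a::complex) (x::complex) = a * x"
definition "cinner_complex (x::complex) (y::complex) = x * cnj y"
instance
  by standard
    (auto simp: scaleC_complex_def cinner_complex_def algebra_simps inner_complex_def scaleR_conv_of_real)
end

text \<open>
  Hilbert spaces that vary with a parameter are closed subspaces of one ambient Hilbert space.
  An operator on the Hilbert space \<open>H\<close> is a function on the ambient space of which only the
  values on \<open>H\<close> are relevant.
\<close>

definition csubspace :: "'h::chilbert_space set \<Rightarrow> bool" where
  "csubspace S \<longleftrightarrow> 0 \<in> S \<and> (\<forall>x\<in>S. \<forall>y\<in>S. x + y \<in> S) \<and> (\<forall>c. \<forall>x\<in>S. c *\<^sub>C x \<in> S)"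

definition hilbert_subspace :: "'h::chilbert_space set \<Rightarrow> bool" where
  "hilbert_subspace H \<longleftrightarrow> csubspace H \<and> closed H"

definition clinear_op :: "'h::chilbert_space set \<Rightarrow> 'h set \<Rightarrow> ('h \<Rightarrow> 'h) \<Rightarrow> bool" where
  "clinear_op H K T \<longleftrightarrow> (\<forall>v\<in>H. T v \<in> K) \<and> (\<forall>v\<in>H. \<forall>w\<in>H. T (v + w) = T v + T w) \<and>
     (\<forall>c. \<forall>v\<in>H. T (c *\<^sub>C v) = c *\<^sub>C T v)"

definition bounded_op :: "'h::chilbert_space set \<Rightarrow> ('h \<Rightarrow> 'h) \<Rightarrow> bool" where
  "bounded_op H T \<longleftrightarrow> clinear_op H H T \<and> (\<exists>C. \<forall>v\<in>H. norm (T v) \<le> C * norm v)"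

definition unitary_op :: "'h::chilbert_space set \<Rightarrow> 'h set \<Rightarrow> ('h \<Rightarrow> 'h) \<Rightarrow> bool" where
  "unitary_op H K U \<longleftrightarrow> clinear_op H K U \<and> U ` H = K \<and>
     (\<forall>v\<in>H. \<forall>w\<in>H. cinner (U v) (U w) = cinner v w)"

definition adjoint_op :: "'h::chilbert_space set \<Rightarrow> ('h \<Rightarrow> 'h) \<Rightarrow> 'h \<Rightarrow> 'h" where
  "adjoint_op H T v = (THE w. w \<in> H \<and> (\<forall>u\<in>H. cinner (T u) v = cinner u w))"

section \<open>Orthonormal bases, Hilbert-Schmidt and trace-class operators\<close>

text \<open>
  These notions are phrased for a carrier \<open>V\<close> with a possibly degenerate inner product, so that
  they apply both to closed subspaces and to spaces of square integrable functions modulo null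
  functions. In a complete space, an orthonormal basis is a maximal orthonormal set. Sums over an
  orthonormal basis are taken with respect to one chosen basis, the value being independent of it.
\<close>

definition orthonormal_basis :: "'v set \<Rightarrow> ('v \<Rightarrow> 'v \<Rightarrow> complex) \<Rightarrow> 'v set \<Rightarrow> bool" where
  "orthonormal_basis V ip B \<longleftrightarrow> B \<subseteq> V \<and> (\<forall>b\<in>B. ip b b = 1) \<and>
     (\<forall>b\<in>B. \<forall>c\<in>B. b \<noteq> c \<longrightarrow> ip b c = 0) \<and>
     (\<forall>v\<in>V. (\<forall>b\<in>B. ip v b = 0) \<longrightarrow> ip v v = 0)"

definition onb :: "'v set \<Rightarrow> ('v \<Rightarrow> 'v \<Rightarrow> complex) \<Rightarrow> 'v set" where
  "onb V ip = (SOME B. orthonormal_basis V ip B)"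

definition hs_summable :: "'v set \<Rightarrow> ('v \<Rightarrow> 'v \<Rightarrow> complex) \<Rightarrow> ('v \<Rightarrow> 'v) \<Rightarrow> bool" where
  "hs_summable V ip T \<longleftrightarrow> (\<lambda>b. Re (ip (T b) (T b))) summable_on onb V ip"

definition hs_norm :: "'v set \<Rightarrow> ('v \<Rightarrow> 'v \<Rightarrow> complex) \<Rightarrow> ('v \<Rightarrow> 'v) \<Rightarrow> real" where
  "hs_norm V ip T = sqrt (infsum (\<lambda>b. Re (ip (T b) (T b))) (onb V ip))"

definition hilbert_schmidt :: "'h::chilbert_space set \<Rightarrow> ('h \<Rightarrow> 'h) \<Rightarrow> bool" where
  "hilbert_schmidt H T \<longleftrightarrow> bounded_op H T \<and> hs_summable H cinner T"

definition op_trace :: "'h::chilbert_space set \<Rightarrow> ('h \<Rightarrow> 'h) \<Rightarrow> complex" where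
  "op_trace H T = infsum (\<lambda>b. cinner (T b) b) (onb H cinner)"

text \<open>
  \<open>S\<close> is the absolute value of \<open>T\<close>: the positive operator with \<open>S\<^sup>2 = T\<^sup>*T\<close>, the last
  identity being tested against inner products. It is unique on \<open>H\<close>.
\<close>

definition is_abs_op :: "'h::chilbert_space set \<Rightarrow> ('h \<Rightarrow> 'h) \<Rightarrow> ('h \<Rightarrow> 'h) \<Rightarrow> bool" where
  "is_abs_op H T S \<longleftrightarrow> bounded_op H S \<and>
     (\<forall>v\<in>H. \<forall>w\<in>H. cinner (S v) w = cinner v (S w)) \<and>
     (\<forall>v\<in>H. 0 \<le> Re (cinner (S v) v)) \<and>
     (\<forall>v\<in>H. \<forall>w\<in>H. cinner (S (S v)) w = cinner (T v) (T w))"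

definition trace_class :: "'h::chilbert_space set \<Rightarrow> ('h \<Rightarrow> 'h) \<Rightarrow> bool" where
  "trace_class H T \<longleftrightarrow> bounded_op H T \<and>
     (\<exists>S. is_abs_op H T S \<and> (\<lambda>b. cinner (S b) b) summable_on onb H cinner)"

definition trace_norm :: "'h::chilbert_space set \<Rightarrow> ('h \<Rightarrow> 'h) \<Rightarrow> real" where
  "trace_norm H T = Re (op_trace H (SOME S. is_abs_op H T S))"

section \<open>Unbounded operators\<close>

text \<open>An unbounded operator is represented by its graph; composition is relational composition.\<close>

definition adjoint_graph :: "'h::chilbert_space set \<Rightarrow> ('h \<times> 'h) set \<Rightarrow> ('h \<times> 'h) set" where
  "adjoint_graph H D = {(v, w). v \<in> H \<and> w \<in> H \<and> (\<forall>(x, y)\<in>D. cinner y v = cinner x w)}"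

definition pos_self_adjoint :: "'h::chilbert_space set \<Rightarrow> ('h \<times> 'h) set \<Rightarrow> bool" where
  "pos_self_adjoint H D \<longleftrightarrow> D \<subseteq> H \<times> H \<and> single_valued D \<and> H \<subseteq> closure (Domain D) \<and>
     adjoint_graph H D = D \<and> (\<forall>(v, w)\<in>D. 0 \<le> Re (cinner w v))"

definition is_sqrt_op :: "'h::chilbert_space set \<Rightarrow> ('h \<times> 'h) set \<Rightarrow> ('h \<times> 'h) set \<Rightarrow> bool" where
  "is_sqrt_op H D S \<longleftrightarrow> pos_self_adjoint H S \<and> S O S = D"

text \<open>\<open>(1 + D)\<^sup>-\<^sup>1\<close>\<close>

definition resolvent_op :: "('h::chilbert_space \<times> 'h) set \<Rightarrow> 'h \<Rightarrow> 'h" where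
  "resolvent_op D u = (THE v. (v, u - v) \<in> D)"

text \<open>\<open>T\<close> extends the product \<open>F S\<close>, where \<open>F\<close> is everywhere defined and \<open>S\<close> unbounded.\<close>

definition extends_prod :: "('h \<Rightarrow> 'h) \<Rightarrow> ('h \<Rightarrow> 'h) \<Rightarrow> ('h \<times> 'h) set \<Rightarrow> bool" where
  "extends_prod T F S \<longleftrightarrow> (\<forall>(v, w)\<in>S. T v = F w)"

text \<open>The bounded extension of \<open>F S\<close>; if \<open>S\<close> is densely defined it is unique on \<open>H\<close>, so
  it is the trace-class extension whenever there is one.\<close>

definition op_ext :: "'h::chilbert_space set \<Rightarrow> ('h \<Rightarrow> 'h) \<Rightarrow> ('h \<times> 'h) set \<Rightarrow> 'h \<Rightarrow> 'h" where
  "op_ext H F S = (SOME T. bounded_op H T \<and> extends_prod T F S)"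

section \<open>Square integrable functions\<close>

text \<open>Elements are functions; equality in the Hilbert space is equality almost everywhere.\<close>

definition L2 :: "'a measure \<Rightarrow> ('a \<Rightarrow> complex) set" where
  "L2 M = {f \<in> borel_measurable M. integrable M (\<lambda>x. (cmod (f x))\<^sup>2)}"

definition L2_inner :: "'a measure \<Rightarrow> ('a \<Rightarrow> complex) \<Rightarrow> ('a \<Rightarrow> complex) \<Rightarrow> complex" where
  "L2_inner M f g = (\<integral>x. f x * cnj (g x) \<partial>M)"

definition L2_norm :: "'a measure \<Rightarrow> ('a \<Rightarrow> complex) \<Rightarrow> real" where
  "L2_norm M f = sqrt (\<integral>x. (cmod (f x))\<^sup>2 \<partial>M)"

definition L2_bounded_op :: "'a measure \<Rightarrow> (('a \<Rightarrow> complex) \<Rightarrow> 'a \<Rightarrow> complex) \<Rightarrow> bool" where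
  "L2_bounded_op M T \<longleftrightarrow> (\<forall>f\<in>L2 M. T f \<in> L2 M) \<and>
     (\<forall>f\<in>L2 M. \<forall>g\<in>L2 M. (AE x in M. f x = g x) \<longrightarrow> (AE x in M. T f x = T g x)) \<and>
     (\<forall>f\<in>L2 M. \<forall>g\<in>L2 M. \<forall>a b. AE x in M. T (\<lambda>z. a * f z + b * g z) x = a * T f x + b * T g x) \<and>
     (\<exists>C. \<forall>f\<in>L2 M. L2_norm M (T f) \<le> C * L2_norm M f)"

definition L2_hilbert_schmidt :: "'a measure \<Rightarrow> (('a \<Rightarrow> complex) \<Rightarrow> 'a \<Rightarrow> complex) \<Rightarrow> bool" where
  "L2_hilbert_schmidt M T \<longleftrightarrow> L2_bounded_op M T \<and> hs_summable (L2 M) (L2_inner M) T"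

definition has_integral_kernel ::
  "'a measure \<Rightarrow> (('a \<Rightarrow> complex) \<Rightarrow> 'a \<Rightarrow> complex) \<Rightarrow> ('a \<times> 'a \<Rightarrow> complex) \<Rightarrow> bool" where
  "has_integral_kernel M T k \<longleftrightarrow> (\<forall>u\<in>L2 M. AE x in M.
     integrable M (\<lambda>y. k (x, y) * u y) \<and> T u x = (\<integral>y. k (x, y) * u y \<partial>M))"

section \<open>Haar measure\<close>

definition left_haar_measure :: "'g::topological_group_add measure \<Rightarrow> bool" where
  "left_haar_measure \<mu> \<longleftrightarrow> sets \<mu> = sets borel \<and> emeasure \<mu> UNIV \<noteq> 0 \<and>
     (\<forall>K. compact K \<longrightarrow> emeasure \<mu> K < \<infinity>) \<and>
     (\<forall>E\<in>sets \<mu>. \<forall>x. emeasure \<mu> ((\<lambda>y. x + y) ` E) = emeasure \<mu> E)"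

definition modular_function :: "'g::topological_group_add measure \<Rightarrow> ('g \<Rightarrow> real) \<Rightarrow> bool" where
  "modular_function \<mu> \<Delta> \<longleftrightarrow> (\<forall>x. 0 < \<Delta> x) \<and>
     (\<forall>E\<in>sets \<mu>. \<forall>x. emeasure \<mu> ((\<lambda>y. y + x) ` E) = ennreal (\<Delta> x) * emeasure \<mu> E)"

section \<open>Unitary representations and the unitary dual\<close>

text \<open>
  Representations act on closed subspaces of the type \<open>'h\<close>. When \<open>'h\<close> is an infinite-dimensional
  separable Hilbert space, this covers all representations on separable Hilbert spaces up to
  equivalence, in particular all irreducible ones if the group is second countable.
\<close>

type_synonym ('g, 'h) rep = "'h set \<times> ('g \<Rightarrow> 'h \<Rightarrow> 'h)"

definition unitary_rep :: "('g::topological_group_add, 'h::chilbert_space) rep \<Rightarrow> bool" where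
  "unitary_rep \<rho> \<longleftrightarrow> (case \<rho> of (H, \<pi>) \<Rightarrow> hilbert_subspace H \<and> (\<forall>x. unitary_op H H (\<pi> x)) \<and>
     (\<forall>x y. \<forall>v\<in>H. \<pi> (x + y) v = \<pi> x (\<pi> y v)) \<and>
     (\<forall>v\<in>H. continuous_on UNIV (\<lambda>x. \<pi> x v)))"

definition irreducible_rep :: "('g::topological_group_add, 'h::chilbert_space) rep \<Rightarrow> bool" where
  "irreducible_rep \<rho> \<longleftrightarrow> unitary_rep \<rho> \<and> (case \<rho> of (H, \<pi>) \<Rightarrow> H \<noteq> {0} \<and>
     (\<forall>K. hilbert_subspace K \<and> K \<subseteq> H \<and> (\<forall>x. \<forall>v\<in>K. \<pi> x v \<in> K) \<longrightarrow> K = {0} \<or> K = H))"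

definition equivalent_reps ::
  "('g, 'h::chilbert_space) rep \<Rightarrow> ('g, 'h) rep \<Rightarrow> bool" where
  "equivalent_reps \<rho> \<sigma> \<longleftrightarrow> (case (\<rho>, \<sigma>) of ((H, \<pi>), (K, \<tau>)) \<Rightarrow>
     (\<exists>U. unitary_op H K U \<and> (\<forall>x. \<forall>v\<in>H. U (\<pi> x v) = \<tau> x (U v))))"

definition unitary_dual :: "('g::topological_group_add, 'h::chilbert_space) rep set set" where
  "unitary_dual = {\<rho>. irreducible_rep \<rho>} //
     {(\<rho>, \<sigma>). irreducible_rep \<rho> \<and> irreducible_rep \<sigma> \<and> equivalent_reps \<rho> \<sigma>}"

text \<open>
  Mackey Borel structure: the irreducible representations on a fixed Hilbert space \<open>K\<close> carry the
  smallest sigma-algebra making all matrix coefficients measurable, and the dual carries the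
  quotient structure. Instead of one \<open>K\<close> in each dimension we let \<open>K\<close> run through all closed
  subspaces, which is the same by transport along unitaries. The family of sets below already is a
  sigma-algebra.
\<close>

definition irreps_on ::
  "'h::chilbert_space set \<Rightarrow> ('g::topological_group_add \<Rightarrow> 'h \<Rightarrow> 'h) measure" where
  "irreps_on K = sigma {\<pi>. irreducible_rep (K, \<pi>)}
     {{\<pi>. irreducible_rep (K, \<pi>) \<and> cinner (\<pi> x v) w \<in> S} | x v w S. v \<in> K \<and> w \<in> K \<and> open S}"

definition mackey_borel :: "('g::topological_group_add, 'h::chilbert_space) rep set measure" where
  "mackey_borel = sigma unitary_dual
     {E. E \<subseteq> unitary_dual \<and> (\<forall>K. hilbert_subspace K \<longrightarrow> {\<pi>. (K, \<pi>) \<in> \<Union>E} \<in> sets (irreps_on K))}"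

text \<open>
  Type I: every primary (factor) representation is a direct sum of copies of one irreducible
  representation.
\<close>

definition commutant ::
  "('g, 'h::chilbert_space) rep \<Rightarrow> ('h \<Rightarrow> 'h) set" where
  "commutant \<rho> = (case \<rho> of (H, \<pi>) \<Rightarrow>
     {T. bounded_op H T \<and> (\<forall>x. \<forall>v\<in>H. T (\<pi> x v) = \<pi> x (T v))})"

definition primary_rep :: "('g::topological_group_add, 'h::chilbert_space) rep \<Rightarrow> bool" where
  "primary_rep \<rho> \<longleftrightarrow> unitary_rep \<rho> \<and> fst \<rho> \<noteq> {0} \<and>
     (\<forall>T\<in>commutant \<rho>. (\<forall>S\<in>commutant \<rho>. \<forall>v\<in>fst \<rho>. T (S v) = S (T v)) \<longrightarrow>
        (\<exists>c. \<forall>v\<in>fst \<rho>. T v = c *\<^sub>C v))"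

definition multiple_of_irreducible :: "('g::topological_group_add, 'h::chilbert_space) rep \<Rightarrow> bool" where
  "multiple_of_irreducible \<rho> \<longleftrightarrow> (case \<rho> of (H, \<pi>) \<Rightarrow> (\<exists>\<K>.
     (\<forall>K\<in>\<K>. K \<subseteq> H \<and> irreducible_rep (K, \<pi>)) \<and>
     (\<forall>K\<in>\<K>. \<forall>L\<in>\<K>. equivalent_reps (K, \<pi>) (L, \<pi>)) \<and>
     (\<forall>K\<in>\<K>. \<forall>L\<in>\<K>. K \<noteq> L \<longrightarrow> (\<forall>v\<in>K. \<forall>w\<in>L. cinner v w = 0)) \<and>
     closure (csubspace hull \<Union>\<K>) = H))"

definition type_I_group :: "'g::topological_group_add itself \<Rightarrow> 'h::chilbert_space itself \<Rightarrow> bool" where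
  "type_I_group _ _ \<longleftrightarrow> (\<forall>\<rho> :: ('g, 'h) rep. primary_rep \<rho> \<longrightarrow> multiple_of_irreducible \<rho>)"

definition integrated_rep ::
  "'g measure \<Rightarrow> ('g \<Rightarrow> 'h \<Rightarrow> 'h) \<Rightarrow> ('g \<Rightarrow> complex) \<Rightarrow>
   'h::{chilbert_space, second_countable_topology} \<Rightarrow> 'h" where
  "integrated_rep M \<pi> f v = (\<integral>y. f y *\<^sub>C \<pi> y v \<partial>M)"

section \<open>Measurable fields and direct integrals\<close>

text \<open>
  A measurable field of Hilbert spaces \<open>H\<close> is given with a fundamental sequence \<open>e\<close> of sections.
\<close>

definition hilbert_field ::
  "'x measure \<Rightarrow> ('x \<Rightarrow> 'h::chilbert_space set) \<Rightarrow> (nat \<Rightarrow> 'x \<Rightarrow> 'h) \<Rightarrow> bool" where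
  "hilbert_field N H e \<longleftrightarrow>
     (\<forall>\<xi>\<in>space N. hilbert_subspace (H \<xi>) \<and> closure (csubspace hull range (\<lambda>n. e n \<xi>)) = H \<xi>) \<and>
     (\<forall>m n. (\<lambda>\<xi>. cinner (e m \<xi>) (e n \<xi>)) \<in> borel_measurable N)"

definition measurable_op_field ::
  "'x measure \<Rightarrow> (nat \<Rightarrow> 'x \<Rightarrow> 'h::chilbert_space) \<Rightarrow> ('x \<Rightarrow> 'h \<Rightarrow> 'h) \<Rightarrow> bool" where
  "measurable_op_field N e F \<longleftrightarrow>
     (\<forall>m n. (\<lambda>\<xi>. cinner (F \<xi> (e m \<xi>)) (e n \<xi>)) \<in> borel_measurable N)"

text \<open>Elements are fields of operators; equality is equality on \<open>H \<xi>\<close> for almost every \<open>\<xi>\<close>.\<close>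

definition B2_space ::
  "'x measure \<Rightarrow> ('x \<Rightarrow> 'h::chilbert_space set) \<Rightarrow> (nat \<Rightarrow> 'x \<Rightarrow> 'h) \<Rightarrow> ('x \<Rightarrow> 'h \<Rightarrow> 'h) set" where
  "B2_space N H e = {F. measurable_op_field N e F \<and> (AE \<xi> in N. hilbert_schmidt (H \<xi>) (F \<xi>)) \<and>
     integrable N (\<lambda>\<xi>. (hs_norm (H \<xi>) cinner (F \<xi>))\<^sup>2)}"

definition B2_inner ::
  "'x measure \<Rightarrow> ('x \<Rightarrow> 'h::chilbert_space set) \<Rightarrow> ('x \<Rightarrow> 'h \<Rightarrow> 'h) \<Rightarrow> ('x \<Rightarrow> 'h \<Rightarrow> 'h) \<Rightarrow> complex" where
  "B2_inner N H F G = (\<integral>\<xi>. op_trace (H \<xi>) (F \<xi> \<circ> adjoint_op (H \<xi>) (G \<xi>)) \<partial>N)"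

text \<open>
  A field in this space may consist of operators that are only defined on the range of
  \<open>D\<^sup>1\<^sup>/\<^sup>2\<close>; its measurability is therefore expressed by that of the extension of \<open>F D\<^sup>1\<^sup>/\<^sup>2\<close>.
  Here \<open>S\<close> is the field of the operators \<open>D\<^sup>1\<^sup>/\<^sup>2\<close>.
\<close>

definition B1_space ::
  "'x measure \<Rightarrow> ('x \<Rightarrow> 'h::chilbert_space set) \<Rightarrow> (nat \<Rightarrow> 'x \<Rightarrow> 'h) \<Rightarrow> ('x \<Rightarrow> ('h \<times> 'h) set) \<Rightarrow>
   ('x \<Rightarrow> 'h \<Rightarrow> 'h) set" where
  "B1_space N H e S = {F. measurable_op_field N e (\<lambda>\<xi>. op_ext (H \<xi>) (F \<xi>) (S \<xi>)) \<and>
     (AE \<xi> in N. \<exists>T. trace_class (H \<xi>) T \<and> extends_prod T (F \<xi>) (S \<xi>)) \<and>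
     integrable N (\<lambda>\<xi>. trace_norm (H \<xi>) (op_ext (H \<xi>) (F \<xi>) (S \<xi>)))}"

section \<open>Plancherel data\<close>

text \<open>The trace of \<open>F D\<^sup>1\<^sup>/\<^sup>2 \<pi>(z)\<^sup>*\<close>\<close>

definition tr_pi ::
  "'h::chilbert_space set \<Rightarrow> ('h \<times> 'h) set \<Rightarrow> ('g \<Rightarrow> 'h \<Rightarrow> 'h) \<Rightarrow> ('h \<Rightarrow> 'h) \<Rightarrow> 'g \<Rightarrow> complex" where
  "tr_pi H S \<pi> F z = op_trace H (op_ext H F S \<circ> adjoint_op H (\<pi> z))"

text \<open>
  \<open>P\<close> is the unitary extension of the Plancherel transform. The measures \<open>M\<close>, \<open>N\<close> will be the
  completions of the Haar measure and of the Plancherel measure: many of the functions to be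
  integrated are only determined almost everywhere, so they need not be measurable with respect to
  the Borel structures themselves. \<open>S\<close> is the field of the operators \<open>D\<^sup>1\<^sup>/\<^sup>2\<close>.
\<close>

definition plancherel_transform ::
  "'g measure \<Rightarrow> 'x measure \<Rightarrow> ('x \<Rightarrow> 'h::{chilbert_space, second_countable_topology} set) \<Rightarrow>
   (nat \<Rightarrow> 'x \<Rightarrow> 'h) \<Rightarrow> ('x \<Rightarrow> 'g \<Rightarrow> 'h \<Rightarrow> 'h) \<Rightarrow> ('x \<Rightarrow> ('h \<times> 'h) set) \<Rightarrow>
   (('g \<Rightarrow> complex) \<Rightarrow> 'x \<Rightarrow> 'h \<Rightarrow> 'h) \<Rightarrow> bool" where
  "plancherel_transform M N H e \<pi> S P \<longleftrightarrow>
     (\<forall>f\<in>L2 M. integrable M f \<longrightarrow>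
        (AE \<xi> in N. hilbert_schmidt (H \<xi>) (P f \<xi>) \<and>
           extends_prod (P f \<xi>) (integrated_rep M (\<pi> \<xi>) f) (S \<xi>)) \<and>
        (L2_norm M f)\<^sup>2 = (\<integral>\<xi>. (hs_norm (H \<xi>) cinner (P f \<xi>))\<^sup>2 \<partial>N)) \<and>
     (\<forall>f\<in>L2 M. P f \<in> B2_space N H e) \<and>
     (\<forall>f\<in>L2 M. \<forall>g\<in>L2 M. \<forall>a b. AE \<xi> in N. \<forall>v\<in>H \<xi>.
        P (\<lambda>x. a * f x + b * g x) \<xi> v = a *\<^sub>C P f \<xi> v + b *\<^sub>C P g \<xi> v) \<and>
     (\<forall>f\<in>L2 M. \<forall>g\<in>L2 M. B2_inner N H (P f) (P g) = L2_inner M f g) \<and>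
     (\<forall>F\<in>B2_space N H e. \<exists>f\<in>L2 M. AE \<xi> in N. \<forall>v\<in>H \<xi>. P f \<xi> v = F \<xi> v)"

definition plancherel_inversion ::
  "'g measure \<Rightarrow> 'x measure \<Rightarrow> ('x \<Rightarrow> 'h::{chilbert_space, second_countable_topology} set) \<Rightarrow>
   (nat \<Rightarrow> 'x \<Rightarrow> 'h) \<Rightarrow> ('x \<Rightarrow> 'g \<Rightarrow> 'h \<Rightarrow> 'h) \<Rightarrow> ('x \<Rightarrow> ('h \<times> 'h) set) \<Rightarrow>
   (('g \<Rightarrow> complex) \<Rightarrow> 'x \<Rightarrow> 'h \<Rightarrow> 'h) \<Rightarrow> bool" where
  "plancherel_inversion M N H e \<pi> S P \<longleftrightarrow>
     (\<forall>F \<in> B1_space N H e S \<inter> B2_space N H e. \<forall>f\<in>L2 M.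
        (AE \<xi> in N. \<forall>v\<in>H \<xi>. P f \<xi> v = F \<xi> v) \<longrightarrow>
        (AE x in M. integrable N (\<lambda>\<xi>. tr_pi (H \<xi>) (S \<xi>) (\<pi> \<xi>) (F \<xi>) x) \<and>
           f x = (\<integral>\<xi>. tr_pi (H \<xi>) (S \<xi>) (\<pi> \<xi>) (F \<xi>) x \<partial>N)))"

text \<open>
  \<open>D\<close> is the field of Duflo-Moore operators and \<open>S\<close> that of their positive square roots, which
  exist and are uniquely determined by \<open>D\<close>. A field of positive self-adjoint operators is
  measurable if the field of resolvents is.
\<close>

definition plancherel_data ::
  "'g::topological_group_add measure \<Rightarrow> ('g \<Rightarrow> real) \<Rightarrow> ('g, 'h) rep set measure \<Rightarrow>
   (('g, 'h) rep set \<Rightarrow> 'h::{chilbert_space, second_countable_topology} set) \<Rightarrow>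
   (nat \<Rightarrow> ('g, 'h) rep set \<Rightarrow> 'h) \<Rightarrow> (('g, 'h) rep set \<Rightarrow> 'g \<Rightarrow> 'h \<Rightarrow> 'h) \<Rightarrow>
   (('g, 'h) rep set \<Rightarrow> ('h \<times> 'h) set) \<Rightarrow> (('g, 'h) rep set \<Rightarrow> ('h \<times> 'h) set) \<Rightarrow> bool" where
  "plancherel_data \<mu> \<Delta> \<nu> H e \<pi> D S \<longleftrightarrow>
     sets \<nu> = sets mackey_borel \<and> sigma_finite_measure \<nu> \<and>
     hilbert_field (completion \<nu>) H e \<and>
     (\<forall>\<xi>\<in>unitary_dual. (H \<xi>, \<pi> \<xi>) \<in> \<xi>) \<and>
     (\<forall>x. measurable_op_field (completion \<nu>) e (\<lambda>\<xi>. \<pi> \<xi> x)) \<and>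
     (\<forall>\<xi>\<in>unitary_dual. pos_self_adjoint (H \<xi>) (D \<xi>) \<and> H \<xi> \<subseteq> closure (Range (D \<xi>)) \<and>
        is_sqrt_op (H \<xi>) (D \<xi>) (S \<xi>)) \<and>
     measurable_op_field (completion \<nu>) e (\<lambda>\<xi>. resolvent_op (D \<xi>)) \<and>
     (AE \<xi> in \<nu>. \<forall>x. map_prod (\<pi> \<xi> x) (\<pi> \<xi> x) ` D \<xi> = map_prod id (\<lambda>w. (1 / \<Delta> x) *\<^sub>R w) ` D \<xi>) \<and>
     (\<exists>P. plancherel_transform (completion \<mu>) (completion \<nu>) H e \<pi> S P \<and>
          plancherel_inversion (completion \<mu>) (completion \<nu>) H e \<pi> S P)"

section \<open>Symbols and their quantization\<close>

text \<open>Finite sums of elementary tensors, up to equality almost everywhere.\<close>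

definition symbols ::
  "'g measure \<Rightarrow> 'x measure \<Rightarrow> ('x \<Rightarrow> 'h::chilbert_space set) \<Rightarrow> (nat \<Rightarrow> 'x \<Rightarrow> 'h) \<Rightarrow>
   ('x \<Rightarrow> ('h \<times> 'h) set) \<Rightarrow> ('g \<Rightarrow> 'x \<Rightarrow> 'h \<Rightarrow> 'h) set" where
  "symbols \<mu> \<nu> H e S = {A. \<exists>n (f :: nat \<Rightarrow> 'g \<Rightarrow> complex) F.
     (\<forall>k<n. f k \<in> L2 (completion \<mu>) \<and>
        F k \<in> B1_space (completion \<nu>) H e S \<inter> B2_space (completion \<nu>) H e) \<and>
     (AE (x, \<xi>) in \<mu> \<Otimes>\<^sub>M \<nu>. \<forall>v\<in>H \<xi>. A x \<xi> v = (\<Sum>k<n. f k x *\<^sub>C F k \<xi> v))}"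

definition symbol_inner ::
  "'g measure \<Rightarrow> 'x measure \<Rightarrow> ('x \<Rightarrow> 'h::chilbert_space set) \<Rightarrow>
   ('g \<Rightarrow> 'x \<Rightarrow> 'h \<Rightarrow> 'h) \<Rightarrow> ('g \<Rightarrow> 'x \<Rightarrow> 'h \<Rightarrow> 'h) \<Rightarrow> complex" where
  "symbol_inner \<mu> \<nu> H A B = (\<integral>x. (\<integral>\<xi>. op_trace (H \<xi>) (A x \<xi> \<circ> adjoint_op (H \<xi>) (B x \<xi>))
     \<partial>completion \<nu>) \<partial>completion \<mu>)"

definition symbol_norm ::
  "'g measure \<Rightarrow> 'x measure \<Rightarrow> ('x \<Rightarrow> 'h::chilbert_space set) \<Rightarrow> ('g \<Rightarrow> 'x \<Rightarrow> 'h \<Rightarrow> 'h) \<Rightarrow> real" where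
  "symbol_norm \<mu> \<nu> H A = sqrt (Re (symbol_inner \<mu> \<nu> H A A))"

definition ker_symbol ::
  "('g::group_add \<Rightarrow> real) \<Rightarrow> 'x measure \<Rightarrow> ('x \<Rightarrow> 'h::chilbert_space set) \<Rightarrow>
   ('x \<Rightarrow> 'g \<Rightarrow> 'h \<Rightarrow> 'h) \<Rightarrow> ('x \<Rightarrow> ('h \<times> 'h) set) \<Rightarrow>
   ('g \<Rightarrow> 'x \<Rightarrow> 'h \<Rightarrow> 'h) \<Rightarrow> 'g \<times> 'g \<Rightarrow> complex" where
  "ker_symbol \<Delta> \<nu> H \<pi> S A = (\<lambda>(x, y). complex_of_real (\<Delta> y powr (- 1 / 2)) *
     (\<integral>\<xi>. tr_pi (H \<xi>) (S \<xi>) (\<pi> \<xi>) (A x \<xi>) (x - y) \<partial>completion \<nu>))"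

definition Op_symbol ::
  "'g::group_add measure \<Rightarrow> ('g \<Rightarrow> real) \<Rightarrow> 'x measure \<Rightarrow> ('x \<Rightarrow> 'h::chilbert_space set) \<Rightarrow>
   ('x \<Rightarrow> 'g \<Rightarrow> 'h \<Rightarrow> 'h) \<Rightarrow> ('x \<Rightarrow> ('h \<times> 'h) set) \<Rightarrow>
   ('g \<Rightarrow> 'x \<Rightarrow> 'h \<Rightarrow> 'h) \<Rightarrow> ('g \<Rightarrow> complex) \<Rightarrow> 'g \<Rightarrow> complex" where
  "Op_symbol \<mu> \<Delta> \<nu> H \<pi> S A u x =
     (\<integral>y. (\<integral>\<xi>. tr_pi (H \<xi>) (S \<xi>) (\<pi> \<xi>) (A x \<xi>) (x - y) *
        complex_of_real (\<Delta> y powr (- 1 / 2)) * u y \<partial>completion \<nu>) \<partial>completion \<mu>)"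

end

theory Submission
  imports Defs "HOL-Library.Function_Algebras"
begin

text \<open>
  Comments write the group multiplicatively. For almost every \<open>x\<close> let \<open>\<Phi>(x, \<cdot>)\<close> be the inverse Plancherel transform of the field \<open>A(x, \<cdot>)\<close>.
  By the inversion formula the inner integral in the kernel is \<open>\<Phi>(x, x y\<^sup>-\<^sup>1)\<close>, so that
  \<open>ker\<^sub>A(x, y) = \<Delta>(y)\<^sup>-\<^sup>1\<^sup>/\<^sup>2 \<Phi>(x, x y\<^sup>-\<^sup>1)\<close> almost everywhere. The measure \<open>\<Delta>(y)\<^sup>-\<^sup>1 dy\<close> is the image of
  Haar measure under inversion; hence the substitution \<open>z = x y\<^sup>-\<^sup>1\<close> shows that the kernel and \<open>\<Phi>\<close> have
  the same norm in \<open>L\<^sup>2(G \<times> G)\<close>. The Plancherel identity in each fibre says that this is the norm of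
  the symbol, and an operator with a square integrable kernel is Hilbert-Schmidt with the norm of its
  kernel.

  The analytic content lies in the following places. The function \<open>\<Phi>\<close> is a finite sum of products,
  and identifying the inner integral with it needs the trace of \<open>F(\<xi>) D\<^sub>\<xi>\<^sup>1\<^sup>/\<^sup>2 \<pi>\<^sub>\<xi>(z)\<^sup>*\<close> to be
  additive in \<open>F\<close>, hence the convergence of the diagonal sum of a trace-class operator times a unitary
  one (\<open>trace_class_diagonal_summable\<close>, \<open>tr_pi_linear_comb\<close>, \<open>symbol_fibre_identities\<close>). The
  substitution rests on the inversion formula for Haar measure (\<open>nn_integral_uminus\<close>), which is
  derived from translation behaviour alone. The Hilbert-Schmidt norm is defined by a sum over an
  orthonormal basis of \<open>L\<^sup>2(G)\<close>, so one needs that \<open>L\<^sup>2\<close> is complete, that bases exist and satisfy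
  the Parseval identity, and that they are countable (\<open>complete_inner_space_L2\<close>, \<open>parseval\<close>,
  \<open>countable_orthonormal_L2\<close>, \<open>T_hs_sum\<close>).
\<close>

section \<open>Inner product spaces on a carrier\<close>

lemma cnj_mult_self: "cnj z * z = complex_of_real ((cmod z)\<^sup>2)"
  by (metis complex_norm_square mult.commute)

text \<open>
  Three spaces are treated alike: a closed subspace of a Hilbert space with \<open>cinner\<close>, the same
  subspace with the degenerate form \<open>\<langle>S u, w\<rangle>\<close> of a positive operator \<open>S\<close>, and square integrable
  functions, where null functions have norm zero. Hence the carrier, the scalar multiplication and
  the form are parameters, and nothing forces a vector of norm zero to vanish.
\<close>

locale semi_inner_space =
  fixes V :: "'v::ab_group_add set"
    and sc :: "complex \<Rightarrow> 'v \<Rightarrow> 'v"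
    and ip :: "'v \<Rightarrow> 'v \<Rightarrow> complex"
  assumes zero_mem: "0 \<in> V"
    and add_mem: "x \<in> V \<Longrightarrow> y \<in> V \<Longrightarrow> x + y \<in> V"
    and sc_mem: "x \<in> V \<Longrightarrow> sc c x \<in> V"
    and sc_minus: "x \<in> V \<Longrightarrow> sc (-1) x = - x"
    and ip_add_left: "x \<in> V \<Longrightarrow> y \<in> V \<Longrightarrow> z \<in> V \<Longrightarrow> ip (x + y) z = ip x z + ip y z"
    and ip_sc_left: "x \<in> V \<Longrightarrow> y \<in> V \<Longrightarrow> ip (sc c x) y = c * ip x y"
    and ip_commute: "x \<in> V \<Longrightarrow> y \<in> V \<Longrightarrow> ip y x = cnj (ip x y)"
    and ip_nonneg: "x \<in> V \<Longrightarrow> 0 \<le> Re (ip x x)"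
begin

definition sq :: "'v \<Rightarrow> real" where "sq x = Re (ip x x)"

definition orthonormal :: "'v set \<Rightarrow> bool" where
  "orthonormal B \<longleftrightarrow> B \<subseteq> V \<and> (\<forall>b\<in>B. ip b b = 1) \<and> (\<forall>b\<in>B. \<forall>c\<in>B. b \<noteq> c \<longrightarrow> ip b c = 0)"

definition proj :: "'v set \<Rightarrow> 'v \<Rightarrow> 'v" where
  "proj F v = (\<Sum>b\<in>F. sc (ip v b) b)"

lemma uminus_mem: "x \<in> V \<Longrightarrow> - x \<in> V"
  using sc_mem[of x "-1"] sc_minus by simp

lemma diff_mem: "x \<in> V \<Longrightarrow> y \<in> V \<Longrightarrow> x - y \<in> V"
  using add_mem[of x "- y"] uminus_mem by simp

lemma sum_mem: "(\<And>i. i \<in> I \<Longrightarrow> f i \<in> V) \<Longrightarrow> sum f I \<in> V"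
  by (induction I rule: infinite_finite_induct) (auto simp: zero_mem add_mem)

lemma ip_zero_left: "x \<in> V \<Longrightarrow> ip 0 x = 0"
  using ip_add_left[OF zero_mem zero_mem] by simp

lemma ip_uminus_left: "x \<in> V \<Longrightarrow> y \<in> V \<Longrightarrow> ip (- x) y = - ip x y"
  using ip_sc_left[of x y "-1"] sc_minus by simp

lemma ip_diff_left: "x \<in> V \<Longrightarrow> y \<in> V \<Longrightarrow> z \<in> V \<Longrightarrow> ip (x - y) z = ip x z - ip y z"
  using ip_add_left[of x "- y" z] uminus_mem ip_uminus_left by simp

lemma ip_add_right: "x \<in> V \<Longrightarrow> y \<in> V \<Longrightarrow> z \<in> V \<Longrightarrow> ip z (x + y) = ip z x + ip z y"
  using ip_commute[of "x + y" z] ip_commute[of x z] ip_commute[of y z] ip_add_left[of x y z] add_mem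
  by simp

lemma ip_diff_right: "x \<in> V \<Longrightarrow> y \<in> V \<Longrightarrow> z \<in> V \<Longrightarrow> ip z (x - y) = ip z x - ip z y"
  using ip_commute[of "x - y" z] ip_commute[of x z] ip_commute[of y z] ip_diff_left[of x y z] diff_mem
  by simp

lemma ip_sc_right: "x \<in> V \<Longrightarrow> y \<in> V \<Longrightarrow> ip y (sc c x) = cnj c * ip y x"
  using ip_commute[of "sc c x" y] ip_commute[of x y] ip_sc_left[of x y c] sc_mem by simp

lemma ip_sum_left:
  "(\<And>i. i \<in> I \<Longrightarrow> f i \<in> V) \<Longrightarrow> z \<in> V \<Longrightarrow> ip (sum f I) z = (\<Sum>i\<in>I. ip (f i) z)"
  by (induction I rule: infinite_finite_induct) (auto simp: ip_zero_left ip_add_left sum_mem)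

lemma ip_sum_right:
  "(\<And>i. i \<in> I \<Longrightarrow> f i \<in> V) \<Longrightarrow> z \<in> V \<Longrightarrow> ip z (sum f I) = (\<Sum>i\<in>I. ip z (f i))"
proof -
  assume f: "\<And>i. i \<in> I \<Longrightarrow> f i \<in> V" and z: "z \<in> V"
  have "ip (sum f I) z = (\<Sum>i\<in>I. ip (f i) z)"
    by (rule ip_sum_left) (use f z in auto)
  moreover have "ip z (sum f I) = cnj (ip (sum f I) z)"
    by (rule ip_commute[OF sum_mem z]) (rule f)
  ultimately have "ip z (sum f I) = cnj (\<Sum>i\<in>I. ip (f i) z)" by simp
  also have "\<dots> = (\<Sum>i\<in>I. ip z (f i))"
    unfolding cnj_sum by (intro sum.cong refl ip_commute[symmetric] f z)
  finally show ?thesis .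
qed

lemma ip_self:
  assumes "x \<in> V"
  shows "ip x x = complex_of_real (sq x)"
  using arg_cong[OF ip_commute[OF assms assms], of Im] by (simp add: complex_eq_iff sq_def)

lemma sq_nonneg: "x \<in> V \<Longrightarrow> 0 \<le> sq x"
  by (simp add: sq_def ip_nonneg)

lemma sq_sc: "x \<in> V \<Longrightarrow> sq (sc c x) = (cmod c)\<^sup>2 * sq x"
proof -
  assume x: "x \<in> V"
  have "ip (sc c x) (sc c x) = (c * cnj c) * ip x x"
    using x by (simp add: ip_sc_left ip_sc_right sc_mem)
  then have "Re (ip (sc c x) (sc c x)) = Re (complex_of_real ((cmod c)\<^sup>2 * sq x))"
    using cnj_mult_self[of c] ip_self[OF x] by (simp only: of_real_mult mult.commute)
  then show ?thesis by (simp only: sq_def[symmetric] Re_complex_of_real)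
qed

lemma sq_diff: "x \<in> V \<Longrightarrow> y \<in> V \<Longrightarrow> sq (x - y) = sq x + sq y - 2 * Re (ip x y)"
  using ip_commute[of x y]
  by (simp add: sq_def ip_diff_left ip_diff_right diff_mem)

lemma sq_add: "x \<in> V \<Longrightarrow> y \<in> V \<Longrightarrow> sq (x + y) = sq x + sq y + 2 * Re (ip x y)"
  using ip_commute[of x y]
  by (simp add: sq_def ip_add_left ip_add_right add_mem)

lemma sq_add_le: "x \<in> V \<Longrightarrow> y \<in> V \<Longrightarrow> sq (x + y) \<le> 2 * sq x + 2 * sq y"
  using sq_diff[of x y] sq_add[of x y] sq_nonneg[OF diff_mem, of x y] by simp

lemma cauchy_schwarz:
  assumes x: "x \<in> V" and y: "y \<in> V"
  shows "(cmod (ip x y))\<^sup>2 \<le> sq x * sq y"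
proof -
  have gen: "0 \<le> sq x + t\<^sup>2 * (cmod (ip x y))\<^sup>2 * sq y - 2 * t * (cmod (ip x y))\<^sup>2" for t :: real
  proof -
    let ?c = "complex_of_real t * ip x y"
    have "0 \<le> sq (x - sc ?c y)"
      by (intro sq_nonneg diff_mem sc_mem x y)
    also have "\<dots> = sq x + (cmod ?c)\<^sup>2 * sq y - 2 * Re (cnj ?c * ip x y)"
      using x y by (simp add: sq_diff sq_sc sc_mem ip_sc_right)
    also have "cnj ?c * ip x y = complex_of_real (t * (cmod (ip x y))\<^sup>2)"
      using cnj_mult_self[of "ip x y"] by simp
    finally show ?thesis
      by (simp add: norm_mult power_mult_distrib)
  qed
  let ?a = "(cmod (ip x y))\<^sup>2"
  show ?thesis
  proof (cases "sq y = 0")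
    case True
    show ?thesis
    proof (rule ccontr)
      assume "\<not> ?thesis"
      then have a: "?a > 0" using True by auto
      have "0 \<le> sq x - 2 * ((sq x + 1) / (2 * ?a)) * ?a"
        using gen[of "(sq x + 1) / (2 * ?a)"] True by simp
      then show False using a by simp
    qed
  next
    case False
    then have p: "sq y > 0" using sq_nonneg[OF y] by simp
    have "(1 / sq y)\<^sup>2 * ?a * sq y = ?a / sq y"
      using p by (simp add: power2_eq_square)
    then have "?a / sq y \<le> sq x"
      using gen[of "1 / sq y"] by simp
    then show ?thesis using p by (simp add: pos_divide_le_eq)
  qed
qed

lemma ip_eq_0_if_sq_eq_0: "x \<in> V \<Longrightarrow> y \<in> V \<Longrightarrow> sq x = 0 \<Longrightarrow> ip x y = 0"
  using cauchy_schwarz[of x y] by simp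

lemma orthonormal_subset: "orthonormal B \<Longrightarrow> F \<subseteq> B \<Longrightarrow> orthonormal F"
  unfolding orthonormal_def by (meson subsetD order_trans)

lemma orthonormalD:
  assumes "orthonormal B"
  shows "b \<in> B \<Longrightarrow> b \<in> V" "b \<in> B \<Longrightarrow> c \<in> B \<Longrightarrow> ip b c = (if b = c then 1 else 0)"
proof -
  note D = assms[unfolded orthonormal_def]
  note B = conjunct1[OF D] conjunct1[OF conjunct2[OF D]] conjunct2[OF conjunct2[OF D]]
  show "b \<in> B \<Longrightarrow> b \<in> V" using B(1) by blast
  assume "b \<in> B" "c \<in> B"
  then show "ip b c = (if b = c then 1 else 0)"
    using B(2)[rule_format, of b] B(3)[rule_format, of b c] by (cases "b = c") simp_all
qed

lemma ip_comb:
  assumes B: "orthonormal F" and F: "finite F" and b: "b \<in> F"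
  shows "ip (\<Sum>c\<in>F. sc (a c) c) b = a b"
proof -
  have "ip (\<Sum>c\<in>F. sc (a c) c) b = (\<Sum>c\<in>F. a c * ip c b)"
    using orthonormalD(1)[OF B] b
    by (subst ip_sum_left) (auto simp: sc_mem ip_sc_left)
  also have "\<dots> = (\<Sum>c\<in>F. if c = b then a c else 0)"
    using orthonormalD(2)[OF B] b by (intro sum.cong) auto
  finally show ?thesis using F b by simp
qed

lemma sq_comb:
  assumes B: "orthonormal F" and F: "finite F"
  shows "sq (\<Sum>c\<in>F. sc (a c) c) = (\<Sum>c\<in>F. (cmod (a c))\<^sup>2)"
proof -
  have m: "(\<Sum>c\<in>F. sc (a c) c) \<in> V"
    using orthonormalD(1)[OF B] by (intro sum_mem sc_mem)
  have "ip (\<Sum>c\<in>F. sc (a c) c) (\<Sum>c\<in>F. sc (a c) c) =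
      (\<Sum>b\<in>F. cnj (a b) * ip (\<Sum>c\<in>F. sc (a c) c) b)"
    using orthonormalD(1)[OF B] m
    by (subst ip_sum_right) (auto simp: sc_mem ip_sc_right)
  also have "\<dots> = (\<Sum>b\<in>F. complex_of_real ((cmod (a b))\<^sup>2))"
    using ip_comb[OF B F] by (intro sum.cong) (auto simp: cnj_mult_self)
  finally have "ip (\<Sum>c\<in>F. sc (a c) c) (\<Sum>c\<in>F. sc (a c) c) =
      complex_of_real (\<Sum>c\<in>F. (cmod (a c))\<^sup>2)"
    by (simp only: of_real_sum)
  then show ?thesis
    by (simp add: sq_def del: of_real_sum)
qed

lemma proj_mem: "orthonormal F \<Longrightarrow> proj F v \<in> V"
  unfolding proj_def using orthonormalD(1) by (intro sum_mem sc_mem)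

lemma ip_diff_proj:
  assumes "orthonormal F" "finite F" "v \<in> V" "b \<in> F"
  shows "ip (v - proj F v) b = 0"
  using ip_comb[OF assms(1,2,4)] assms proj_mem[OF assms(1)] orthonormalD(1)[OF assms(1,4)]
  by (simp add: ip_diff_left proj_def)

lemma sq_diff_proj:
  assumes B: "orthonormal F" and F: "finite F" and v: "v \<in> V"
  shows "sq (v - proj F v) = sq v - (\<Sum>b\<in>F. (cmod (ip v b))\<^sup>2)"
proof -
  have "ip v (proj F v) = (\<Sum>b\<in>F. cnj (ip v b) * ip v b)"
    unfolding proj_def using orthonormalD(1)[OF B] v
    by (subst ip_sum_right) (auto simp: sc_mem ip_sc_right)
  also have "\<dots> = complex_of_real (\<Sum>b\<in>F. (cmod (ip v b))\<^sup>2)"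
    by (simp add: cnj_mult_self)
  finally show ?thesis
    using sq_diff[OF v proj_mem[OF B], of v] sq_comb[OF B F, of "\<lambda>b. ip v b"]
    by (simp add: proj_def del: of_real_sum)
qed

lemma bessel:
  assumes "orthonormal F" "finite F" "v \<in> V"
  shows "(\<Sum>b\<in>F. (cmod (ip v b))\<^sup>2) \<le> sq v"
  using sq_diff_proj[OF assms] sq_nonneg[OF diff_mem[OF assms(3) proj_mem[OF assms(1)]], of v]
  by simp

lemma bessel_summable:
  assumes "orthonormal B" "v \<in> V"
  shows "(\<lambda>b. (cmod (ip v b))\<^sup>2) summable_on B"
proof (rule nonneg_bdd_above_summable_on)
  show "bdd_above (sum (\<lambda>b. (cmod (ip v b))\<^sup>2) ` {F. F \<subseteq> B \<and> finite F})"
    by (rule bdd_aboveI[of _ "sq v"])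
      (use bessel[OF orthonormal_subset[OF assms(1)] _ assms(2)] in blast)
qed auto

lemma normalize:
  assumes "v \<in> V" "sq v \<noteq> 0"
  shows "ip (sc (complex_of_real (1 / sqrt (sq v))) v) (sc (complex_of_real (1 / sqrt (sq v))) v) = 1"
proof -
  have "sq (sc (complex_of_real (1 / sqrt (sq v))) v) = 1"
    unfolding sq_sc[OF assms(1)] norm_of_real
    using sq_nonneg[OF assms(1)] assms(2) by (simp add: power_divide)
  then show ?thesis by (subst ip_self) (auto simp: sc_mem assms)
qed

lemma orthonormal_insert:
  assumes B: "orthonormal B" and v: "v \<in> V" "ip v v = 1" and o: "\<And>b. b \<in> B \<Longrightarrow> ip v b = 0"
  shows "orthonormal (insert v B)"
proof -
  have o': "ip b v = 0" if "b \<in> B" for b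
    using ip_commute[OF v(1) orthonormalD(1)[OF B that]] o[OF that] by simp
  show ?thesis
    unfolding orthonormal_def
  proof (intro conjI ballI impI)
    show "insert v B \<subseteq> V" using v(1) orthonormalD(1)[OF B] by blast
    show "ip b b = 1" if "b \<in> insert v B" for b
      using that v(2) orthonormalD(2)[OF B, of b b] by (cases "b = v") simp_all
    show "ip b c = 0" if "b \<in> insert v B" "c \<in> insert v B" "b \<noteq> c" for b c
      using that o[of c] o'[of b] orthonormalD(2)[OF B, of b c]
      by (cases "b = v"; cases "c = v") simp_all
  qed
qed

text \<open>
  A vector of norm zero contributes nothing to the orthonormal set, so in a degenerate space the
  vectors of \<open>J\<close> are recovered from their coefficients only up to norm zero. That is all one needs
  in order to expand an operator along \<open>J\<close>, provided that it annihilates the vectors of norm zero.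
\<close>

lemma gram_schmidt:
  assumes "finite J" "J \<subseteq> V"
  shows "\<exists>E. finite E \<and> orthonormal E \<and> (\<forall>v\<in>J. sq (v - proj E v) = 0)"
  using assms
proof (induction J rule: finite_induct)
  case empty
  show ?case by (intro exI[of _ "{}"]) (auto simp: orthonormal_def)
next
  case (insert x J)
  then obtain E where E: "finite E" "orthonormal E" "\<And>v. v \<in> J \<Longrightarrow> sq (v - proj E v) = 0"
    by auto
  have x: "x \<in> V" and J: "J \<subseteq> V" using insert by auto
  define r where "r = x - proj E x"
  have r: "r \<in> V" unfolding r_def by (intro diff_mem x proj_mem E)
  show ?case
  proof (cases "sq r = 0")
    case True
    then show ?thesis using E by (intro exI[of _ E]) (auto simp: r_def)
  next
    case False
    define c where "c = complex_of_real (1 / sqrt (sq r))"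
    define b where "b = sc c r"
    have c: "c \<noteq> 0" using False sq_nonneg[OF r] by (simp add: c_def)
    have b: "b \<in> V" "ip b b = 1"
      using normalize[OF r False] by (auto simp: b_def c_def sc_mem r)
    have rE: "ip r e = 0" if "e \<in> E" for e
      unfolding r_def using ip_diff_proj[OF E(2,1) x that] .
    have bE: "ip b e = 0" if "e \<in> E" for e
      using rE[OF that] that orthonormalD(1)[OF E(2)] r by (simp add: b_def ip_sc_left)
    have bn: "b \<notin> E" using bE b by auto
    have oE: "orthonormal (insert b E)" by (rule orthonormal_insert[OF E(2) b bE])
    have le: "sq (v - proj (insert b E) v) \<le> sq (v - proj E v)" if "v \<in> V" for v
      using that E bn oE by (simp add: sq_diff_proj)
    have pE: "proj (insert b E) v = sc (ip v b) b + proj E v" for v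
      using E bn by (simp add: proj_def)
    have "ip (proj E x) r = 0"
    proof -
      have "ip (proj E x) r = (\<Sum>e\<in>E. ip x e * ip e r)"
        unfolding proj_def using r orthonormalD(1)[OF E(2)]
        by (subst ip_sum_left) (auto simp: sc_mem ip_sc_left)
      also have "\<dots> = 0"
        using rE r ip_commute orthonormalD(1)[OF E(2)] by (intro sum.neutral) (metis complex_cnj_zero mult_zero_right)
      finally show ?thesis .
    qed
    then have "ip x r = ip r r"
      using ip_add_left[OF r proj_mem[OF E(2)] r, of x] by (simp add: r_def)
    then have xb: "ip x b = c * complex_of_real (sq r)"
      using x r by (simp add: b_def ip_sc_right c_def ip_self)
    have "cmod (ip x b) = sq r / sqrt (sq r)"
      using sq_nonneg[OF r] by (simp add: xb c_def norm_mult norm_divide)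
    then have "(cmod (ip x b))\<^sup>2 = sq r"
      using sq_nonneg[OF r] by (simp add: real_div_sqrt)
    then have "sq (x - proj (insert b E) x) = 0"
      using sq_diff_proj[OF oE _ x] sq_diff_proj[OF E(2,1) x] E bn by (simp add: r_def)
    moreover have "sq (v - proj (insert b E) v) = 0" if "v \<in> J" for v
    proof -
      have "v \<in> V" using that J by auto
      then show ?thesis
        using le[of v] E(3)[OF that] sq_nonneg[OF diff_mem[OF \<open>v \<in> V\<close> proj_mem[OF oE]], of v]
        by simp
    qed
    ultimately show ?thesis
      using E oE by (intro exI[of _ "insert b E"]) auto
  qed
qed

text \<open>
  The basis picked by the choice operator exists: a set that is maximal among the orthonormal ones
  cannot be orthogonal to a vector of nonzero norm, since the normalized vector could be added to it.
\<close>

lemma onb_orthonormal_basis: "orthonormal_basis V ip (onb V ip)"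
proof -
  have "\<exists>M\<in>Collect orthonormal. \<forall>X\<in>Collect orthonormal. M \<subseteq> X \<longrightarrow> X = M"
  proof (rule subset_Zorn')
    fix C assume C: "subset.chain (Collect orthonormal) C"
    have o: "orthonormal X" if "X \<in> C" for X
      using C that unfolding subset.chain_def by blast
    have ch: "X \<subseteq> Y \<or> Y \<subseteq> X" if "X \<in> C" "Y \<in> C" for X Y
      using C that unfolding subset.chain_def by blast
    show "\<Union>C \<in> Collect orthonormal"
      unfolding mem_Collect_eq orthonormal_def
    proof (intro conjI ballI impI)
      show "\<Union>C \<subseteq> V" using orthonormalD(1)[OF o] by blast
      show "ip b b = 1" if "b \<in> \<Union>C" for b
        using that orthonormalD(2)[OF o, of _ b b] by auto
      fix b c assume b: "b \<in> \<Union>C" and c: "c \<in> \<Union>C" and ne: "b \<noteq> c"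
      obtain X Y where XY: "X \<in> C" "b \<in> X" "Y \<in> C" "c \<in> Y" using b c by blast
      obtain Z where "Z \<in> C" "b \<in> Z" "c \<in> Z" using ch[OF XY(1,3)] XY by blast
      then show "ip b c = 0" using orthonormalD(2)[OF o, of Z b c] ne by simp
    qed
  qed
  then obtain B where B: "orthonormal B" and max: "\<And>X. orthonormal X \<Longrightarrow> B \<subseteq> X \<Longrightarrow> X = B"
    by auto
  have "ip v v = 0" if v: "v \<in> V" and o: "\<forall>b\<in>B. ip v b = 0" for v
  proof (rule ccontr)
    assume "ip v v \<noteq> 0"
    then have q: "sq v \<noteq> 0" using ip_self[OF v] by auto
    define b where "b = sc (complex_of_real (1 / sqrt (sq v))) v"
    have b: "b \<in> V" "ip b b = 1"
      using normalize[OF v q] v by (auto simp: b_def sc_mem)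
    have bo: "ip b e = 0" if "e \<in> B" for e
      unfolding b_def using o that v orthonormalD(1)[OF B] by (simp add: ip_sc_left)
    have "insert b B = B"
      by (rule max[OF orthonormal_insert[OF B b bo]]) auto
    then show False using bo b by force
  qed
  then have "orthonormal_basis V ip B"
    using B unfolding orthonormal_basis_def orthonormal_def by simp
  then show ?thesis unfolding onb_def by (rule someI[where P = "orthonormal_basis V ip"])
qed

lemma onb_orthonormal: "orthonormal (onb V ip)"
  using onb_orthonormal_basis unfolding orthonormal_basis_def orthonormal_def by simp

lemma onb_maximal:
  assumes "v \<in> V" "\<And>b. b \<in> onb V ip \<Longrightarrow> ip v b = 0"
  shows "sq v = 0"
proof -
  have "\<forall>v\<in>V. (\<forall>b\<in>onb V ip. ip v b = 0) \<longrightarrow> ip v v = 0"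
    using onb_orthonormal_basis unfolding orthonormal_basis_def by (elim conjE) assumption
  then have "ip v v = 0" using assms by blast
  then show ?thesis by (simp add: sq_def)
qed

lemma onb_mem: "b \<in> onb V ip \<Longrightarrow> b \<in> V"
  using onb_orthonormal orthonormalD(1) by blast

end

section \<open>Complete inner product spaces\<close>

locale complete_inner_space = semi_inner_space +
  assumes complete: "\<And>s. (\<And>n. s n \<in> V) \<Longrightarrow>
      (\<And>e. e > 0 \<Longrightarrow> \<exists>N. \<forall>m\<ge>N. \<forall>n\<ge>N. Re (ip (s m - s n) (s m - s n)) < e) \<Longrightarrow>
      \<exists>l\<in>V. (\<lambda>n. Re (ip (s n - l) (s n - l))) \<longlonglongrightarrow> 0"
begin

text \<open>
  Finite parts of the series carrying all but \<open>1 / (n + 1)\<close> of the sum of squares form a Cauchy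
  sequence. They need not increase: a basis vector outside the \<open>n\<close>-th part has a coefficient
  whose square is below \<open>1 / (n + 1)\<close>, so the coefficients of the partial sums still converge.
\<close>

lemma riesz_fischer:
  assumes B: "orthonormal B" and sm: "(\<lambda>b. (cmod (c b))\<^sup>2) summable_on B"
  shows "\<exists>w\<in>V. (\<forall>b\<in>B. ip w b = c b) \<and>
    (\<forall>e>0. \<exists>F. finite F \<and> F \<subseteq> B \<and> sq (w - (\<Sum>b\<in>F. sc (c b) b)) < e)"
proof -
  let ?g = "\<lambda>b. (cmod (c b))\<^sup>2"
  let ?S = "infsum ?g B"
  have "\<exists>F. finite F \<and> F \<subseteq> B \<and> ?S - sum ?g F < 1 / Suc n" for n
  proof -
    have "((sum ?g) \<longlongrightarrow> ?S) (finite_subsets_at_top B)"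
      using has_sum_infsum[OF sm] by (simp add: has_sum_def)
    then have "eventually (\<lambda>F. dist (sum ?g F) ?S < 1 / Suc n) (finite_subsets_at_top B)"
      by (rule tendstoD) simp
    then obtain F where "finite F" "F \<subseteq> B" "dist (sum ?g F) ?S < 1 / Suc n"
      unfolding eventually_finite_subsets_at_top by blast
    then show ?thesis by (intro exI[of _ F]) (auto simp: dist_real_def)
  qed
  then obtain F where F: "\<And>n. finite (F n)" "\<And>n. F n \<subseteq> B" "\<And>n::nat. ?S - sum ?g (F n) < 1 / Suc n"
    by metis
  have oF: "orthonormal (F n)" for n using orthonormal_subset[OF B F(2)] .
  have le: "sum ?g X \<le> ?S" if "finite X" "X \<subseteq> B" for X
    using that by (intro finite_sum_le_infsum sm) auto
  have out: "sum ?g X < 1 / Suc n" if "finite X" "X \<subseteq> B" "X \<inter> F n = {}" for X n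
    using le[of "X \<union> F n"] that F(1,2,3)[of n] by (simp add: sum.union_disjoint)
  define s where "s n = (\<Sum>b\<in>F n. sc (c b) b)" for n
  have s: "s n \<in> V" for n
    unfolding s_def using orthonormalD(1)[OF oF] by (intro sum_mem sc_mem)
  have dec: "s m - s n = (\<Sum>b\<in>F m - F n. sc (c b) b) - (\<Sum>b\<in>F n - F m. sc (c b) b)" for m n
    unfolding s_def sum.Int_Diff[OF F(1), of _ m "F n"] sum.Int_Diff[OF F(1), of _ n "F m"]
    by (simp add: Int_commute)
  have cauchy: "sq (s m - s n) \<le> 2 / Suc n + 2 / Suc m" for m n
  proof -
    let ?x = "\<Sum>b\<in>F m - F n. sc (c b) b" and ?y = "\<Sum>b\<in>F n - F m. sc (c b) b"
    have o: "orthonormal (F m - F n)" "orthonormal (F n - F m)"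
      using orthonormal_subset[OF B] F(2) by (meson Diff_subset order_trans)+
    have m: "?x \<in> V" "?y \<in> V"
      using orthonormalD(1)[OF o(1)] orthonormalD(1)[OF o(2)] by (auto intro!: sum_mem sc_mem)
    have "sq (?x - ?y) \<le> 2 * sq ?x + 2 * sq ?y"
      using sq_diff[OF m] sq_add[OF m] sq_nonneg[OF add_mem[OF m]] by simp
    also have "sq ?x < 1 / Suc n"
      using out[of "F m - F n" n] F(1,2) by (subst sq_comb[OF o(1)]) auto
    also have "sq ?y < 1 / Suc m"
      using out[of "F n - F m" m] F(1,2) by (subst sq_comb[OF o(2)]) auto
    finally show ?thesis unfolding dec by simp
  qed
  have "\<exists>l\<in>V. (\<lambda>n. Re (ip (s n - l) (s n - l))) \<longlonglongrightarrow> 0"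
  proof (rule complete[OF s])
    fix e :: real assume e: "e > 0"
    obtain N where N: "1 / Suc N < e / 4" using e using nat_approx_posE[of "e / 4"] by auto
    have "Re (ip (s m - s n) (s m - s n)) < e" if "m \<ge> N" "n \<ge> N" for m n
    proof -
      have "1 / real (Suc m) \<le> 1 / Suc N" "1 / real (Suc n) \<le> 1 / Suc N"
        using that by (auto intro!: divide_left_mono)
      then show ?thesis using cauchy[of m n] N unfolding sq_def by simp
    qed
    then show "\<exists>N. \<forall>m\<ge>N. \<forall>n\<ge>N. Re (ip (s m - s n) (s m - s n)) < e" by blast
  qed
  then obtain l where l: "l \<in> V" and lim: "(\<lambda>n. sq (s n - l)) \<longlonglongrightarrow> 0"
    unfolding sq_def by blast
  have coeff: "ip l b = c b" if b: "b \<in> B" for b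
  proof -
    have bV: "b \<in> V" "sq b = 1" using b orthonormalD[OF B] by (auto simp: sq_def)
    have 1: "(cmod (ip (s n) b - c b))\<^sup>2 \<le> 1 / Suc n" for n
    proof (cases "b \<in> F n")
      case True
      then show ?thesis unfolding s_def using ip_comb[OF oF F(1) True, of c] by simp
    next
      case False
      have "ip (s n) b = (\<Sum>e\<in>F n. c e * ip e b)"
        unfolding s_def using orthonormalD(1)[OF oF] bV
        by (subst ip_sum_left) (auto simp: sc_mem ip_sc_left)
      also have "\<dots> = 0"
      proof (intro sum.neutral ballI)
        fix e assume e: "e \<in> F n"
        then have "e \<in> B" "e \<noteq> b" using F(2) False by auto
        then show "c e * ip e b = 0" using orthonormalD(2)[OF B _ b, of e] by simp
      qed
      finally show ?thesis using out[of "{b}" n] False b by simp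
    qed
    have 2: "(cmod (ip (s n) b - ip l b))\<^sup>2 \<le> sq (s n - l)" for n
      using cauchy_schwarz[OF diff_mem[OF s l] bV(1), of n] bV s l by (simp add: ip_diff_left)
    have 3: "(cmod (ip l b - c b))\<^sup>2 \<le> 2 / Suc n + 2 * sq (s n - l)" for n
    proof -
      have "cmod (ip l b - c b) \<le> cmod (ip (s n) b - c b) + cmod (ip (s n) b - ip l b)"
        using norm_triangle_ineq4[of "ip (s n) b - c b" "ip (s n) b - ip l b"] by simp
      then have "(cmod (ip l b - c b))\<^sup>2 \<le> (cmod (ip (s n) b - c b) + cmod (ip (s n) b - ip l b))\<^sup>2"
        by (intro power_mono) auto
      also have "\<dots> \<le> 2 * (cmod (ip (s n) b - c b))\<^sup>2 + 2 * (cmod (ip (s n) b - ip l b))\<^sup>2"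
        using sum_squares_bound[of "cmod (ip (s n) b - c b)" "cmod (ip (s n) b - ip l b)"]
        by (simp add: power2_sum)
      finally show ?thesis using 1[of n] 2[of n] by simp
    qed
    have "(\<lambda>n. 2 / real (Suc n) + 2 * sq (s n - l)) \<longlonglongrightarrow> 2 * 0 + 2 * 0"
      using tendsto_mult_left[OF LIMSEQ_inverse_real_of_nat, of 2]
      by (intro tendsto_add tendsto_mult_left[OF lim]) (simp add: divide_inverse)
    then have "(cmod (ip l b - c b))\<^sup>2 \<le> 0"
      using 3 by (intro LIMSEQ_le_const[of "\<lambda>n. 2 / real (Suc n) + 2 * sq (s n - l)"]) auto
    then show ?thesis by simp
  qed
  have appr: "\<exists>X. finite X \<and> X \<subseteq> B \<and> sq (l - (\<Sum>b\<in>X. sc (c b) b)) < e" if "e > 0" for e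
  proof -
    have "eventually (\<lambda>n. sq (s n - l) < e) sequentially"
      using lim that by (rule order_tendstoD)
    then obtain n where "sq (s n - l) < e" by (auto simp: eventually_sequentially)
    moreover have "sq (l - s n) = sq (s n - l)"
      using sq_diff[OF l s, of n] sq_diff[OF s l, of n] ip_commute[OF l s, of n] by simp
    ultimately show ?thesis using F(1,2) by (intro exI[of _ "F n"]) (auto simp: s_def)
  qed
  show ?thesis using l coeff appr by blast
qed

text \<open>
  The Riesz-Fischer vector with the Fourier coefficients of \<open>v\<close> differs from \<open>v\<close> by a vector that
  is orthogonal to \<open>B\<close>, hence of norm zero by maximality.
\<close>

lemma parseval:
  assumes B: "orthonormal B" and max: "\<And>v. v \<in> V \<Longrightarrow> (\<And>b. b \<in> B \<Longrightarrow> ip v b = 0) \<Longrightarrow> sq v = 0"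
    and v: "v \<in> V"
  shows "((\<lambda>b. (cmod (ip v b))\<^sup>2) has_sum sq v) B"
proof -
  let ?g = "\<lambda>b. (cmod (ip v b))\<^sup>2"
  have sm: "?g summable_on B" by (rule bessel_summable[OF B v])
  obtain l where l: "l \<in> V" "\<And>b. b \<in> B \<Longrightarrow> ip l b = ip v b"
    and appr: "\<And>e. e > 0 \<Longrightarrow> \<exists>F. finite F \<and> F \<subseteq> B \<and> sq (l - proj F v) < e"
    using riesz_fischer[OF B sm] unfolding proj_def by blast
  have z: "sq (v - l) = 0"
    using l v orthonormalD(1)[OF B] by (intro max diff_mem) (simp_all add: ip_diff_left)
  have le: "infsum ?g B \<le> sq v"
    using bessel[OF orthonormal_subset[OF B]] v
    by (intro infsum_le_finite_sums[OF sm]) auto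
  have "sq v \<le> infsum ?g B + e" if e: "e > 0" for e
  proof -
    obtain F where F: "finite F" "F \<subseteq> B" "sq (l - proj F v) < e / 2"
      using appr[of "e / 2"] e by auto
    have oF: "orthonormal F" by (rule orthonormal_subset[OF B F(2)])
    have "sq v - sum ?g F = sq ((v - l) + (l - proj F v))"
      using sq_diff_proj[OF oF F(1) v] by simp
    also have "\<dots> \<le> 2 * sq (v - l) + 2 * sq (l - proj F v)"
      by (intro sq_add_le diff_mem v l proj_mem oF)
    also have "\<dots> < e" using z F by simp
    finally show ?thesis using finite_sum_le_infsum[OF sm F(1,2)] by simp
  qed
  then have "sq v \<le> infsum ?g B" by (rule field_le_epsilon)
  then have "infsum ?g B = sq v" using le by simp
  then show ?thesis using has_sum_infsum[OF sm] by simp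
qed

lemma onb_parseval: "v \<in> V \<Longrightarrow> ((\<lambda>b. (cmod (ip v b))\<^sup>2) has_sum sq v) (onb V ip)"
  by (rule parseval[OF onb_orthonormal onb_maximal])

lemma onb_approx:
  assumes v: "v \<in> V" and e: "e > 0"
  shows "\<exists>F. finite F \<and> F \<subseteq> onb V ip \<and> sq (v - proj F v) < e"
proof -
  let ?g = "\<lambda>b. (cmod (ip v b))\<^sup>2"
  have "(sum ?g \<longlongrightarrow> sq v) (finite_subsets_at_top (onb V ip))"
    using onb_parseval[OF v] by (simp add: has_sum_def)
  then have "eventually (\<lambda>F. dist (sum ?g F) (sq v) < e) (finite_subsets_at_top (onb V ip))"
    using e by (rule tendstoD)
  then obtain F where "finite F" "F \<subseteq> onb V ip" "dist (sum ?g F) (sq v) < e"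
    unfolding eventually_finite_subsets_at_top by blast
  then show ?thesis
    using sq_diff_proj[OF orthonormal_subset[OF onb_orthonormal] _ v, of F]
    by (intro exI[of _ F]) (auto simp: dist_real_def)
qed

text \<open>
  Testing \<open>l\<close> on \<open>\<Sum>b\<in>F. cnj (l b) b\<close> shows that the values of \<open>l\<close> on the basis are square
  summable. The vector with the conjugate coefficients represents \<open>l\<close> on the basis, and by
  continuity everywhere.
\<close>

lemma riesz_representation:
  assumes add: "\<And>x y. x \<in> V \<Longrightarrow> y \<in> V \<Longrightarrow> l (x + y) = l x + l y"
    and hom: "\<And>c x. x \<in> V \<Longrightarrow> l (sc c x) = c * l x"
    and C: "C \<ge> 0"
    and bd: "\<And>x. x \<in> V \<Longrightarrow> (cmod (l x))\<^sup>2 \<le> C * sq x"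
  shows "\<exists>w\<in>V. \<forall>x\<in>V. l x = ip x w"
proof -
  let ?B = "onb V ip"
  note oB = onb_orthonormal
  have l0: "l 0 = 0" using add[OF zero_mem zero_mem] by simp
  have lsum: "l (sum f I) = (\<Sum>i\<in>I. l (f i))" if "\<And>i. i \<in> I \<Longrightarrow> f i \<in> V" for f and I :: "'v set"
    using that by (induction I rule: infinite_finite_induct) (auto simp: l0 add sum_mem)
  have fin: "(\<Sum>b\<in>F. (cmod (l b))\<^sup>2) \<le> C" if F: "finite F" "F \<subseteq> ?B" for F
  proof -
    have oF: "orthonormal F" by (rule orthonormal_subset[OF oB F(2)])
    let ?u = "\<Sum>b\<in>F. sc (cnj (l b)) b" and ?s = "\<Sum>b\<in>F. (cmod (l b))\<^sup>2"
    have u: "?u \<in> V" using orthonormalD(1)[OF oF] by (intro sum_mem sc_mem)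
    have "l ?u = (\<Sum>b\<in>F. cnj (l b) * l b)"
      using orthonormalD(1)[OF oF] by (simp add: lsum sc_mem hom)
    also have "\<dots> = complex_of_real ?s"
      by (simp add: cnj_mult_self)
    finally have "cmod (l ?u) = ?s" by (simp add: sum_nonneg del: of_real_sum)
    moreover have "sq ?u = ?s" using sq_comb[OF oF F(1), of "\<lambda>b. cnj (l b)"] by simp
    ultimately have le: "?s\<^sup>2 \<le> C * ?s" using bd[OF u] by simp
    show ?thesis
    proof (cases "?s = 0")
      case True
      then show ?thesis using C by simp
    next
      case False
      then have "?s > 0" by (simp add: sum_nonneg order.not_eq_order_implies_strict)
      then show ?thesis using le by (simp add: power2_eq_square)
    qed
  qed
  have sm: "(\<lambda>b. (cmod (cnj (l b)))\<^sup>2) summable_on ?B"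
    using fin by (intro nonneg_bdd_above_summable_on bdd_aboveI[of _ C]) auto
  obtain w where w: "w \<in> V" "\<And>b. b \<in> ?B \<Longrightarrow> ip w b = cnj (l b)"
    using riesz_fischer[OF oB sm] by blast
  have "l x = ip x w" if x: "x \<in> V" for x
  proof -
    have "(cmod (l x - ip x w))\<^sup>2 \<le> 0 + e" if e: "e > 0" for e
    proof -
      \<comment> \<open>the last summand keeps \<open>K\<close> positive\<close>
      define K where "K = 2 * C + 2 * sq w + 1"
      have K: "K > 0" using C sq_nonneg[OF w(1)] by (simp add: K_def)
      obtain F where F: "finite F" "F \<subseteq> ?B" "sq (x - proj F x) < e / K"
        using onb_approx[OF x, of "e / K"] e K by auto
      have oF: "orthonormal F" by (rule orthonormal_subset[OF oB F(2)])
      note FV = orthonormalD(1)[OF oF]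
      let ?d = "x - proj F x"
      have d: "?d \<in> V" by (intro diff_mem x proj_mem oF)
      have lb: "l b = ip b w" if "b \<in> F" for b
        using w(2)[of b] F(2) that ip_commute[OF w(1) FV[OF that]] by auto
      have "l (proj F x) = ip (proj F x) w"
        unfolding proj_def using FV w(1) lb
        by (simp add: lsum sc_mem hom ip_sum_left ip_sc_left)
      moreover have "x = ?d + proj F x" by simp
      ultimately have eq: "l x - ip x w = l ?d - ip ?d w"
        using add[OF d proj_mem[OF oF]] ip_add_left[OF d proj_mem[OF oF] w(1)]
        by (metis add_diff_cancel_right)
      have "(cmod (l ?d - ip ?d w))\<^sup>2 \<le> (cmod (l ?d) + cmod (ip ?d w))\<^sup>2"
        by (intro power_mono norm_triangle_ineq4) auto
      also have "\<dots> \<le> 2 * (cmod (l ?d))\<^sup>2 + 2 * (cmod (ip ?d w))\<^sup>2"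
        using sum_squares_bound[of "cmod (l ?d)" "cmod (ip ?d w)"] by (simp add: power2_sum)
      also have "\<dots> \<le> 2 * (C * sq ?d) + 2 * (sq ?d * sq w)"
        using bd[OF d] cauchy_schwarz[OF d w(1)] by simp
      also have "\<dots> \<le> K * sq ?d"
        using sq_nonneg[OF d] by (simp add: K_def algebra_simps)
      also have "\<dots> \<le> K * (e / K)" using F(3) K by (intro mult_left_mono) auto
      finally show ?thesis using K eq by simp
    qed
    then have "(cmod (l x - ip x w))\<^sup>2 \<le> 0" by (rule field_le_epsilon)
    then show ?thesis by simp
  qed
  then show ?thesis using w(1) by blast
qed

end

section \<open>Traces and adjoints on closed subspaces\<close>

lemma norm_sq_cinner: "Re (cinner x x) = (norm x)\<^sup>2"
  by (simp add: inner_eq_Re_cinner[symmetric] power2_norm_eq_inner)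

lemma scaleC_minus_one: "(-1::complex) *\<^sub>C x = - x"
  using scaleR_scaleC[of "-1" x] by simp

lemma complete_inner_space_hilbert:
  assumes "hilbert_subspace H"
  shows "complete_inner_space H (*\<^sub>C) cinner"
proof -
  have H: "csubspace H" "closed H" using assms by (auto simp: hilbert_subspace_def)
  show ?thesis
  proof
    fix s :: "nat \<Rightarrow> 'a"
    assume s: "\<And>n. s n \<in> H"
      and c: "\<And>e. e > 0 \<Longrightarrow> \<exists>N. \<forall>m\<ge>N. \<forall>n\<ge>N. Re (cinner (s m - s n) (s m - s n)) < e"
    have "Cauchy s"
      unfolding Cauchy_def
    proof (intro allI impI)
      fix e :: real assume e: "e > 0"
      show "\<exists>M. \<forall>m\<ge>M. \<forall>n\<ge>M. dist (s m) (s n) < e"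
        using c[of "e\<^sup>2"] e unfolding norm_sq_cinner dist_norm
        by (metis less_imp_le power2_less_imp_less zero_less_power)
    qed
    then obtain l where l: "s \<longlonglongrightarrow> l" using Cauchy_convergent convergent_def by blast
    have "l \<in> H" using closed_sequentially[OF H(2) _ l] s by auto
    moreover have "(\<lambda>n. (norm (s n - l))\<^sup>2) \<longlonglongrightarrow> 0"
      using tendsto_power[OF tendsto_norm[OF LIM_zero[OF l]], of 2] by simp
    ultimately show "\<exists>l\<in>H. (\<lambda>n. Re (cinner (s n - l) (s n - l))) \<longlonglongrightarrow> 0"
      unfolding norm_sq_cinner by blast
  qed (use H in \<open>auto simp: csubspace_def scaleC_minus_one cinner_add_left cinner_scaleC_left
        norm_sq_cinner intro: cinner_commute\<close>)
qed

text \<open>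
  Gram-Schmidt with respect to this form replaces the square root of \<open>S\<close> below.
\<close>

lemma semi_inner_space_abs_op:
  assumes H: "hilbert_subspace H" and S: "is_abs_op H T S"
  shows "semi_inner_space H (*\<^sub>C) (\<lambda>u w. cinner (S u) w)"
proof -
  interpret h: complete_inner_space H "(*\<^sub>C)" cinner by (rule complete_inner_space_hilbert[OF H])
  have S': "clinear_op H H S" "\<And>v w. v \<in> H \<Longrightarrow> w \<in> H \<Longrightarrow> cinner (S v) w = cinner v (S w)"
    "\<And>v. v \<in> H \<Longrightarrow> 0 \<le> Re (cinner (S v) v)"
    using S by (auto simp: is_abs_op_def bounded_op_def)
  show ?thesis
  proof
    show "cinner (S y) x = cnj (cinner (S x) y)" if "x \<in> H" "y \<in> H" for x y
      using S'(2)[of x y] that by (metis cinner_commute)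
  qed (use S' in \<open>auto simp: clinear_op_def h.zero_mem h.add_mem h.sc_mem h.sc_minus
        cinner_add_left cinner_scaleC_left\<close>)
qed

lemma clinear_op_sum:
  assumes H: "hilbert_subspace H" and T: "clinear_op H K T" and f: "\<And>i. i \<in> I \<Longrightarrow> f i \<in> H"
  shows "T (\<Sum>i\<in>I. f i) = (\<Sum>i\<in>I. T (f i))"
proof -
  interpret h: complete_inner_space H "(*\<^sub>C)" cinner by (rule complete_inner_space_hilbert[OF H])
  have "T (0 + 0) = T 0 + T 0"
    using T h.zero_mem unfolding clinear_op_def by blast
  then have "T 0 = 0" by simp
  then show ?thesis
    using f T by (induction I rule: infinite_finite_induct) (auto simp: clinear_op_def h.sum_mem)
qed

lemma has_sum_finite_sum:
  fixes f :: "'i \<Rightarrow> 'a \<Rightarrow> 'b::topological_comm_monoid_add"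
  assumes "finite I" "\<And>i. i \<in> I \<Longrightarrow> (f i has_sum s i) A"
  shows "((\<lambda>x. \<Sum>i\<in>I. f i x) has_sum (\<Sum>i\<in>I. s i)) A"
  using assms by (induction I rule: finite_induct) (auto intro: has_sum_add has_sum_0)

text \<open>
  With a polar decomposition \<open>T = W S\<close> one would bound \<open>\<langle>T U b, b\<rangle> = \<langle>S U b, W\<^sup>* b\<rangle>\<close> by the
  Cauchy-Schwarz inequality for the form of \<open>S\<close> and use that the trace of \<open>S\<close> does not depend on the
  basis. Both the decomposition and the square root of \<open>S\<close> are avoided as follows. For a finite set
  \<open>F\<close> of basis vectors let \<open>E\<close> be orthonormal for \<open>\<langle>S u, w\<rangle>\<close> and span the vectors \<open>U b\<close>, \<open>b \<in> F\<close>,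
  up to norm zero. Since \<open>T\<close> kills what has norm zero,
  \<open>\<langle>T U b, b\<rangle> = \<Sum>a\<in>E. \<langle>U b, S a\<rangle> \<langle>T a, b\<rangle>\<close>. The Bessel inequalities for \<open>U b\<close> and for \<open>b\<close>,
  together with \<open>\<parallel>T a\<parallel> = \<parallel>S a\<parallel>\<close>, bound the sum over \<open>F\<close> by \<open>\<Sum>a\<in>E. \<parallel>S a\<parallel>\<^sup>2\<close>, and the Parseval
  identity for the basis followed by the Bessel inequality for \<open>E\<close> bounds that by the trace of \<open>S\<close>.
\<close>

lemma trace_class_diagonal_summable:
  assumes H: "hilbert_subspace H" and T: "trace_class H T"
    and U: "\<And>b. b \<in> onb H cinner \<Longrightarrow> U b \<in> H"
    and bes: "\<And>F v. finite F \<Longrightarrow> F \<subseteq> onb H cinner \<Longrightarrow> v \<in> H \<Longrightarrow>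
       (\<Sum>b\<in>F. (cmod (cinner (U b) v))\<^sup>2) \<le> (norm v)\<^sup>2"
  shows "(\<lambda>b. cinner (T (U b)) b) summable_on onb H cinner"
proof -
  interpret h: complete_inner_space H "(*\<^sub>C)" cinner by (rule complete_inner_space_hilbert[OF H])
  let ?B = "onb H cinner"
  have hsq: "h.sq v = (norm v)\<^sup>2" for v by (simp add: h.sq_def norm_sq_cinner)
  obtain S where S: "is_abs_op H T S" and tr: "(\<lambda>b. cinner (S b) b) summable_on ?B"
    using T by (auto simp: trace_class_def)
  interpret f: semi_inner_space H "(*\<^sub>C)" "\<lambda>u w. cinner (S u) w"
    by (rule semi_inner_space_abs_op[OF H S])
  have Tlin: "clinear_op H H T" using T by (auto simp: trace_class_def bounded_op_def)
  have Slin: "clinear_op H H S" using S by (auto simp: is_abs_op_def bounded_op_def)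
  have SH: "S v \<in> H" if "v \<in> H" for v using Slin that by (auto simp: clinear_op_def)
  have TH: "T v \<in> H" if "v \<in> H" for v using Tlin that by (auto simp: clinear_op_def)
  have Sadj: "cinner (S v) w = cinner v (S w)" if "v \<in> H" "w \<in> H" for v w
    using S that by (auto simp: is_abs_op_def)
  have nT: "norm (T v) = norm (S v)" if v: "v \<in> H" for v
  proof -
    have "cinner (T v) (T v) = cinner (S (S v)) v" using S v by (auto simp: is_abs_op_def)
    also have "\<dots> = cinner (S v) (S v)" using Sadj[OF SH[OF v] v] .
    finally have "(norm (T v))\<^sup>2 = (norm (S v))\<^sup>2" by (metis norm_sq_cinner)
    then show ?thesis by simp
  qed
  have null: "T r = 0" if r: "r \<in> H" "f.sq r = 0" for r
  proof -
    have "cinner (S r) (S r) = 0"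
      using f.ip_eq_0_if_sq_eq_0[OF r(1) SH[OF r(1)] r(2)] .
    then have "norm (S r) = 0" using norm_sq_cinner[of "S r"] by simp
    then show ?thesis using nT[OF r(1)] by simp
  qed
  have trRe: "(\<lambda>b. f.sq b) summable_on ?B"
    unfolding f.sq_def using summable_on_bounded_linear[OF bounded_linear_Re tr] by (simp add: o_def)
  define D where "D = infsum f.sq ?B"
  have Sbound: "(\<Sum>a\<in>E. (norm (S a))\<^sup>2) \<le> D" if E: "finite E" "f.orthonormal E" for E
  proof -
    note EH = f.orthonormalD(1)[OF E(2)]
    have "((\<lambda>b. (cmod (cinner (S a) b))\<^sup>2) has_sum (norm (S a))\<^sup>2) ?B" if "a \<in> E" for a
      using h.onb_parseval[OF SH[OF EH[OF that]]] by (simp add: hsq)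
    then have 1: "((\<lambda>b. \<Sum>a\<in>E. (cmod (cinner (S a) b))\<^sup>2) has_sum (\<Sum>a\<in>E. (norm (S a))\<^sup>2)) ?B"
      using E(1) by (intro has_sum_finite_sum)
    have 2: "(f.sq has_sum D) ?B"
      unfolding D_def using trRe by (rule has_sum_infsum)
    show ?thesis
    proof (rule has_sum_mono[OF 1 2])
      fix b assume b: "b \<in> ?B"
      have "cmod (cinner (S a) b) = cmod (cinner (S b) a)" if "a \<in> E" for a
        using f.ip_commute[OF EH[OF that] h.onb_mem[OF b]] by simp
      then show "(\<Sum>a\<in>E. (cmod (cinner (S a) b))\<^sup>2) \<le> f.sq b"
        using f.bessel[OF E(2,1) h.onb_mem[OF b]] by (metis (no_types, lifting) sum.cong)
    qed
  qed
  have amgm: "x * y \<le> (x\<^sup>2 + y\<^sup>2) / 2" for x y :: real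
    using sum_squares_bound[of x y] by simp
  have bound: "(\<Sum>b\<in>F. cmod (cinner (T (U b)) b)) \<le> D" if F: "finite F" "F \<subseteq> ?B" for F
  proof -
    have UF: "finite (U ` F)" "U ` F \<subseteq> H" using F U by auto
    obtain E where E: "finite E" "f.orthonormal E" "\<And>v. v \<in> U ` F \<Longrightarrow> f.sq (v - f.proj E v) = 0"
      using f.gram_schmidt[OF UF] by blast
    note EH = f.orthonormalD(1)[OF E(2)]
    have ex: "cinner (T (U b)) b = (\<Sum>a\<in>E. cinner (U b) (S a) * cinner (T a) b)" if b: "b \<in> F" for b
    proof -
      let ?r = "U b - f.proj E (U b)"
      have Ub: "U b \<in> H" using b F U by auto
      have p: "f.proj E (U b) \<in> H" by (rule f.proj_mem[OF E(2)])
      have r: "?r \<in> H" using Ub p by (rule h.diff_mem)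
      have "T (U b) = T (?r + f.proj E (U b))" by simp
      also have "\<dots> = T ?r + T (f.proj E (U b))"
        using Tlin r p unfolding clinear_op_def by blast
      also have "\<dots> = (\<Sum>a\<in>E. T (cinner (S (U b)) a *\<^sub>C a))"
        unfolding f.proj_def using EH null[OF r E(3)] b
        by (simp add: clinear_op_sum[OF H Tlin] h.sc_mem f.proj_def)
      also have "\<dots> = (\<Sum>a\<in>E. cinner (U b) (S a) *\<^sub>C T a)"
        using EH Tlin Sadj[OF Ub] by (intro sum.cong) (auto simp: clinear_op_def)
      finally have "T (U b) = (\<Sum>a\<in>E. cinner (U b) (S a) *\<^sub>C T a)" .
      then have "cinner (T (U b)) b = (\<Sum>a\<in>E. cinner (cinner (U b) (S a) *\<^sub>C T a) b)"
        using EH TH b F h.onb_mem h.sc_mem by (simp add: h.ip_sum_left subset_iff)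
      then show ?thesis by (simp add: cinner_scaleC_left)
    qed
    have "(\<Sum>b\<in>F. cmod (cinner (T (U b)) b)) \<le>
      (\<Sum>b\<in>F. \<Sum>a\<in>E. ((cmod (cinner (U b) (S a)))\<^sup>2 + (cmod (cinner (T a) b))\<^sup>2) / 2)"
    proof (intro sum_mono)
      fix b assume "b \<in> F"
      have "cmod (cinner (T (U b)) b) \<le> (\<Sum>a\<in>E. cmod (cinner (U b) (S a)) * cmod (cinner (T a) b))"
        unfolding ex[OF \<open>b \<in> F\<close>] by (rule order_trans[OF norm_sum]) (simp add: norm_mult)
      also have "\<dots> \<le> (\<Sum>a\<in>E. ((cmod (cinner (U b) (S a)))\<^sup>2 + (cmod (cinner (T a) b))\<^sup>2) / 2)"
        by (intro sum_mono amgm)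
      finally show "cmod (cinner (T (U b)) b) \<le> \<dots>" .
    qed
    also have "\<dots> = (\<Sum>a\<in>E. ((\<Sum>b\<in>F. (cmod (cinner (U b) (S a)))\<^sup>2) + (\<Sum>b\<in>F. (cmod (cinner (T a) b))\<^sup>2)) / 2)"
      by (subst sum.swap) (simp only: sum.distrib[symmetric] sum_divide_distrib)
    also have "\<dots> \<le> (\<Sum>a\<in>E. ((norm (S a))\<^sup>2 + (norm (S a))\<^sup>2) / 2)"
    proof (intro sum_mono divide_right_mono add_mono)
      fix a assume a: "a \<in> E"
      show "(\<Sum>b\<in>F. (cmod (cinner (U b) (S a)))\<^sup>2) \<le> (norm (S a))\<^sup>2"
        using bes[OF F SH[OF EH[OF a]]] .
      show "(\<Sum>b\<in>F. (cmod (cinner (T a) b))\<^sup>2) \<le> (norm (S a))\<^sup>2"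
        using h.bessel[OF h.orthonormal_subset[OF h.onb_orthonormal F(2)] F(1) TH[OF EH[OF a]]]
          nT[OF EH[OF a]] by (simp add: hsq)
    qed auto
    also have "\<dots> \<le> D" using Sbound[OF E(1,2)] by simp
    finally show ?thesis .
  qed
  have "(\<lambda>b. norm (cinner (T (U b)) b)) summable_on ?B"
    using bound by (intro nonneg_bdd_above_summable_on bdd_aboveI[of _ D]) auto
  then show ?thesis by (rule abs_summable_summable)
qed

lemma adjoint_op_cong:
  assumes "\<And>v. v \<in> H \<Longrightarrow> T v = T' v"
  shows "adjoint_op H T = adjoint_op H T'"
proof
  fix v
  have "(\<forall>u\<in>H. cinner (T u) v = cinner u w) \<longleftrightarrow> (\<forall>u\<in>H. cinner (T' u) v = cinner u w)" for w
    using assms by simp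
  then show "adjoint_op H T v = adjoint_op H T' v"
    unfolding adjoint_op_def by simp
qed

lemma adjoint_op:
  assumes H: "hilbert_subspace H" and T: "bounded_op H T" and v: "v \<in> H"
  shows "adjoint_op H T v \<in> H" "u \<in> H \<Longrightarrow> cinner (T u) v = cinner u (adjoint_op H T v)"
proof -
  interpret h: complete_inner_space H "(*\<^sub>C)" cinner by (rule complete_inner_space_hilbert[OF H])
  obtain C where C: "\<And>v. v \<in> H \<Longrightarrow> norm (T v) \<le> C * norm v" and lin: "clinear_op H H T"
    using T unfolding bounded_op_def by blast
  have "\<exists>w\<in>H. \<forall>x\<in>H. cinner (T x) v = cinner x w"
  proof (rule h.riesz_representation[where C = "C\<^sup>2 * h.sq v"])
    fix x assume x: "x \<in> H"
    have "(cmod (cinner (T x) v))\<^sup>2 \<le> (norm (T x))\<^sup>2 * h.sq v"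
      using h.cauchy_schwarz[of "T x" v] lin x v by (auto simp: clinear_op_def h.sq_def norm_sq_cinner)
    also have "\<dots> \<le> (C * norm x)\<^sup>2 * h.sq v"
      using C[OF x] h.sq_nonneg[OF v] by (intro mult_right_mono power_mono) auto
    finally show "(cmod (cinner (T x) v))\<^sup>2 \<le> C\<^sup>2 * h.sq v * h.sq x"
      by (simp add: h.sq_def[of x] norm_sq_cinner power_mult_distrib mult_ac)
  qed (use lin v h.sq_nonneg[OF v] in \<open>auto simp: clinear_op_def cinner_add_left cinner_scaleC_left\<close>)
  then obtain w where w: "w \<in> H" "\<forall>x\<in>H. cinner (T x) v = cinner x w" by blast
  have "adjoint_op H T v = w"
    unfolding adjoint_op_def
  proof (rule the_equality)
    fix w' assume w': "w' \<in> H \<and> (\<forall>u\<in>H. cinner (T u) v = cinner u w')"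
    then have "cinner (w' - w) (w' - w) = 0"
      using w h.diff_mem[of w' w] by (simp add: h.ip_diff_right)
    then show "w' = w" using norm_sq_cinner[of "w' - w"] by simp
  qed (use w in auto)
  then show "adjoint_op H T v \<in> H" "u \<in> H \<Longrightarrow> cinner (T u) v = cinner u (adjoint_op H T v)"
    using w by auto
qed

lemma op_trace_cong:
  assumes H: "hilbert_subspace H" and "\<And>v. v \<in> H \<Longrightarrow> T v = T' v"
  shows "op_trace H T = op_trace H T'"
proof -
  interpret h: complete_inner_space H "(*\<^sub>C)" cinner by (rule complete_inner_space_hilbert[OF H])
  show ?thesis unfolding op_trace_def using assms(2) h.onb_mem by (intro infsum_cong) auto
qed

text \<open>
  The trace of \<open>T T\<^sup>*\<close> only sees the values of \<open>T\<close> on \<open>H\<close> because \<open>T\<^sup>*\<close> maps into \<open>H\<close>, which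
  is where boundedness is used.
\<close>

lemma op_trace_self_adjoint_cong:
  assumes H: "hilbert_subspace H" and T: "bounded_op H T" and eq: "\<And>v. v \<in> H \<Longrightarrow> T' v = T v"
  shows "op_trace H (T' \<circ> adjoint_op H T') = op_trace H (T \<circ> adjoint_op H T)"
  using adjoint_op_cong[of H T' T, OF eq] adjoint_op(1)[OF H T] eq
  by (intro op_trace_cong[OF H]) auto

lemma unitary_bounded_op:
  assumes "unitary_op H H U"
  shows "bounded_op H U"
proof -
  have "norm (U v) \<le> 1 * norm v" if "v \<in> H" for v
  proof -
    have "(norm (U v))\<^sup>2 = (norm v)\<^sup>2"
      using assms that unfolding unitary_op_def norm_sq_cinner[symmetric] by simp
    then show ?thesis by simp
  qed
  then show ?thesis using assms unfolding bounded_op_def unitary_op_def by blast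
qed

lemma bounded_op_eq_on_dense:
  fixes H :: "'h::chilbert_space set"
  assumes H: "hilbert_subspace H" and T: "bounded_op H T" "bounded_op H T'"
    and dense: "H \<subseteq> closure X" and X: "X \<subseteq> H" and eq: "\<And>v. v \<in> X \<Longrightarrow> T v = T' v" and v: "v \<in> H"
  shows "T v = T' v"
proof -
  interpret h: complete_inner_space H "(*\<^sub>C)" cinner by (rule complete_inner_space_hilbert[OF H])
  have cont: "continuous_on H R" if R: "bounded_op H R" for R
  proof -
    obtain C where C: "\<And>v. v \<in> H \<Longrightarrow> norm (R v) \<le> C * norm v" and lin: "clinear_op H H R"
      using R unfolding bounded_op_def by blast
    have "dist (R x) (R y) \<le> \<bar>C\<bar> * dist x y" if "x \<in> H" "y \<in> H" for x y
    proof -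
      have "R (x - y) = R (x + (-1) *\<^sub>C y)" by (simp add: scaleC_minus_one)
      also have "\<dots> = R x + (-1) *\<^sub>C R y"
        using lin that h.sc_mem unfolding clinear_op_def by metis
      finally have "R x - R y = R (x - y)" by (simp add: scaleC_minus_one)
      then show ?thesis
        using C[OF h.diff_mem[OF that]] mult_right_mono[OF abs_ge_self[of C], of "norm (x - y)"]
        by (simp add: dist_norm)
    qed
    then have "\<bar>C\<bar>-lipschitz_on H R" by (intro lipschitz_onI) auto
    then show ?thesis by (rule lipschitz_on_continuous_on)
  qed
  obtain x where x: "\<And>n. x n \<in> X" "x \<longlonglongrightarrow> v"
    using dense v closure_sequential by blast
  have "(\<lambda>n. R (x n)) \<longlonglongrightarrow> R v" if "bounded_op H R" for R
    using cont[OF that] x X v unfolding continuous_on_sequentially by (auto simp: o_def)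
  note lim = this
  have "(\<lambda>n. T (x n)) = (\<lambda>n. T' (x n))" using eq[OF x(1)] by simp
  then show ?thesis using LIMSEQ_unique[OF lim[OF T(1)]] lim[OF T(2)] by simp
qed

section \<open>Linearity of the trace in the field\<close>

lemma bounded_op_linear_comb:
  fixes n :: nat
  assumes H: "hilbert_subspace H" and T: "\<And>k. k < n \<Longrightarrow> bounded_op H (T k)"
  shows "bounded_op H (\<lambda>v. \<Sum>k<n. c k *\<^sub>C T k v)"
  using T
proof (induction n)
  case 0
  interpret h: complete_inner_space H "(*\<^sub>C)" cinner by (rule complete_inner_space_hilbert[OF H])
  have "c *\<^sub>C (0::'a) = 0" for c using scaleC_add_right[of c 0 0] by simp
  then show ?case by (auto simp: bounded_op_def clinear_op_def h.zero_mem intro: exI[of _ 0])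
next
  case (Suc n)
  interpret h: complete_inner_space H "(*\<^sub>C)" cinner by (rule complete_inner_space_hilbert[OF H])
  let ?R = "\<lambda>v. \<Sum>k<n. c k *\<^sub>C T k v"
  have "bounded_op H ?R" using Suc by simp
  then obtain C where R: "clinear_op H H ?R" and C: "\<And>v. v \<in> H \<Longrightarrow> norm (?R v) \<le> C * norm v"
    unfolding bounded_op_def by blast
  have "bounded_op H (T n)" using Suc.prems by simp
  then obtain C' where T': "clinear_op H H (T n)" and C': "\<And>v. v \<in> H \<Longrightarrow> norm (T n v) \<le> C' * norm v"
    unfolding bounded_op_def by blast
  have scn: "norm (a *\<^sub>C v) = cmod a * norm v" if "v \<in> H" for a v
  proof -
    have "(norm (a *\<^sub>C v))\<^sup>2 = (cmod a * norm v)\<^sup>2"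
      using h.sq_sc[OF that, of a] by (simp add: h.sq_def norm_sq_cinner power_mult_distrib)
    then show ?thesis by (simp add: power2_eq_iff_nonneg)
  qed
  have comm: "a *\<^sub>C b *\<^sub>C v = b *\<^sub>C a *\<^sub>C v" for a b and v :: 'a
    by (simp add: scaleC_scaleC mult.commute)
  have TnH: "T n v \<in> H" if "v \<in> H" for v using T' that by (auto simp: clinear_op_def)
  have "clinear_op H H (\<lambda>v. ?R v + c n *\<^sub>C T n v)"
    unfolding clinear_op_def
  proof (intro conjI ballI allI)
    show "?R v + c n *\<^sub>C T n v \<in> H" if "v \<in> H" for v
      using R that h.sc_mem[OF TnH[OF that]] by (auto simp: clinear_op_def intro!: h.add_mem)
    show "?R (v + w) + c n *\<^sub>C T n (v + w) = ?R v + c n *\<^sub>C T n v + (?R w + c n *\<^sub>C T n w)"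
      if "v \<in> H" "w \<in> H" for v w
    proof -
      have "?R (v + w) = ?R v + ?R w" using R that unfolding clinear_op_def by blast
      moreover have "T n (v + w) = T n v + T n w" using T' that unfolding clinear_op_def by blast
      ultimately show ?thesis by (simp only: scaleC_add_right add_ac)
    qed
    show "?R (a *\<^sub>C v) + c n *\<^sub>C T n (a *\<^sub>C v) = a *\<^sub>C (?R v + c n *\<^sub>C T n v)"
      if "v \<in> H" for a v
    proof -
      have "?R (a *\<^sub>C v) = a *\<^sub>C ?R v" using R that unfolding clinear_op_def by blast
      moreover have "T n (a *\<^sub>C v) = a *\<^sub>C T n v" using T' that unfolding clinear_op_def by blast
      ultimately show ?thesis by (simp only: scaleC_add_right comm[of a "c n"])
    qed
  qed
  moreover have "norm (?R v + c n *\<^sub>C T n v) \<le> (C + cmod (c n) * C') * norm v" if "v \<in> H" for v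
  proof -
    have "norm (?R v + c n *\<^sub>C T n v) \<le> norm (?R v) + norm (c n *\<^sub>C T n v)"
      by (rule norm_triangle_ineq)
    also have "norm (c n *\<^sub>C T n v) = cmod (c n) * norm (T n v)" by (rule scn[OF TnH[OF that]])
    also have "\<dots> \<le> cmod (c n) * (C' * norm v)" using C'[OF that] by (intro mult_left_mono) auto
    finally show ?thesis using C[OF that] by (simp add: algebra_simps)
  qed
  ultimately show ?case unfolding bounded_op_def by auto
qed

text \<open>
  Density of the domain of \<open>S\<close> makes the arbitrarily chosen bounded extension canonical, so that
  it may be computed from any bounded extension at hand.
\<close>

lemma op_ext_eq:
  assumes H: "hilbert_subspace H" and S: "S \<subseteq> H \<times> H" "H \<subseteq> closure (Domain S)"
    and T: "bounded_op H T" "extends_prod T F S" and v: "v \<in> H"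
  shows "op_ext H F S v = T v"
proof -
  have E: "bounded_op H (op_ext H F S) \<and> extends_prod (op_ext H F S) F S"
    unfolding op_ext_def by (rule someI[of _ T]) (use T in simp)
  show ?thesis
  proof (rule bounded_op_eq_on_dense[OF H conjunct1[OF E] T(1) S(2) _ _ v])
    show "Domain S \<subseteq> H" using S(1) by blast
    fix u assume "u \<in> Domain S"
    then obtain w where "(u, w) \<in> S" by blast
    then have "op_ext H F S u = F w" "T u = F w"
      using E T(2) unfolding extends_prod_def by blast+
    then show "op_ext H F S u = T u" by simp
  qed
qed

lemma op_trace_linear_comb:
  fixes n :: nat and R :: "nat \<Rightarrow> 'h::chilbert_space \<Rightarrow> 'h"
  assumes "\<And>k. k < n \<Longrightarrow> (\<lambda>b. cinner (R k b) b) summable_on onb H cinner"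
  shows "op_trace H (\<lambda>v. \<Sum>k<n. c k *\<^sub>C R k v) = (\<Sum>k<n. c k * op_trace H (R k))"
proof -
  have "((\<lambda>b. \<Sum>k<n. c k * cinner (R k b) b) has_sum (\<Sum>k<n. c k * op_trace H (R k))) (onb H cinner)"
    unfolding op_trace_def using assms
    by (intro has_sum_finite_sum has_sum_cmult_right has_sum_infsum) auto
  moreover have "cinner (0::'h) b = 0" for b
    using cinner_add_left[of 0 0 b] by simp
  then have "cinner (\<Sum>k<n. c k *\<^sub>C R k b) b = (\<Sum>k<n. c k * cinner (R k b) b)" for b
    by (induction n) (auto simp: cinner_add_left cinner_scaleC_left)
  ultimately show ?thesis
    unfolding op_trace_def by (simp add: infsumI)
qed

text \<open>
  The delicate point is that \<^const>\<open>op_trace\<close> is an infinite sum with value zero when it does not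
  converge, so additivity needs convergence for each summand. This is
  \<open>trace_class_diagonal_summable\<close>; its Bessel hypothesis holds for the adjoint of the unitary
  \<open>\<pi> z\<close>, as the coefficients of \<open>v\<close> along the vectors \<open>\<pi>(z)\<^sup>* b\<close> are those of \<open>\<pi>(z) v\<close> along \<open>b\<close>.
\<close>

lemma tr_pi_linear_comb:
  fixes n :: nat
  assumes H: "hilbert_subspace H" and S: "S \<subseteq> H \<times> H" "H \<subseteq> closure (Domain S)"
    and U: "unitary_op H H (\<pi> z)"
    and F: "\<And>k. k < n \<Longrightarrow> \<exists>T. trace_class H T \<and> extends_prod T (F k) S"
    and A: "\<And>v. v \<in> H \<Longrightarrow> A v = (\<Sum>k<n. c k *\<^sub>C F k v)"
  shows "tr_pi H S \<pi> A z = (\<Sum>k<n. c k * tr_pi H S \<pi> (F k) z)"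
proof -
  interpret h: complete_inner_space H "(*\<^sub>C)" cinner by (rule complete_inner_space_hilbert[OF H])
  obtain T where T: "\<And>k. k < n \<Longrightarrow> trace_class H (T k)" "\<And>k. k < n \<Longrightarrow> extends_prod (T k) (F k) S"
    using F by metis
  have bT: "bounded_op H (T k)" if "k < n" for k using T(1)[OF that] by (simp add: trace_class_def)
  let ?U = "adjoint_op H (\<pi> z)"
  have bU: "bounded_op H (\<pi> z)" by (rule unitary_bounded_op[OF U])
  have UH: "?U v \<in> H" if "v \<in> H" for v by (rule adjoint_op(1)[OF H bU that])
  have piH: "\<pi> z v \<in> H" if "v \<in> H" for v using U that by (auto simp: unitary_op_def clinear_op_def)
  have "(\<Sum>k<n. c k *\<^sub>C T k v) = A w" if vw: "(v, w) \<in> S" for v w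
  proof -
    have "w \<in> H" using S(1) vw by blast
    moreover have "T k v = F k w" if "k < n" for k
      using T(2)[OF that] vw unfolding extends_prod_def by blast
    ultimately show ?thesis using A by simp
  qed
  then have "extends_prod (\<lambda>v. \<Sum>k<n. c k *\<^sub>C T k v) A S"
    unfolding extends_prod_def by (simp add: case_prod_unfold)
  note extA = op_ext_eq[OF H S bounded_op_linear_comb[OF H bT, where c = c] this]
  have "tr_pi H S \<pi> A z = op_trace H (\<lambda>v. \<Sum>k<n. c k *\<^sub>C T k (?U v))"
    unfolding tr_pi_def by (intro op_trace_cong[OF H]) (simp add: extA UH)
  also have "\<dots> = (\<Sum>k<n. c k * op_trace H (\<lambda>v. T k (?U v)))"
  proof (intro op_trace_linear_comb trace_class_diagonal_summable[OF H T(1)])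
    fix E v assume E: "finite E" "E \<subseteq> onb H cinner" and v: "v \<in> H"
    have "cmod (cinner (?U b) v) = cmod (cinner (\<pi> z v) b)" if "b \<in> E" for b
    proof -
      have "b \<in> H" using that E h.onb_mem by blast
      then show ?thesis
        using adjoint_op(2)[OF H bU _ v, of b] h.ip_commute[OF UH v, of b] by simp
    qed
    then have "(\<Sum>b\<in>E. (cmod (cinner (?U b) v))\<^sup>2) = (\<Sum>b\<in>E. (cmod (cinner (\<pi> z v) b))\<^sup>2)"
      by simp
    also have "\<dots> \<le> h.sq (\<pi> z v)"
      by (rule h.bessel[OF h.orthonormal_subset[OF h.onb_orthonormal E(2)] E(1) piH[OF v]])
    also have "\<dots> = (norm v)\<^sup>2"
      using U v by (simp add: h.sq_def unitary_op_def norm_sq_cinner)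
    finally show "(\<Sum>b\<in>E. (cmod (cinner (?U b) v))\<^sup>2) \<le> (norm v)\<^sup>2" .
  qed (use h.onb_mem UH in auto)
  also have "\<dots> = (\<Sum>k<n. c k * tr_pi H S \<pi> (F k) z)"
  proof (intro sum.cong refl)
    fix k assume "k \<in> {..<n}"
    then have k: "k < n" by simp
    have "op_trace H (\<lambda>v. T k (?U v)) = tr_pi H S \<pi> (F k) z"
      unfolding tr_pi_def
      by (intro op_trace_cong[OF H]) (simp add: op_ext_eq[OF H S bT[OF k] T(2)[OF k]] UH)
    then show "c k * op_trace H (\<lambda>v. T k (?U v)) = c k * tr_pi H S \<pi> (F k) z" by simp
  qed
  finally show ?thesis .
qed

section \<open>Haar measure and inversion\<close>

lemma borel_measurable_uminus_group [measurable (raw)]: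
  fixes f :: "'a \<Rightarrow> 'g::{topological_group_add, second_countable_topology}"
  assumes "f \<in> borel_measurable M"
  shows "(\<lambda>x. - f x) \<in> borel_measurable M"
  using assms by (rule borel_measurable_continuous_on[rotated]) (intro continuous_intros continuous_on_id)

lemma borel_measurable_diff_group [measurable (raw)]:
  fixes f :: "'a \<Rightarrow> 'g::{topological_group_add, second_countable_topology}"
  assumes [measurable]: "f \<in> borel_measurable M" "g \<in> borel_measurable M"
  shows "(\<lambda>x. f x - g x) \<in> borel_measurable M"
  unfolding diff_conv_add_uminus by measurable

text \<open>
  A countable base can be thinned out to the members contained in compact sets without losing the
  covering property.
\<close>

lemma haar_sigma_finite:
  fixes \<mu> :: "'g::{topological_group_add, t2_space, second_countable_topology} measure"
  assumes lc: "locally_compact_space (euclidean :: 'g topology)" and haar: "left_haar_measure \<mu>"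
  shows "sigma_finite_measure \<mu>"
proof
  have sets: "sets \<mu> = sets borel" using haar by (simp add: left_haar_measure_def)
  have fin: "emeasure \<mu> K < \<infinity>" if "compact K" for K
    using haar that by (simp add: left_haar_measure_def)
  obtain B :: "'g set set" where B: "countable B" "topological_basis B"
    using ex_countable_basis by blast
  let ?C = "{b \<in> B. \<exists>K. compact K \<and> b \<subseteq> K}"
  have "\<exists>b\<in>?C. x \<in> b" for x
  proof -
    obtain U K where UK: "open U" "compact K" "x \<in> U" "U \<subseteq> K"
      using lc unfolding locally_compact_space_def by simp blast
    obtain b where "b \<in> B" "x \<in> b" "b \<subseteq> U" using topological_basisE[OF B(2) UK(1,3)] by blast
    then show ?thesis using UK by blast
  qed
  moreover have "b \<in> sets \<mu>" "emeasure \<mu> b \<noteq> \<infinity>" if b: "b \<in> ?C" for b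
  proof -
    have "open b" using b topological_basis_open[OF B(2)] by blast
    then show "b \<in> sets \<mu>" using sets by simp
    obtain K where K: "compact K" "b \<subseteq> K" using b by blast
    have "emeasure \<mu> b \<le> emeasure \<mu> K"
      using K compact_imp_closed[OF K(1)] by (intro emeasure_mono) (auto simp: sets)
    then show "emeasure \<mu> b \<noteq> \<infinity>" using fin[OF K(1)] by (auto simp: top_unique)
  qed
  moreover have "space \<mu> = UNIV" using sets_eq_imp_space_eq[OF sets] by simp
  ultimately show "\<exists>A. countable A \<and> A \<subseteq> sets \<mu> \<and> \<Union>A = space \<mu> \<and> (\<forall>a\<in>A. emeasure \<mu> a \<noteq> \<infinity>)"
    using B(1) by (intro exI[of _ ?C]) (auto intro: countable_subset)
qed

locale haar_group =
  fixes \<mu> :: "'g::{topological_group_add, t2_space, second_countable_topology} measure"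
    and \<Delta> :: "'g \<Rightarrow> real"
  assumes sigma_finite: "sigma_finite_measure \<mu>"
    and haar: "left_haar_measure \<mu>"
    and modular: "modular_function \<mu> \<Delta>"
begin

lemma sets_haar [simp, measurable_cong]: "sets \<mu> = sets borel"
  using haar by (simp add: left_haar_measure_def)

lemma space_haar [simp]: "space \<mu> = UNIV"
  using sets_eq_imp_space_eq[OF sets_haar] by simp

lemma modular_pos: "0 < \<Delta> x"
  using modular by (simp add: modular_function_def)

lemma emeasure_left_translate: "E \<in> sets borel \<Longrightarrow> emeasure \<mu> ((\<lambda>y. x + y) ` E) = emeasure \<mu> E"
  using haar by (simp add: left_haar_measure_def)

lemma emeasure_right_translate:
  "E \<in> sets borel \<Longrightarrow> emeasure \<mu> ((\<lambda>y. y + x) ` E) = ennreal (\<Delta> x) * emeasure \<mu> E"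
  using modular by (simp add: modular_function_def)

lemma image_left: "(\<lambda>y. x + y) ` E = (\<lambda>y. - x + y) -` E" for x :: 'g
  by (auto simp: image_iff add.assoc[symmetric] intro!: bexI[of _ "- x + _"])

lemma image_right: "(\<lambda>y. y + x) ` E = (\<lambda>y. y - x) -` E" for x :: 'g
  by (auto simp: image_iff intro!: bexI[of _ "_ - x"])

lemma nn_integral_left_translate:
  assumes [measurable]: "f \<in> borel_measurable borel"
  shows "(\<integral>\<^sup>+y. f (x + y) \<partial>\<mu>) = (\<integral>\<^sup>+y. f y \<partial>\<mu>)"
proof -
  have "distr \<mu> borel (\<lambda>y. x + y) = \<mu>"
  proof (rule measure_eqI)
    fix E assume "E \<in> sets (distr \<mu> borel (\<lambda>y. x + y))"
    then have E [measurable]: "E \<in> sets borel" by simp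
    have "emeasure (distr \<mu> borel (\<lambda>y. x + y)) E = emeasure \<mu> ((\<lambda>y. x + y) -` E)"
      by (subst emeasure_distr) simp_all
    also have "\<dots> = emeasure \<mu> ((\<lambda>y. - x + y) ` E)" by (simp only: image_left minus_minus)
    finally show "emeasure (distr \<mu> borel (\<lambda>y. x + y)) E = emeasure \<mu> E"
      by (simp only: emeasure_left_translate[OF E])
  qed simp
  then have "(\<integral>\<^sup>+y. f y \<partial>\<mu>) = (\<integral>\<^sup>+y. f y \<partial>distr \<mu> borel (\<lambda>y. x + y))" by simp
  also have "\<dots> = (\<integral>\<^sup>+y. f (x + y) \<partial>\<mu>)" by (subst nn_integral_distr) simp_all
  finally show ?thesis ..
qed

lemma nn_integral_right_translate:
  assumes [measurable]: "f \<in> borel_measurable borel"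
  shows "(\<integral>\<^sup>+y. f (y + x) \<partial>\<mu>) = ennreal (\<Delta> (- x)) * (\<integral>\<^sup>+y. f y \<partial>\<mu>)"
proof -
  have "distr \<mu> borel (\<lambda>y. y + x) = scale_measure (ennreal (\<Delta> (- x))) \<mu>"
  proof (rule measure_eqI)
    fix E assume "E \<in> sets (distr \<mu> borel (\<lambda>y. y + x))"
    then have E [measurable]: "E \<in> sets borel" by simp
    have "emeasure (distr \<mu> borel (\<lambda>y. y + x)) E = emeasure \<mu> ((\<lambda>y. y + x) -` E)"
      by (subst emeasure_distr) simp_all
    also have "(\<lambda>y. y + x) -` E = (\<lambda>y. y + - x) ` E"
      unfolding image_right by (simp add: diff_conv_add_uminus)
    finally show "emeasure (distr \<mu> borel (\<lambda>y. y + x)) E = emeasure (scale_measure (ennreal (\<Delta> (- x))) \<mu>) E"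
      by (simp only: emeasure_right_translate[OF E] emeasure_scale_measure)
  qed simp
  then have "(\<integral>\<^sup>+y. f y \<partial>distr \<mu> borel (\<lambda>y. y + x)) = ennreal (\<Delta> (- x)) * (\<integral>\<^sup>+y. f y \<partial>\<mu>)"
    by (simp add: nn_integral_scale_measure)
  then show ?thesis by (subst (asm) nn_integral_distr) simp_all
qed

lemma ex_finite_positive_set: "\<exists>E\<in>sets borel. 0 < emeasure \<mu> E \<and> emeasure \<mu> E < \<infinity>"
proof -
  interpret sigma_finite_measure \<mu> by (rule sigma_finite)
  obtain A :: "nat \<Rightarrow> 'g set" where A: "range A \<subseteq> sets \<mu>" "(\<Union>i. A i) = space \<mu>" "\<And>i. emeasure \<mu> (A i) \<noteq> \<infinity>"
    using sigma_finite by blast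
  have "emeasure \<mu> UNIV \<noteq> 0" using haar by (simp add: left_haar_measure_def)
  then have "\<exists>i. emeasure \<mu> (A i) \<noteq> 0"
    using emeasure_UN_eq_0[of \<mu> A] A by (auto simp: null_sets_def)
  then obtain i where "emeasure \<mu> (A i) \<noteq> 0" ..
  then show ?thesis using A by (intro bexI[of _ "A i"]) (auto simp: less_top zero_less_iff_neq_zero)
qed

lemma modular_add: "\<Delta> (x + y) = \<Delta> x * \<Delta> y"
proof -
  obtain E where E: "E \<in> sets borel" "0 < emeasure \<mu> E" "emeasure \<mu> E < \<infinity>"
    using ex_finite_positive_set by blast
  have Ex: "(\<lambda>z. z + x) ` E \<in> sets borel"
  proof -
    have "(\<lambda>z. z - x) \<in> borel_measurable borel" by measurable
    from measurable_sets[OF this E(1)] show ?thesis unfolding image_right by simp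
  qed
  have "(\<lambda>z. z + (x + y)) ` E = (\<lambda>z. z + y) ` (\<lambda>z. z + x) ` E"
    by (simp add: image_image add.assoc)
  then have "ennreal (\<Delta> (x + y)) * emeasure \<mu> E = ennreal (\<Delta> y) * (ennreal (\<Delta> x) * emeasure \<mu> E)"
    using emeasure_right_translate[OF E(1), of "x + y"] emeasure_right_translate[OF Ex, of y]
      emeasure_right_translate[OF E(1), of x] by simp
  then have "emeasure \<mu> E * ennreal (\<Delta> (x + y)) = emeasure \<mu> E * ennreal (\<Delta> x * \<Delta> y)"
    using modular_pos[of x] modular_pos[of y] by (simp add: ennreal_mult less_imp_le ac_simps)
  then have "ennreal (\<Delta> (x + y)) = ennreal (\<Delta> x * \<Delta> y)"
    using E by (subst (asm) ennreal_mult_cancel_left) auto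
  then show ?thesis
    using modular_pos[of x] modular_pos[of y] modular_pos[of "x + y"] by (simp add: less_imp_le)
qed

lemma modular_uminus: "\<Delta> (- x) = 1 / \<Delta> x"
proof -
  have "\<Delta> 0 = 1" using modular_add[of 0 0] modular_pos[of 0] by simp
  then show ?thesis using modular_add[of x "- x"] modular_pos[of x] by (simp add: field_simps)
qed

lemma modular_measurable [measurable]: "\<Delta> \<in> borel_measurable borel"
proof -
  interpret sigma_finite_measure \<mu> by (rule sigma_finite)
  obtain E where E [measurable]: "E \<in> sets borel" and p: "0 < emeasure \<mu> E" "emeasure \<mu> E < \<infinity>"
    using ex_finite_positive_set by blast
  have eq: "\<Delta> x = enn2real (\<integral>\<^sup>+y. indicator E (y - x) \<partial>\<mu>) / enn2real (emeasure \<mu> E)" for x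
  proof -
    have "(\<integral>\<^sup>+y. indicator E (y - x) \<partial>\<mu>) = (\<integral>\<^sup>+y. indicator E (y + - x) \<partial>\<mu>)" by simp
    also have "\<dots> = ennreal (\<Delta> x) * emeasure \<mu> E"
      by (subst nn_integral_right_translate) simp_all
    finally show ?thesis
      using less_imp_neq[OF p(1)] less_imp_neq[OF p(2)] modular_pos[of x]
      by (simp add: enn2real_mult enn2real_eq_0_iff)
  qed
  have m: "(\<lambda>(x, y). indicator E (y - x) :: ennreal) \<in> borel_measurable (borel \<Otimes>\<^sub>M \<mu>)"
    by measurable
  have "(\<lambda>x. \<integral>\<^sup>+y. indicator E (y - x) \<partial>\<mu>) \<in> borel_measurable borel"
    using borel_measurable_nn_integral[OF m] .
  then show ?thesis unfolding eq by measurable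
qed

text \<open>
  This is the behaviour of Haar measure under inversion. Instead of invoking uniqueness of Haar
  measure and determining the constant, one multiplies by \<open>\<mu>(E) = \<integral> 1\<^sub>E\<close> with
  \<open>0 < \<mu>(E) < \<infinity>\<close>. By right translation
  \<open>\<Delta>(y)\<^sup>-\<^sup>1 \<mu>(E) = \<integral> 1\<^sub>E(x y) dx\<close>, and after exchanging the integrals two left
  translations, first \<open>y \<mapsto> x\<^sup>-\<^sup>1 y\<close> and then \<open>x \<mapsto> y x\<close>, separate the variables.
\<close>

lemma nn_integral_uminus:
  assumes [measurable]: "h \<in> borel_measurable borel"
  shows "(\<integral>\<^sup>+y. ennreal (1 / \<Delta> y) * h y \<partial>\<mu>) = (\<integral>\<^sup>+y. h (- y) \<partial>\<mu>)"
proof -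
  interpret pair_sigma_finite \<mu> \<mu> unfolding pair_sigma_finite_def using sigma_finite by blast
  obtain E where E [measurable]: "E \<in> sets borel" and p: "0 < emeasure \<mu> E" "emeasure \<mu> E < \<infinity>"
    using ex_finite_positive_set by blast
  let ?I = "indicator E :: 'g \<Rightarrow> ennreal"
  have m: "(\<lambda>(x, y). h y * ?I (x + y)) \<in> borel_measurable (\<mu> \<Otimes>\<^sub>M \<mu>)"
    by measurable
  have m2: "(\<lambda>(x, y). h (- x + y) * ?I y) \<in> borel_measurable (\<mu> \<Otimes>\<^sub>M \<mu>)"
    by measurable
  have "emeasure \<mu> E * (\<integral>\<^sup>+y. ennreal (1 / \<Delta> y) * h y \<partial>\<mu>) =
      (\<integral>\<^sup>+y. h y * (ennreal (\<Delta> (- y)) * emeasure \<mu> E) \<partial>\<mu>)"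
    by (subst nn_integral_cmult[symmetric]) (auto simp: modular_uminus ac_simps)
  also have "\<dots> = (\<integral>\<^sup>+y. \<integral>\<^sup>+x. h y * ?I (x + y) \<partial>\<mu> \<partial>\<mu>)"
    by (subst nn_integral_cmult) (simp_all add: nn_integral_right_translate)
  also have "\<dots> = (\<integral>\<^sup>+x. \<integral>\<^sup>+y. h y * ?I (x + y) \<partial>\<mu> \<partial>\<mu>)"
    using m by (rule Fubini')
  also have "\<dots> = (\<integral>\<^sup>+x. \<integral>\<^sup>+y. h (- x + (x + y)) * ?I (x + y) \<partial>\<mu> \<partial>\<mu>)"
    by (simp add: add.assoc[symmetric])
  also have "\<dots> = (\<integral>\<^sup>+x. \<integral>\<^sup>+y. h (- x + y) * ?I y \<partial>\<mu> \<partial>\<mu>)"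
  proof (rule nn_integral_cong)
    fix x
    show "(\<integral>\<^sup>+y. h (- x + (x + y)) * ?I (x + y) \<partial>\<mu>) = (\<integral>\<^sup>+y. h (- x + y) * ?I y \<partial>\<mu>)"
      by (rule nn_integral_left_translate) measurable
  qed
  also have "\<dots> = (\<integral>\<^sup>+y. \<integral>\<^sup>+x. h (- x + y) * ?I y \<partial>\<mu> \<partial>\<mu>)"
    using m2 by (rule Fubini'[symmetric])
  also have "\<dots> = (\<integral>\<^sup>+y. \<integral>\<^sup>+x. h (- (- y + x)) * ?I y \<partial>\<mu> \<partial>\<mu>)"
    by (simp add: minus_add)
  also have "\<dots> = (\<integral>\<^sup>+y. \<integral>\<^sup>+x. h (- x) * ?I y \<partial>\<mu> \<partial>\<mu>)"
  proof (rule nn_integral_cong)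
    fix y
    show "(\<integral>\<^sup>+x. h (- (- y + x)) * ?I y \<partial>\<mu>) = (\<integral>\<^sup>+x. h (- x) * ?I y \<partial>\<mu>)"
      by (rule nn_integral_left_translate) measurable
  qed
  also have "\<dots> = emeasure \<mu> E * (\<integral>\<^sup>+x. h (- x) \<partial>\<mu>)"
    by (simp add: nn_integral_multc nn_integral_cmult mult.commute)
  finally show ?thesis
    using p by (subst (asm) ennreal_mult_cancel_left) auto
qed

text \<open>
  The substitution that turns the kernel at \<open>(x, x y\<^sup>-\<^sup>1)\<close> into a function of two independent
  variables; the factor \<open>\<Delta>(y)\<^sup>-\<^sup>1\<close> is the square of the factor \<open>\<Delta>(y)\<^sup>-\<^sup>1\<^sup>/\<^sup>2\<close> in the kernel.
\<close>

lemma nn_integral_reflect: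
  assumes [measurable]: "g \<in> borel_measurable borel"
  shows "(\<integral>\<^sup>+y. ennreal (1 / \<Delta> y) * g (x - y) \<partial>\<mu>) = (\<integral>\<^sup>+y. g y \<partial>\<mu>)"
proof -
  have "(\<integral>\<^sup>+y. ennreal (1 / \<Delta> y) * g (x - y) \<partial>\<mu>) = (\<integral>\<^sup>+y. g (x - - y) \<partial>\<mu>)"
    by (rule nn_integral_uminus) measurable
  also have "\<dots> = (\<integral>\<^sup>+y. g (x + y) \<partial>\<mu>)" by simp
  also have "\<dots> = (\<integral>\<^sup>+y. g y \<partial>\<mu>)" by (rule nn_integral_left_translate) measurable
  finally show ?thesis .
qed

lemma AE_reflect:
  assumes "AE z in \<mu>. P z"
  shows "AE y in \<mu>. P (x - y)"
proof -
  obtain Z where Z: "{z \<in> space \<mu>. \<not> P z} \<subseteq> Z" "emeasure \<mu> Z = 0" "Z \<in> sets \<mu>"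
    using assms by (rule AE_E)
  have [measurable]: "Z \<in> sets borel" using Z(3) by simp
  have "(\<integral>\<^sup>+y. ennreal (1 / \<Delta> y) * indicator Z (x - y) \<partial>\<mu>) = (\<integral>\<^sup>+y. indicator Z y \<partial>\<mu>)"
    by (rule nn_integral_reflect) measurable
  also have "\<dots> = 0" using Z by simp
  finally have "AE y in \<mu>. ennreal (1 / \<Delta> y) * indicator Z (x - y) = 0"
    by (subst (asm) nn_integral_0_iff_AE) measurable
  then show ?thesis
  proof eventually_elim
    case (elim y)
    have "ennreal (1 / \<Delta> y) \<noteq> 0" using modular_pos[of y] by simp
    then have "x - y \<notin> Z" using elim by (auto simp: indicator_def split: if_splits)
    then show ?case using Z(1) by auto
  qed
qed

end

section \<open>Completeness of spaces of square integrable functions\<close>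

lemma mult_cnj_self: "z * cnj z = complex_of_real ((cmod z)\<^sup>2)"
  by (rule complex_norm_square[symmetric])

lemma cmod_mult_le: "cmod (z * w) \<le> (cmod z)\<^sup>2 + (cmod w)\<^sup>2"
proof -
  have "2 * cmod z * cmod w \<le> (cmod z)\<^sup>2 + (cmod w)\<^sup>2" by (rule sum_squares_bound)
  moreover have "0 \<le> cmod z * cmod w" by simp
  ultimately show ?thesis unfolding norm_mult by linarith
qed

lemma cmod_add_sq_le: "(cmod (z + w))\<^sup>2 \<le> 2 * (cmod z)\<^sup>2 + 2 * (cmod w)\<^sup>2"
proof -
  have "(cmod (z + w))\<^sup>2 \<le> (cmod z + cmod w)\<^sup>2" by (intro power_mono norm_triangle_ineq) simp
  also have "\<dots> \<le> 2 * (cmod z)\<^sup>2 + 2 * (cmod w)\<^sup>2"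
    using sum_squares_bound[of "cmod z" "cmod w"] by (simp add: power2_sum)
  finally show ?thesis .
qed

lemma L2_measurable: "f \<in> L2 M \<Longrightarrow> f \<in> borel_measurable M"
  by (simp add: L2_def)

lemma L2_integrable: "f \<in> L2 M \<Longrightarrow> integrable M (\<lambda>x. (cmod (f x))\<^sup>2)"
  by (simp add: L2_def)

lemma L2I_nn:
  assumes [measurable]: "f \<in> borel_measurable M" and "(\<integral>\<^sup>+x. ennreal ((cmod (f x))\<^sup>2) \<partial>M) < \<infinity>"
  shows "f \<in> L2 M"
  unfolding L2_def using assms by (auto intro!: integrableI_nonneg)

lemma L2_nn_integral:
  assumes "f \<in> L2 M"
  shows "(\<integral>\<^sup>+x. ennreal ((cmod (f x))\<^sup>2) \<partial>M) = ennreal (\<integral>x. (cmod (f x))\<^sup>2 \<partial>M)"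
  using L2_integrable[OF assms] by (intro nn_integral_eq_integral) auto

lemma L2_add:
  assumes "f \<in> L2 M" "g \<in> L2 M"
  shows "(\<lambda>x. f x + g x) \<in> L2 M"
proof -
  note [measurable] = L2_measurable[OF assms(1)] L2_measurable[OF assms(2)]
  have "integrable M (\<lambda>x. 2 * (cmod (f x))\<^sup>2 + 2 * (cmod (g x))\<^sup>2)"
    using L2_integrable[OF assms(1)] L2_integrable[OF assms(2)] by simp
  then have "integrable M (\<lambda>x. (cmod (f x + g x))\<^sup>2)"
    by (rule Bochner_Integration.integrable_bound) (simp_all add: cmod_add_sq_le)
  then show ?thesis by (simp add: L2_def)
qed

lemma L2_cmult: "f \<in> L2 M \<Longrightarrow> (\<lambda>x. c * f x) \<in> L2 M"
  by (auto simp: L2_def norm_mult power_mult_distrib intro!: borel_measurable_times)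

lemma L2_cnj: "f \<in> L2 M \<Longrightarrow> (\<lambda>x. cnj (f x)) \<in> L2 M"
  using borel_measurable_continuous_on[of cnj f M] by (simp add: L2_def continuous_on_cnj)

lemma L2_mult_integrable:
  assumes "f \<in> L2 M" "g \<in> L2 M"
  shows "integrable M (\<lambda>x. f x * g x)"
proof -
  note [measurable] = L2_measurable[OF assms(1)] L2_measurable[OF assms(2)]
  have "integrable M (\<lambda>x. (cmod (f x))\<^sup>2 + (cmod (g x))\<^sup>2)"
    using L2_integrable[OF assms(1)] L2_integrable[OF assms(2)] by simp
  then show ?thesis
    by (rule Bochner_Integration.integrable_bound) (simp_all add: cmod_mult_le)
qed

lemma L2_cong_AE:
  assumes "f \<in> L2 M" "g \<in> borel_measurable M" "AE x in M. f x = g x"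
  shows "g \<in> L2 M"
proof -
  note [measurable] = L2_measurable[OF assms(1)] assms(2)
  have "integrable M (\<lambda>x. (cmod (g x))\<^sup>2)"
    using L2_integrable[OF assms(1)] by (rule integrable_cong_AE_imp) (use assms(3) in auto)
  then show ?thesis using assms(2) by (simp add: L2_def)
qed

lemma L2_inner_self: "L2_inner M f f = complex_of_real (\<integral>x. (cmod (f x))\<^sup>2 \<partial>M)"
  unfolding L2_inner_def mult_cnj_self by (rule integral_complex_of_real)

lemma semi_inner_space_L2: "semi_inner_space (L2 M) (\<lambda>c f x. c * f x) (L2_inner M)"
proof
  show "0 \<in> L2 M" by (simp add: L2_def zero_fun_def)
  show "f + g \<in> L2 M" if "f \<in> L2 M" "g \<in> L2 M" for f g
    using L2_add[OF that] by (simp add: plus_fun_def)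
  show "(\<lambda>x. - 1 * f x) = - f" if "f \<in> L2 M" for f by (simp add: fun_eq_iff)
  show "L2_inner M (f + g) h = L2_inner M f h + L2_inner M g h"
    if "f \<in> L2 M" "g \<in> L2 M" "h \<in> L2 M" for f g h
    unfolding L2_inner_def
    using L2_mult_integrable[OF that(1) L2_cnj[OF that(3)]] L2_mult_integrable[OF that(2) L2_cnj[OF that(3)]]
    by (simp add: distrib_right)
  show "L2_inner M (\<lambda>x. c * f x) g = c * L2_inner M f g" for c f g
    unfolding L2_inner_def by (simp add: mult.assoc)
  show "L2_inner M g f = cnj (L2_inner M f g)" for f g
    unfolding L2_inner_def using Bochner_Integration.integral_cnj[of M "\<lambda>x. f x * cnj (g x)"] by (simp add: mult.commute)
  show "0 \<le> Re (L2_inner M f f)" for f unfolding L2_inner_self by simp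
qed (rule L2_cmult)

text \<open>
  From \<open>\<bar>d\<bar> \<le> 2\<^sup>-\<^sup>k + 2\<^sup>k \<bar>d\<bar>\<^sup>2\<close> absolute convergence follows once \<open>\<Sum> 2\<^sup>k \<bar>d\<^sub>k\<bar>\<^sup>2\<close> has a finite
  integral, which it has, being dominated termwise by \<open>2\<^sup>k 4\<^sup>-\<^sup>k\<close>. This spares the triangle
  inequality for infinite sums in \<open>L\<^sup>2\<close>.
\<close>

lemma L2_series_converges_AE:
  assumes d: "\<And>k. d k \<in> L2 M" and small: "\<And>k. (\<integral>x. (cmod (d k x))\<^sup>2 \<partial>M) \<le> (1/4)^k"
  shows "AE x in M. summable (\<lambda>k. d k x)"
proof -
  note [measurable] = L2_measurable[OF d]
  have "(\<integral>\<^sup>+x. (\<Sum>k. ennreal (2^k * (cmod (d k x))\<^sup>2)) \<partial>M) = (\<Sum>k. \<integral>\<^sup>+x. ennreal (2^k * (cmod (d k x))\<^sup>2) \<partial>M)"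
    by (intro nn_integral_suminf) measurable
  also have "\<dots> \<le> (\<Sum>k. ennreal ((1/2)^k))"
  proof (intro suminf_le)
    fix k
    have "(\<integral>\<^sup>+x. ennreal (2^k * (cmod (d k x))\<^sup>2) \<partial>M) = ennreal (2^k) * (\<integral>\<^sup>+x. ennreal ((cmod (d k x))\<^sup>2) \<partial>M)"
      by (subst nn_integral_cmult[symmetric]) (simp_all add: ennreal_mult)
    also have "\<dots> \<le> ennreal (2^k) * ennreal ((1/4)^k)"
      unfolding L2_nn_integral[OF d] by (intro mult_left_mono ennreal_leI small) simp
    also have "\<dots> = ennreal ((1/2)^k)"
      by (simp add: ennreal_mult[symmetric] power_mult_distrib[symmetric])
    finally show "(\<integral>\<^sup>+x. ennreal (2^k * (cmod (d k x))\<^sup>2) \<partial>M) \<le> ennreal ((1/2)^k)" .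
  qed auto
  also have "\<dots> = ennreal (\<Sum>k. (1/2)^k)"
    by (intro suminf_ennreal_eq) (auto intro: summable_sums summable_geometric)
  finally have "(\<integral>\<^sup>+x. (\<Sum>k. ennreal (2^k * (cmod (d k x))\<^sup>2)) \<partial>M) \<noteq> \<infinity>"
    by (auto simp: top_unique)
  then have "AE x in M. (\<Sum>k. ennreal (2^k * (cmod (d k x))\<^sup>2)) \<noteq> \<infinity>"
    by (intro nn_integral_PInf_AE) measurable
  then show ?thesis
  proof eventually_elim
    case (elim x)
    then have "summable (\<lambda>k. 2^k * (cmod (d k x))\<^sup>2)"
      by (intro summable_suminf_not_top) auto
    then have s: "summable (\<lambda>k. (1/2)^k + 2^k * (cmod (d k x))\<^sup>2)"
      by (intro summable_add) (simp_all add: summable_geometric)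
    have le: "cmod (d k x) \<le> (1/2)^k + 2^k * (cmod (d k x))\<^sup>2" for k
    proof -
      let ?t = "2^k :: real" and ?a = "cmod (d k x)"
      have "?t * ?a \<le> 1 + (?t * ?a)\<^sup>2"
      proof -
        have "0 \<le> ?t * ?a" by simp
        moreover have "2 * (?t * ?a) \<le> 1 + (?t * ?a)\<^sup>2"
          using sum_squares_bound[of 1 "?t * ?a"] by simp
        ultimately show ?thesis by linarith
      qed
      then have "?a \<le> (1 + (?t * ?a)\<^sup>2) / ?t"
        by (simp add: field_simps)
      also have "\<dots> = (1/2)^k + ?t * ?a\<^sup>2"
        by (simp add: field_simps power2_eq_square power_divide)
      finally show ?thesis .
    qed
    have "summable (\<lambda>k. cmod (d k x))"
      by (rule summable_comparison_test'[OF s, of 0]) (use le in simp)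
    then show ?case by (rule summable_norm_cancel)
  qed
qed

text \<open>
  A rapidly converging subsequence converges almost everywhere, and the Fatou lemma transfers the
  Cauchy estimate to the limit.
\<close>

lemma complete_inner_space_L2: "complete_inner_space (L2 M) (\<lambda>c f x. c * f x) (L2_inner M)"
proof -
  interpret semi_inner_space "L2 M" "\<lambda>c f x. c * f x" "L2_inner M" by (rule semi_inner_space_L2)
  define q where "q f = (\<integral>x. (cmod (f x))\<^sup>2 \<partial>M)" for f
  have sq: "Re (L2_inner M f f) = q f" for f by (simp add: q_def L2_inner_self)
  have dif: "(\<lambda>x. f x - g x) \<in> L2 M" if "f \<in> L2 M" "g \<in> L2 M" for f g
    using diff_mem[OF that] by (simp add: fun_diff_def)
  have qd: "q (f - g) = q (\<lambda>x. f x - g x)" for f g by (simp add: fun_diff_def)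
  show ?thesis
  proof (unfold_locales, unfold sq)
    fix s :: "nat \<Rightarrow> 'a \<Rightarrow> complex"
    assume s: "\<And>n. s n \<in> L2 M" and c: "\<And>e. e > 0 \<Longrightarrow> \<exists>N. \<forall>m\<ge>N. \<forall>n\<ge>N. q (s m - s n) < e"
    note [measurable] = L2_measurable[OF s]
    have "\<exists>N. \<forall>m\<ge>N. \<forall>n\<ge>N. q (s m - s n) < (1/4)^k" for k :: nat by (rule c) simp
    then obtain R where R: "\<And>k m n. m \<ge> R k \<Longrightarrow> n \<ge> R k \<Longrightarrow> q (s m - s n) < (1/4)^k" by metis
    \<comment> \<open>adding up the thresholds makes the subsequence monotone\<close>
    define r where "r k = k + (\<Sum>j\<le>k. R j)" for k
    have rR: "r k \<ge> R k" for k
      unfolding r_def using member_le_sum[of k "{..k}" R] by simp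
    have rS: "r (Suc k) \<ge> r k" for k by (simp add: r_def)
    have rk: "r k \<ge> k" for k by (simp add: r_def)
    define d where "d k = (\<lambda>x. s (r (Suc k)) x - s (r k) x)" for k
    have "AE x in M. summable (\<lambda>k. d k x)"
    proof (rule L2_series_converges_AE)
      show "d k \<in> L2 M" for k unfolding d_def by (intro dif s)
      show "(\<integral>x. (cmod (d k x))\<^sup>2 \<partial>M) \<le> (1/4)^k" for k
        using R[of k "r (Suc k)" "r k"] rR[of k] rS[of k] by (simp add: d_def q_def)
    qed
    define l where "l x = lim (\<lambda>k. s (r k) x)" for x
    have [measurable]: "l \<in> borel_measurable M" unfolding l_def by measurable
    have lim: "AE x in M. (\<lambda>k. s (r k) x) \<longlonglongrightarrow> l x"
      using \<open>AE x in M. summable (\<lambda>k. d k x)\<close>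
    proof eventually_elim
      case (elim x)
      have "(\<lambda>n. \<Sum>k<n. d k x) \<longlonglongrightarrow> (\<Sum>k. d k x)" using elim by (rule summable_LIMSEQ)
      then have "(\<lambda>n. s (r 0) x + (\<Sum>k<n. d k x)) \<longlonglongrightarrow> s (r 0) x + (\<Sum>k. d k x)"
        by (intro tendsto_add tendsto_const)
      moreover have "s (r 0) x + (\<Sum>k<n. d k x) = s (r n) x" for n
        unfolding d_def using sum_lessThan_telescope[of "\<lambda>k. s (r k) x" n] by simp
      ultimately have "convergent (\<lambda>n. s (r n) x)" by (auto simp: convergent_def)
      then show ?case unfolding l_def by (simp add: convergent_LIMSEQ_iff)
    qed
    have fatou: "(\<integral>\<^sup>+x. ennreal ((cmod (s n x - l x))\<^sup>2) \<partial>M) \<le> ennreal e"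
      if N: "\<forall>m\<ge>N. \<forall>n\<ge>N. q (s m - s n) < e" and n: "n \<ge> N" for n N e
    proof -
      have "(\<integral>\<^sup>+x. ennreal ((cmod (s n x - l x))\<^sup>2) \<partial>M) =
          (\<integral>\<^sup>+x. liminf (\<lambda>k. ennreal ((cmod (s n x - s (r k) x))\<^sup>2)) \<partial>M)"
      proof (rule nn_integral_cong_AE, use lim in eventually_elim)
        fix x assume "(\<lambda>k. s (r k) x) \<longlonglongrightarrow> l x"
        then have "(\<lambda>k. ennreal ((cmod (s n x - s (r k) x))\<^sup>2)) \<longlonglongrightarrow> ennreal ((cmod (s n x - l x))\<^sup>2)"
          by (intro tendsto_intros)
        then show "ennreal ((cmod (s n x - l x))\<^sup>2) = liminf (\<lambda>k. ennreal ((cmod (s n x - s (r k) x))\<^sup>2))"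
          by (intro lim_imp_Liminf[symmetric]) auto
      qed
      also have "\<dots> \<le> liminf (\<lambda>k. \<integral>\<^sup>+x. ennreal ((cmod (s n x - s (r k) x))\<^sup>2) \<partial>M)"
        by (intro nn_integral_liminf) measurable
      also have "\<dots> \<le> ennreal e"
      proof (rule Liminf_le)
        show "\<forall>\<^sub>F k in sequentially. (\<integral>\<^sup>+x. ennreal ((cmod (s n x - s (r k) x))\<^sup>2) \<partial>M) \<le> ennreal e"
          unfolding eventually_sequentially
        proof (intro exI[of _ N] allI impI)
          fix k assume "k \<ge> N"
          then have "q (s n - s (r k)) < e" using N n rk[of k] by (meson le_trans)
          then show "(\<integral>\<^sup>+x. ennreal ((cmod (s n x - s (r k) x))\<^sup>2) \<partial>M) \<le> ennreal e"
            by (subst L2_nn_integral[OF dif[OF s s]]) (simp add: q_def ennreal_leI)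
        qed
      qed simp
      finally show ?thesis .
    qed
    have snl: "(\<lambda>x. s n x - l x) \<in> L2 M \<and> q (\<lambda>x. s n x - l x) \<le> e"
      if N: "\<forall>m\<ge>N. \<forall>n\<ge>N. q (s m - s n) < e" and n: "n \<ge> N" and e: "e > 0" for n N e
    proof -
      have "(\<lambda>x. s n x - l x) \<in> L2 M"
        by (intro L2I_nn order_le_less_trans[OF fatou[OF N n]]) (auto intro!: borel_measurable_diff L2_measurable[OF s])
      moreover from this have "q (\<lambda>x. s n x - l x) \<le> e"
        using fatou[OF N n] e by (subst (asm) L2_nn_integral) (auto simp: q_def ennreal_le_iff)
      ultimately show ?thesis by simp
    qed
    obtain N0 where N0: "\<forall>m\<ge>N0. \<forall>n\<ge>N0. q (s m - s n) < 1" using c[of 1] by auto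
    have "(\<lambda>x. s N0 x - (s N0 x - l x)) \<in> L2 M"
      using dif[OF s, of "\<lambda>x. s N0 x - l x" N0] snl[OF N0 order_refl] by simp
    then have l: "l \<in> L2 M" by simp
    have "(\<lambda>n. q (s n - l)) \<longlonglongrightarrow> 0"
    proof (rule LIMSEQ_I)
      fix e :: real assume e: "e > 0"
      obtain N where N: "\<forall>m\<ge>N. \<forall>n\<ge>N. q (s m - s n) < e / 2" using c[of "e / 2"] e by auto
      have "norm (q (s n - l) - 0) < e" if "n \<ge> N" for n
      proof -
        have "0 \<le> q (s n - l)" unfolding q_def by simp
        then show ?thesis using snl[OF N that] e by (simp add: qd)
      qed
      then show "\<exists>N. \<forall>n\<ge>N. norm (q (s n - l) - 0) < e" by blast
    qed
    then show "\<exists>l\<in>L2 M. (\<lambda>n. q (s n - l)) \<longlonglongrightarrow> 0" using l by blast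
  qed
qed

section \<open>Integral operators with square integrable kernels\<close>

lemma nn_integral_count_space_has_sum:
  fixes f :: "'b \<Rightarrow> real"
  assumes pos: "\<And>b. b \<in> B \<Longrightarrow> 0 \<le> f b" and s: "(f has_sum s) B"
  shows "(\<integral>\<^sup>+b. ennreal (f b) \<partial>count_space B) = ennreal s"
proof -
  have "(\<lambda>b. norm (f b)) summable_on B"
    using has_sum_imp_summable[OF s] summable_on_iff_abs_summable_on_real by blast
  then have abs: "Infinite_Set_Sum.abs_summable_on f B"
    by (simp only: abs_summable_equivalent)
  show ?thesis
    using nn_integral_conv_infsetsum[OF abs pos] infsetsum_infsum[OF abs] infsumI[OF s] by simp
qed

lemma has_sum_nn_integral_count_space:
  fixes f :: "'b \<Rightarrow> real"
  assumes pos: "\<And>b. b \<in> B \<Longrightarrow> 0 \<le> f b" and "0 \<le> s"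
    and eq: "(\<integral>\<^sup>+b. ennreal (f b) \<partial>count_space B) = ennreal s"
  shows "(f has_sum s) B"
proof -
  have "integrable (count_space B) f"
    by (rule integrableI_nonneg) (use pos eq in \<open>auto simp: AE_count_space\<close>)
  then have "Infinite_Set_Sum.abs_summable_on f B"
    by (simp add: Infinite_Set_Sum.abs_summable_on_def)
  then have "(\<lambda>b. norm (f b)) summable_on B"
    by (simp only: abs_summable_equivalent)
  then have "f summable_on B" by (rule abs_summable_summable)
  then have s': "(f has_sum infsum f B) B" by (rule has_sum_infsum)
  have "ennreal (infsum f B) = ennreal s"
    using nn_integral_count_space_has_sum[OF pos s'] eq by simp
  then have "infsum f B = s"
    using assms(2) infsum_nonneg[of B f] pos by simp
  then show ?thesis using s' by simp
qed

lemma completion_complex_representative: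
  fixes g :: "'a \<Rightarrow> complex"
  assumes [measurable]: "g \<in> borel_measurable (completion M)"
  shows "\<exists>g'\<in>borel_measurable M. AE x in M. g x = g' x"
proof -
  have "(\<lambda>x. Re (g x)) \<in> borel_measurable (completion M)" "(\<lambda>x. Im (g x)) \<in> borel_measurable (completion M)"
    by measurable
  then obtain a b where [measurable]: "a \<in> borel_measurable M" "b \<in> borel_measurable M"
    and eq: "AE x in M. Re (g x) = a x" "AE x in M. Im (g x) = b x"
    using completion_ex_borel_measurable_real by metis
  from eq have "AE x in M. g x = complex_of_real (a x) + \<i> * complex_of_real (b x)"
    by eventually_elim (simp add: complex_eq_iff)
  moreover have "(\<lambda>x. complex_of_real (a x) + \<i> * complex_of_real (b x)) \<in> borel_measurable M"
    by measurable
  ultimately show ?thesis by (intro bexI) auto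
qed

lemma borel_measurable_completion_AE:
  assumes g': "g' \<in> borel_measurable (completion M)" and eq: "AE x in M. g x = g' x"
  shows "g \<in> borel_measurable (completion M)"
proof (rule measurableI)
  fix S :: "'b set" assume S: "S \<in> sets borel"
  show "g -` S \<inter> space (completion M) \<in> sets (completion M)"
  proof (rule completion.in_sets_AE)
    show "AE x in completion M. x \<in> g' -` S \<inter> space (completion M) \<longleftrightarrow> x \<in> g -` S \<inter> space (completion M)"
      using AE_completion[OF eq] by eventually_elim auto
  qed (use measurable_sets[OF g' S] in auto)
qed simp

lemma integrable_completion_cong_AE:
  fixes f g :: "'a \<Rightarrow> 'b::{banach, second_countable_topology}"
  assumes g: "integrable (completion M) g" and eq: "AE x in M. f x = g x"
  shows "integrable (completion M) f"
proof (rule integrable_cong_AE_imp[OF g])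
  show "f \<in> borel_measurable (completion M)"
    using borel_measurable_completion_AE[OF borel_measurable_integrable[OF g] eq] .
  show "AE x in completion M. g x = f x" using AE_completion[OF eq] by eventually_elim simp
qed

text \<open>
  Null sets of a completed measure do not affect measurability, so if one of the functions is not
  integrable, then neither is the other, and both integrals are zero. This makes it possible to
  modify the operators in a field of traces on a null set although the measurability of such a
  field is not known beforehand.
\<close>

lemma integral_completion_cong_AE:
  fixes f g :: "'a \<Rightarrow> 'b::{banach, second_countable_topology}"
  assumes eq: "AE x in M. f x = g x"
  shows "integral\<^sup>L (completion M) f = integral\<^sup>L (completion M) g"
proof (cases "integrable (completion M) g")
  case True
  then show ?thesis
    using integrable_completion_cong_AE[OF True eq] AE_completion[OF eq]
    by (intro integral_cong_AE borel_measurable_integrable)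
next
  case False
  have "AE x in M. g x = f x" using eq by eventually_elim simp
  then have "\<not> integrable (completion M) f"
    using False integrable_completion_cong_AE by blast
  then show ?thesis using False by (simp add: not_integrable_integral_eq)
qed

lemma L2_completion_representative:
  assumes "u \<in> L2 (completion M)"
  shows "\<exists>u'\<in>L2 M. AE x in M. u x = u' x"
proof -
  obtain u' where u' [measurable]: "u' \<in> borel_measurable M" and eq: "AE x in M. u x = u' x"
    using completion_complex_representative[OF L2_measurable[OF assms]] by blast
  have "u' \<in> L2 (completion M)"
    using L2_cong_AE[OF assms measurable_completion[OF u'] AE_completion[OF eq]] .
  moreover have "(\<lambda>x. (cmod (u' x))\<^sup>2) \<in> borel_measurable M" by measurable
  ultimately have "u' \<in> L2 M"
    using u' by (simp add: L2_def integrable_completion)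
  then show ?thesis using eq by blast
qed

lemma L2_completion:
  assumes "f \<in> L2 M"
  shows "f \<in> L2 (completion M)"
proof -
  note [measurable] = L2_measurable[OF assms]
  have "(\<lambda>x. (cmod (f x))\<^sup>2) \<in> borel_measurable M" by measurable
  then show ?thesis
    using assms by (simp add: L2_def integrable_completion measurable_completion)
qed

text \<open>
  The integral formula for \<open>T u\<close> is only required almost everywhere, since kernels given by a
  Plancherel inversion are not under control on a null set. The kernel itself is measurable for
  the product \<open>\<mu> \<Otimes>\<^sub>M \<mu>\<close> before completion, where the Tonelli theorem applies.
\<close>

locale square_integrable_kernel =
  fixes \<mu> :: "'a measure" and k :: "'a \<times> 'a \<Rightarrow> complex" and T :: "('a \<Rightarrow> complex) \<Rightarrow> 'a \<Rightarrow> complex"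
    and K :: real
  assumes sigma_finite: "sigma_finite_measure \<mu>"
    and k_measurable [measurable]: "k \<in> borel_measurable (\<mu> \<Otimes>\<^sub>M \<mu>)"
    and K: "0 \<le> K" "(\<integral>\<^sup>+x. \<integral>\<^sup>+y. ennreal ((cmod (k (x, y)))\<^sup>2) \<partial>\<mu> \<partial>\<mu>) = ennreal K"
    and T: "\<And>u. u \<in> L2 (completion \<mu>) \<Longrightarrow>
      AE x in \<mu>. T u x = (\<integral>y. k (x, y) * u y \<partial>completion \<mu>)"
    and countable_onb: "countable (onb (L2 (completion \<mu>)) (L2_inner (completion \<mu>)))"
begin

sublocale ip: complete_inner_space "L2 (completion \<mu>)" "\<lambda>c f x. c * f x" "L2_inner (completion \<mu>)"
  by (rule complete_inner_space_L2)

sublocale sf: sigma_finite_measure \<mu>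
  by (rule sigma_finite)

text \<open>
  Conjugated, so that \<open>T u x\<close> is the conjugate of the inner product of a fixed vector with \<open>u\<close>.
\<close>

definition slice :: "'a \<Rightarrow> 'a \<Rightarrow> complex" where "slice x y = cnj (k (x, y))"

lemma sq_eq: "ip.sq f = (\<integral>x. (cmod (f x))\<^sup>2 \<partial>completion \<mu>)"
  by (simp add: ip.sq_def L2_inner_self)

lemma ennreal_sq: "f \<in> L2 (completion \<mu>) \<Longrightarrow> ennreal (ip.sq f) = (\<integral>\<^sup>+x. ennreal ((cmod (f x))\<^sup>2) \<partial>\<mu>)"
  unfolding sq_eq by (subst L2_nn_integral[symmetric]) (simp_all add: nn_integral_completion)

lemma k_slice_measurable: "x \<in> space \<mu> \<Longrightarrow> (\<lambda>y. k (x, y)) \<in> borel_measurable \<mu>"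
  by measurable

lemma measurable_norm_slice: "(\<lambda>x. \<integral>\<^sup>+y. ennreal ((cmod (k (x, y)))\<^sup>2) \<partial>\<mu>) \<in> borel_measurable \<mu>"
  by measurable

lemma slice_L2: "AE x in \<mu>. slice x \<in> L2 (completion \<mu>)"
proof -
  have "AE x in \<mu>. (\<integral>\<^sup>+y. ennreal ((cmod (k (x, y)))\<^sup>2) \<partial>\<mu>) \<noteq> \<infinity>"
    using K(2) by (intro nn_integral_PInf_AE measurable_norm_slice) simp
  then show ?thesis
    using AE_space
  proof eventually_elim
    case (elim x)
    have "(\<lambda>y. k (x, y)) \<in> L2 \<mu>"
      using elim by (intro L2I_nn k_slice_measurable) (auto simp: less_top)
    then show ?case
      unfolding slice_def[abs_def] by (intro L2_completion L2_cnj)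
  qed
qed

lemma norm_slice:
  "slice x \<in> L2 (completion \<mu>) \<Longrightarrow> ennreal (ip.sq (slice x)) = (\<integral>\<^sup>+y. ennreal ((cmod (k (x, y)))\<^sup>2) \<partial>\<mu>)"
  by (simp add: ennreal_sq slice_def)

lemma kernel_integrable:
  assumes u: "u \<in> L2 (completion \<mu>)"
  shows "AE x in \<mu>. integrable (completion \<mu>) (\<lambda>y. k (x, y) * u y)"
  using slice_L2
proof eventually_elim
  case (elim x)
  then have "(\<lambda>y. k (x, y)) \<in> L2 (completion \<mu>)"
    using L2_cnj[of "slice x"] by (simp add: slice_def)
  then show ?case using u by (rule L2_mult_integrable)
qed

lemma T_eq_inner:
  assumes u: "u \<in> L2 (completion \<mu>)"
  shows "AE x in \<mu>. T u x = cnj (L2_inner (completion \<mu>) (slice x) u)"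
  using T[OF u]
proof eventually_elim
  case (elim x)
  show ?case unfolding elim L2_inner_def slice_def
    by (subst Bochner_Integration.integral_cnj[symmetric]) simp
qed

lemma T_measurable:
  assumes u: "u \<in> L2 (completion \<mu>)"
  shows "T u \<in> borel_measurable (completion \<mu>)"
proof -
  obtain u' where u': "u' \<in> L2 \<mu>" and eq: "AE x in \<mu>. u x = u' x"
    using L2_completion_representative[OF u] by blast
  note [measurable] = L2_measurable[OF u']
  have "AE x in \<mu>. T u x = (\<integral>y. k (x, y) * u' y \<partial>\<mu>)"
    using T[OF u] AE_space
  proof eventually_elim
    case (elim x)
    note [measurable] = k_slice_measurable[OF elim(2)]
    have "T u x = (\<integral>y. k (x, y) * u y \<partial>completion \<mu>)" by (rule elim)
    also have "\<dots> = (\<integral>y. k (x, y) * u' y \<partial>completion \<mu>)"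
    proof (rule integral_completion_cong_AE)
      show "AE y in \<mu>. k (x, y) * u y = k (x, y) * u' y" using eq by eventually_elim simp
    qed
    also have "\<dots> = (\<integral>y. k (x, y) * u' y \<partial>\<mu>)"
      by (rule integral_completion) measurable
    finally show ?case .
  qed
  moreover have "(\<lambda>x. \<integral>y. k (x, y) * u' y \<partial>\<mu>) \<in> borel_measurable (completion \<mu>)"
    by (rule measurable_completion) measurable
  ultimately show ?thesis by (rule borel_measurable_completion_AE[rotated])
qed

lemma T_bound_nn:
  assumes u: "u \<in> L2 (completion \<mu>)"
  shows "(\<integral>\<^sup>+x. ennreal ((cmod (T u x))\<^sup>2) \<partial>\<mu>) \<le> ennreal (K * ip.sq u)"
proof -
  have "AE x in \<mu>. ennreal ((cmod (T u x))\<^sup>2) \<le>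
      (\<integral>\<^sup>+y. ennreal ((cmod (k (x, y)))\<^sup>2) \<partial>\<mu>) * ennreal (ip.sq u)"
    using T_eq_inner[OF u] slice_L2
  proof eventually_elim
    case (elim x)
    have "(cmod (T u x))\<^sup>2 \<le> ip.sq (slice x) * ip.sq u"
      using ip.cauchy_schwarz[OF elim(2) u] elim(1) by simp
    then have "ennreal ((cmod (T u x))\<^sup>2) \<le> ennreal (ip.sq (slice x)) * ennreal (ip.sq u)"
      using ip.sq_nonneg[OF u] ip.sq_nonneg[OF elim(2)] by (simp add: ennreal_mult[symmetric] ennreal_leI)
    then show ?case unfolding norm_slice[OF elim(2)] .
  qed
  then have "(\<integral>\<^sup>+x. ennreal ((cmod (T u x))\<^sup>2) \<partial>\<mu>) \<le>
      (\<integral>\<^sup>+x. (\<integral>\<^sup>+y. ennreal ((cmod (k (x, y)))\<^sup>2) \<partial>\<mu>) * ennreal (ip.sq u) \<partial>\<mu>)"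
    by (rule nn_integral_mono_AE)
  also have "\<dots> = ennreal K * ennreal (ip.sq u)"
    by (subst nn_integral_multc[OF measurable_norm_slice]) (simp add: K(2))
  finally show ?thesis
    using K(1) ip.sq_nonneg[OF u] by (simp add: ennreal_mult)
qed

lemma T_L2:
  assumes u: "u \<in> L2 (completion \<mu>)"
  shows "T u \<in> L2 (completion \<mu>)"
proof (rule L2I_nn[OF T_measurable[OF u]])
  show "(\<integral>\<^sup>+x. ennreal ((cmod (T u x))\<^sup>2) \<partial>completion \<mu>) < \<infinity>"
    unfolding nn_integral_completion using T_bound_nn[OF u] by (auto intro: order_le_less_trans)
qed

lemma T_bound:
  assumes u: "u \<in> L2 (completion \<mu>)"
  shows "ip.sq (T u) \<le> K * ip.sq u"
proof -
  have "ennreal (ip.sq (T u)) \<le> ennreal (K * ip.sq u)"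
    unfolding ennreal_sq[OF T_L2[OF u]] by (rule T_bound_nn[OF u])
  then show ?thesis
    using K(1) ip.sq_nonneg[OF u] by (subst (asm) ennreal_le_iff) auto
qed

lemma T_bounded_op: "L2_bounded_op (completion \<mu>) T"
  unfolding L2_bounded_op_def
proof (intro conjI ballI allI impI)
  fix f g assume f: "f \<in> L2 (completion \<mu>)" and g: "g \<in> L2 (completion \<mu>)"
  show "AE x in completion \<mu>. T f x = T g x" if eq: "AE x in completion \<mu>. f x = g x"
  proof (rule AE_completion, use T[OF f] T[OF g] in eventually_elim)
    case (elim x)
    have "AE y in \<mu>. k (x, y) * f y = k (x, y) * g y"
      using eq unfolding AE_completion_iff by eventually_elim simp
    then show ?case unfolding elim by (rule integral_completion_cong_AE)
  qed
  fix a b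
  have c: "(\<lambda>z. a * f z + b * g z) \<in> L2 (completion \<mu>)"
    by (intro L2_add L2_cmult f g)
  show "AE x in completion \<mu>. T (\<lambda>z. a * f z + b * g z) x = a * T f x + b * T g x"
  proof (rule AE_completion, use T[OF f] T[OF g] T[OF c] kernel_integrable[OF f] kernel_integrable[OF g] in eventually_elim)
    case (elim x)
    have "(\<integral>y. k (x, y) * (a * f y + b * g y) \<partial>completion \<mu>) =
        (\<integral>y. a * (k (x, y) * f y) + b * (k (x, y) * g y) \<partial>completion \<mu>)"
      by (simp add: algebra_simps)
    also have "\<dots> = a * T f x + b * T g x"
      unfolding elim(1,2) using elim(4,5) by simp
    finally show ?case using elim(3) by simp
  qed
next
  show "\<exists>C. \<forall>f\<in>L2 (completion \<mu>). L2_norm (completion \<mu>) (T f) \<le> C * L2_norm (completion \<mu>) f"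
  proof (intro exI[of _ "sqrt K"] ballI)
    fix f assume "f \<in> L2 (completion \<mu>)"
    then show "L2_norm (completion \<mu>) (T f) \<le> sqrt K * L2_norm (completion \<mu>) f"
      using T_bound[of f] by (simp add: L2_norm_def sq_eq real_sqrt_mult[symmetric])
  qed
qed (rule T_L2)

text \<open>
  By the Parseval identity in the slice at \<open>x\<close>, the sum of \<open>\<bar>T b x\<bar>\<^sup>2\<close> over the basis is the squared
  norm of the slice; now integrate over \<open>x\<close>. Countability of the basis is needed twice: for one null
  set that serves all basis vectors, and for exchanging sum and integral.
\<close>

lemma T_hs_sum:
  "((\<lambda>b. Re (L2_inner (completion \<mu>) (T b) (T b))) has_sum K)
     (onb (L2 (completion \<mu>)) (L2_inner (completion \<mu>)))"
proof -
  let ?B = "onb (L2 (completion \<mu>)) (L2_inner (completion \<mu>))"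
  note B = ip.onb_mem
  have "AE x in \<mu>. \<forall>b\<in>?B. T b x = cnj (L2_inner (completion \<mu>) (slice x) b)"
    using T_eq_inner[OF B] by (subst AE_ball_countable[OF countable_onb]) blast
  then have AE: "AE x in \<mu>. (\<integral>\<^sup>+b. ennreal ((cmod (T b x))\<^sup>2) \<partial>count_space ?B) =
      (\<integral>\<^sup>+y. ennreal ((cmod (k (x, y)))\<^sup>2) \<partial>\<mu>)"
    using slice_L2
  proof eventually_elim
    case (elim x)
    have "(\<integral>\<^sup>+b. ennreal ((cmod (T b x))\<^sup>2) \<partial>count_space ?B) =
        (\<integral>\<^sup>+b. ennreal ((cmod (L2_inner (completion \<mu>) (slice x) b))\<^sup>2) \<partial>count_space ?B)"
      using elim(1) by (intro nn_integral_cong) simp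
    also have "\<dots> = ennreal (ip.sq (slice x))"
      by (rule nn_integral_count_space_has_sum[OF _ ip.onb_parseval[OF elim(2)]]) simp
    finally show ?case by (simp only: norm_slice[OF elim(2)])
  qed
  have "(\<integral>\<^sup>+b. ennreal (ip.sq (T b)) \<partial>count_space ?B) =
      (\<integral>\<^sup>+b. \<integral>\<^sup>+x. ennreal ((cmod (T b x))\<^sup>2) \<partial>completion \<mu> \<partial>count_space ?B)"
    using ennreal_sq[OF T_L2[OF B]] by (intro nn_integral_cong) (simp add: nn_integral_completion)
  also have "\<dots> = (\<integral>\<^sup>+x. \<integral>\<^sup>+b. ennreal ((cmod (T b x))\<^sup>2) \<partial>count_space ?B \<partial>completion \<mu>)"
  proof (rule nn_integral_count_space_nn_integral[OF countable_onb, symmetric])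
    fix b assume "b \<in> ?B"
    note [measurable] = T_measurable[OF B[OF this]]
    show "(\<lambda>x. ennreal ((cmod (T b x))\<^sup>2)) \<in> borel_measurable (completion \<mu>)" by measurable
  qed
  also have "\<dots> = (\<integral>\<^sup>+x. \<integral>\<^sup>+y. ennreal ((cmod (k (x, y)))\<^sup>2) \<partial>\<mu> \<partial>\<mu>)"
    unfolding nn_integral_completion using AE by (rule nn_integral_cong_AE)
  finally have "(\<integral>\<^sup>+b. ennreal (ip.sq (T b)) \<partial>count_space ?B) = ennreal K"
    using K(2) by simp
  then show ?thesis
    unfolding ip.sq_def[symmetric]
    by (intro has_sum_nn_integral_count_space K(1) ip.sq_nonneg T_L2 B)
qed

lemma T_hilbert_schmidt: "L2_hilbert_schmidt (completion \<mu>) T"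
  unfolding L2_hilbert_schmidt_def hs_summable_def
  using T_bounded_op has_sum_imp_summable[OF T_hs_sum] by blast

lemma T_hs_norm: "hs_norm (L2 (completion \<mu>)) (L2_inner (completion \<mu>)) T = sqrt K"
  unfolding hs_norm_def using infsumI[OF T_hs_sum] by simp

end

section \<open>Countability of orthonormal sets of square integrable functions\<close>

lemma countable_Int_stable_generator:
  "\<exists>P :: 'a::second_countable_topology set set. countable P \<and> Int_stable P \<and> UNIV \<in> P \<and>
     sigma_sets UNIV P = sets borel"
proof -
  obtain B :: "'a set set" where B: "countable B" "topological_basis B"
    using ex_countable_basis by blast
  let ?P = "Inter ` {F. finite F \<and> F \<subseteq> B}"
  have "countable ?P" by (intro countable_image countable_Collect_finite_subset B(1))
  moreover have "Int_stable ?P"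
  proof (rule Int_stableI)
    fix X Y assume "X \<in> ?P" "Y \<in> ?P"
    then obtain F G where "finite F" "F \<subseteq> B" "X = \<Inter>F" "finite G" "G \<subseteq> B" "Y = \<Inter>G" by blast
    then show "X \<inter> Y \<in> ?P"
      by (intro image_eqI[of _ _ "F \<union> G"]) auto
  qed
  moreover have "UNIV \<in> ?P" by (rule image_eqI[of _ _ "{}"]) auto
  moreover have "sigma_sets UNIV ?P = sets borel"
  proof (rule antisym)
    have "?P \<subseteq> sets borel"
    proof (rule image_subsetI)
      fix F assume "F \<in> {F. finite F \<and> F \<subseteq> B}"
      then have F: "finite F" "F \<subseteq> B" by auto
      have "open (\<Inter>F)" using F topological_basis_open[OF B(2)] by (intro open_Inter) auto
      then show "\<Inter>F \<in> sets borel" by simp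
    qed
    then show "sigma_sets UNIV ?P \<subseteq> sets borel"
      using sets.sigma_sets_subset[of ?P borel] by simp
    have "B \<subseteq> ?P"
    proof
      fix b assume "b \<in> B"
      then show "b \<in> ?P" by (intro image_eqI[of _ _ "{b}"]) auto
    qed
    then have "sigma_sets UNIV B \<subseteq> sigma_sets UNIV ?P" by (rule sigma_sets_mono')
    moreover have "sets borel = sigma_sets UNIV B"
      by (subst borel_eq_countable_basis[OF B]) (simp add: sets_measure_of)
    ultimately show "sets borel \<subseteq> sigma_sets UNIV ?P" by simp
  qed
  ultimately show ?thesis by (intro exI[of _ ?P]) simp
qed

text \<open>
  The sets over which \<open>g\<close> has integral zero form a Dynkin system.
\<close>

lemma AE_zero_if_integrals_zero:
  fixes g :: "'a \<Rightarrow> complex"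
  assumes sf: "sigma_finite_measure \<mu>" and gen: "sigma_sets (space \<mu>) P = sets \<mu>"
    and P: "Int_stable P" "P \<subseteq> Pow (space \<mu>)" "space \<mu> \<in> P" and g: "integrable \<mu> g"
    and zero: "\<And>p. p \<in> P \<Longrightarrow> (LINT x:p|\<mu>. g x) = 0"
  shows "AE x in \<mu>. g x = 0"
proof (rule sigma_finite_measure.density_zero[OF sf g])
  have si: "set_integrable \<mu> E g" if "E \<in> sets \<mu>" for E
    using that g unfolding set_integrable_def by (rule integrable_mult_indicator)
  fix E assume "E \<in> sets \<mu>"
  then have "E \<in> sigma_sets (space \<mu>) P" by (simp add: gen)
  from P(1,2) this show "(LINT x:E|\<mu>. g x) = 0"
  proof (induction E rule: sigma_sets_induct_disjoint)
    case (basic E)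
    then show ?case by (rule zero)
  next
    case empty
    show ?case by (simp add: set_lebesgue_integral_def)
  next
    case (compl E)
    then have E: "E \<in> sets \<mu>" by (simp add: gen)
    have "(LINT x:E \<union> (space \<mu> - E)|\<mu>. g x) = (LINT x:E|\<mu>. g x) + (LINT x:space \<mu> - E|\<mu>. g x)"
      using E by (intro set_integral_Un si) auto
    moreover have "E \<union> (space \<mu> - E) = space \<mu>" using sets.sets_into_space[OF E] by blast
    ultimately show ?case using compl zero[OF P(3)] by simp
  next
    case (union E)
    then have E: "E i \<in> sets \<mu>" for i using gen by auto
    have "(LINT x:(\<Union>i. E i)|\<mu>. g x) = (\<Sum>i. LINT x:E i|\<mu>. g x)"
      using E union(1) by (intro lebesgue_integral_countable_add si) (auto simp: disjoint_family_on_def)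
    then show ?case using union(3) by simp
  qed
qed

text \<open>
  Countably many indicator functions of sets of finite measure are total in \<open>L\<^sup>2\<close>. Each of them has
  only countably many nonzero coefficients along \<open>B\<close> by the Bessel inequality, and each member of \<open>B\<close>
  has a nonzero coefficient with one of them.
\<close>

lemma countable_orthonormal_L2:
  fixes \<mu> :: "'a::second_countable_topology measure"
  assumes sf: "sigma_finite_measure \<mu>" and sets: "sets \<mu> = sets borel"
    and B: "semi_inner_space.orthonormal (L2 (completion \<mu>)) (L2_inner (completion \<mu>)) B"
  shows "countable B"
proof -
  let ?M = "completion \<mu>"
  interpret ip: complete_inner_space "L2 ?M" "\<lambda>c f x. c * f x" "L2_inner ?M"
    by (rule complete_inner_space_L2)
  interpret sf: sigma_finite_measure \<mu> by (rule sf)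
  have sp: "space \<mu> = UNIV" using sets_eq_imp_space_eq[OF sets] by simp
  obtain P :: "'a set set" where P: "countable P" "Int_stable P" "UNIV \<in> P" "sigma_sets UNIV P = Sigma_Algebra.sets borel"
    using countable_Int_stable_generator by blast
  have Pm: "p \<in> Sigma_Algebra.sets \<mu>" if "p \<in> P" for p
    using sigma_sets.Basic[OF that] P(4) sets by blast
  obtain A :: "nat \<Rightarrow> 'a set" where A: "range A \<subseteq> Sigma_Algebra.sets \<mu>" "(\<Union>i. A i) = space \<mu>"
    "\<And>i. emeasure \<mu> (A i) \<noteq> \<infinity>"
    using sf.sigma_finite by blast
  define e where "e n p = (\<lambda>x. indicator (A n \<inter> p) x :: complex)" for n p
  have e_L2: "e n p \<in> L2 \<mu>" if "p \<in> P" for n p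
  proof (rule L2I_nn)
    have m: "A n \<inter> p \<in> Sigma_Algebra.sets \<mu>" using A(1) Pm[OF that] by auto
    then show "e n p \<in> borel_measurable \<mu>" unfolding e_def by measurable
    have "(\<integral>\<^sup>+x. ennreal ((cmod (e n p x))\<^sup>2) \<partial>\<mu>) = (\<integral>\<^sup>+x. indicator (A n \<inter> p) x \<partial>\<mu>)"
      unfolding e_def by (intro nn_integral_cong) (auto simp: indicator_def)
    also have "\<dots> = emeasure \<mu> (A n \<inter> p)" using m by simp
    also have "\<dots> \<le> emeasure \<mu> (A n)" using A(1) by (intro emeasure_mono) auto
    also have "\<dots> < \<infinity>" using A(3)[of n] by (simp add: less_top)
    finally show "(\<integral>\<^sup>+x. ennreal ((cmod (e n p x))\<^sup>2) \<partial>\<mu>) < \<infinity>" .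
  qed
  note eM = L2_completion[OF e_L2]
  have total: "\<exists>n. \<exists>p\<in>P. L2_inner ?M (e n p) b \<noteq> 0" if b: "b \<in> B" for b
  proof (rule ccontr)
    assume "\<not> ?thesis"
    then have z: "L2_inner ?M (e n p) b = 0" if "p \<in> P" for n p using that by blast
    have bL: "b \<in> L2 ?M" "L2_inner ?M b b = 1" using ip.orthonormalD[OF B] b by auto
    obtain f where f: "f \<in> L2 \<mu>" and eq: "AE x in \<mu>. cnj (b x) = f x"
      using L2_completion_representative[OF L2_cnj[OF bL(1)]] by blast
    note [measurable] = L2_measurable[OF f] L2_measurable[OF bL(1)]
    have "AE x in \<mu>. e n UNIV x * f x = 0" for n
    proof (rule AE_zero_if_integrals_zero[OF sf _ P(2)])
      show "sigma_sets (space \<mu>) P = Sigma_Algebra.sets \<mu>" using P(4) sets sp by simp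
      show "P \<subseteq> Pow (space \<mu>)" "space \<mu> \<in> P" using P(3) sp by auto
      show "integrable \<mu> (\<lambda>x. e n UNIV x * f x)"
        by (rule L2_mult_integrable[OF e_L2[OF P(3)] f])
      fix p assume p: "p \<in> P"
      note [measurable] = L2_measurable[OF e_L2[OF p, of n]]
      have "(LINT x:p|\<mu>. e n UNIV x * f x) = (\<integral>x. e n p x * f x \<partial>\<mu>)"
        unfolding set_lebesgue_integral_def
        by (intro Bochner_Integration.integral_cong) (auto simp: e_def indicator_def)
      also have "\<dots> = (\<integral>x. e n p x * f x \<partial>?M)"
        by (rule integral_completion[symmetric]) measurable
      also have "\<dots> = (\<integral>x. e n p x * cnj (b x) \<partial>?M)"
      proof (rule integral_completion_cong_AE)
        show "AE x in \<mu>. e n p x * f x = e n p x * cnj (b x)" using eq by eventually_elim simp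
      qed
      also have "\<dots> = 0" using z[OF p, of n] by (simp add: L2_inner_def)
      finally show "(LINT x:p|\<mu>. e n UNIV x * f x) = 0" .
    qed
    then have "AE x in \<mu>. \<forall>n. e n UNIV x * f x = 0"
      unfolding AE_all_countable by (rule allI)
    then have "AE x in \<mu>. b x = 0"
      using eq
    proof eventually_elim
      case (elim x)
      obtain n where "x \<in> A n" using A(2) sp by blast
      then have "f x = 0" using elim(1)[rule_format, of n] by (simp add: e_def)
      then show ?case using elim(2) by simp
    qed
    then have "AE x in \<mu>. b x * cnj (b x) = 0" by eventually_elim simp
    then have "L2_inner ?M b b = (\<integral>x. 0 \<partial>?M)"
      unfolding L2_inner_def by (rule integral_completion_cong_AE)
    then show False using bL(2) by simp
  qed
  have "B \<subseteq> (\<Union>n. \<Union>p\<in>P. {b \<in> B. (cmod (L2_inner ?M (e n p) b))\<^sup>2 \<noteq> 0})"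
    using total by fastforce
  moreover have "countable (\<Union>n. \<Union>p\<in>P. {b \<in> B. (cmod (L2_inner ?M (e n p) b))\<^sup>2 \<noteq> 0})"
    by (intro countable_UN P(1) countableI_type summable_countable_real ip.bessel_summable[OF B] eM)
  ultimately show ?thesis by (rule countable_subset)
qed

section \<open>Symbols in the fibres\<close>

lemma space_mackey_borel: "space mackey_borel = unitary_dual"
  unfolding mackey_borel_def by (rule space_measure_of) blast

lemma unitary_dual_member_irreducible:
  assumes "\<xi> \<in> unitary_dual" "\<rho> \<in> \<xi>"
  shows "irreducible_rep \<rho>"
  using assms unfolding unitary_dual_def quotient_def by blast

lemma irreducible_rep_unitary:
  assumes "irreducible_rep (H, \<pi>)"
  shows "hilbert_subspace H" "unitary_op H H (\<pi> x)"
  using assms by (auto simp: irreducible_rep_def unitary_rep_def)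

lemma scaleC_zero_left: "0 *\<^sub>C v = (0::'h::chilbert_space)"
  using scaleC_add_left[of 0 0 v] by simp

lemma scaleC_one: "1 *\<^sub>C v = (v::'h::chilbert_space)"
  using scaleR_scaleC[of 1 v] by simp

lemma plancherel_transform_linear_comb:
  fixes \<phi> :: "nat \<Rightarrow> 'g \<Rightarrow> complex"
  assumes lin: "\<forall>f\<in>L2 M. \<forall>g\<in>L2 M. \<forall>a b. AE \<xi> in N. \<forall>v\<in>H \<xi>.
        P (\<lambda>x. a * f x + b * g x) \<xi> v = a *\<^sub>C P f \<xi> v + b *\<^sub>C P g \<xi> v"
    and \<phi>: "\<And>k. k < n \<Longrightarrow> \<phi> k \<in> L2 M"
  shows "(\<lambda>z. \<Sum>k<n. c k * \<phi> k z) \<in> L2 M \<and>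
    (AE \<xi> in N. \<forall>v\<in>H \<xi>. P (\<lambda>z. \<Sum>k<n. c k * \<phi> k z) \<xi> v = (\<Sum>k<n. c k *\<^sub>C P (\<phi> k) \<xi> v))"
  using \<phi>
proof (induction n)
  case 0
  have z: "(\<lambda>x. 0) \<in> L2 M" by (simp add: L2_def)
  have "AE \<xi> in N. \<forall>v\<in>H \<xi>. P (\<lambda>x. 0 * 0 + 0 * 0) \<xi> v = 0 *\<^sub>C P (\<lambda>x. 0) \<xi> v + 0 *\<^sub>C P (\<lambda>x. 0) \<xi> v"
    using lin[rule_format, OF z z, of 0 0] .
  then show ?case using z by (simp add: scaleC_zero_left)
next
  case (Suc n)
  let ?s = "\<lambda>z. \<Sum>k<n. c k * \<phi> k z"
  have s: "?s \<in> L2 M" and eq: "AE \<xi> in N. \<forall>v\<in>H \<xi>. P ?s \<xi> v = (\<Sum>k<n. c k *\<^sub>C P (\<phi> k) \<xi> v)"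
    using Suc by auto
  have n: "\<phi> n \<in> L2 M" using Suc.prems by simp
  have "AE \<xi> in N. \<forall>v\<in>H \<xi>. P (\<lambda>x. 1 * ?s x + c n * \<phi> n x) \<xi> v = 1 *\<^sub>C P ?s \<xi> v + c n *\<^sub>C P (\<phi> n) \<xi> v"
    using lin[rule_format, OF s n, of 1 "c n"] .
  then have "AE \<xi> in N. \<forall>v\<in>H \<xi>. P (\<lambda>z. \<Sum>k<Suc n. c k * \<phi> k z) \<xi> v = (\<Sum>k<Suc n. c k *\<^sub>C P (\<phi> k) \<xi> v)"
    using eq by eventually_elim (simp add: scaleC_one)
  moreover have "(\<lambda>z. \<Sum>k<Suc n. c k * \<phi> k z) \<in> L2 M"
    using L2_add[OF s L2_cmult[OF n, of "c n"]] by simp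
  ultimately show ?case by blast
qed

lemma L2_tensor:
  assumes sf: "sigma_finite_measure \<mu>" and f: "f \<in> L2 \<mu>" and g: "g \<in> L2 \<mu>"
  shows "(\<lambda>p. f (fst p) * g (snd p)) \<in> L2 (\<mu> \<Otimes>\<^sub>M \<mu>)"
proof (rule L2I_nn)
  interpret sigma_finite_measure \<mu> by (rule sf)
  note [measurable] = L2_measurable[OF f] L2_measurable[OF g]
  show "(\<lambda>p. f (fst p) * g (snd p)) \<in> borel_measurable (\<mu> \<Otimes>\<^sub>M \<mu>)" by measurable
  have "(\<integral>\<^sup>+p. ennreal ((cmod (f (fst p) * g (snd p)))\<^sup>2) \<partial>(\<mu> \<Otimes>\<^sub>M \<mu>)) =
      (\<integral>\<^sup>+x. \<integral>\<^sup>+y. ennreal ((cmod (f x * g y))\<^sup>2) \<partial>\<mu> \<partial>\<mu>)"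
    by (subst nn_integral_fst[symmetric]) simp_all
  also have "\<dots> = (\<integral>\<^sup>+x. \<integral>\<^sup>+y. ennreal ((cmod (f x))\<^sup>2) * ennreal ((cmod (g y))\<^sup>2) \<partial>\<mu> \<partial>\<mu>)"
    by (simp add: norm_mult power_mult_distrib ennreal_mult)
  also have "\<dots> = (\<integral>\<^sup>+x. ennreal ((cmod (f x))\<^sup>2) \<partial>\<mu>) * (\<integral>\<^sup>+y. ennreal ((cmod (g y))\<^sup>2) \<partial>\<mu>)"
    by (simp add: nn_integral_cmult nn_integral_multc)
  also have "\<dots> < \<infinity>"
    unfolding L2_nn_integral[OF f] L2_nn_integral[OF g] by (simp add: ennreal_mult_less_top)
  finally show "(\<integral>\<^sup>+p. ennreal ((cmod (f (fst p) * g (snd p)))\<^sup>2) \<partial>(\<mu> \<Otimes>\<^sub>M \<mu>)) < \<infinity>" .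
qed

lemma L2_sum:
  assumes "\<And>k. k < (n::nat) \<Longrightarrow> f k \<in> L2 M"
  shows "(\<lambda>x. \<Sum>k<n. f k x) \<in> L2 M"
  using assms
proof (induction n)
  case 0
  show ?case by (simp add: L2_def)
next
  case (Suc n)
  have "(\<lambda>x. (\<Sum>k<n. f k x) + f n x) \<in> L2 M"
    using Suc by (intro L2_add) auto
  then show ?case by simp
qed

lemma choice_below:
  fixes n :: nat
  assumes "\<And>k. k < n \<Longrightarrow> \<exists>x. Q k x \<and> R k x"
  shows "\<exists>h. (\<forall>k<n. Q k (h k)) \<and> (\<forall>k<n. R k (h k))"
proof -
  have "\<forall>k. \<exists>x. k < n \<longrightarrow> Q k x \<and> R k x" using assms by blast
  from choice[OF this] obtain h where "\<forall>k. k < n \<longrightarrow> Q k (h k) \<and> R k (h k)" ..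
  then show ?thesis by (intro exI[of _ h]) simp
qed

lemma AE_below:
  fixes n :: nat
  assumes "\<And>k. k < n \<Longrightarrow> AE x in M. Q k x"
  shows "AE x in M. \<forall>k<n. Q k x"
proof -
  have "AE x in M. \<forall>k\<in>{..<n}. Q k x"
    using assms by (subst AE_ball_countable) auto
  then show ?thesis unfolding Ball_def lessThan_iff .
qed

text \<open>
  Write the symbol as \<open>\<Sum> f\<^sub>k \<otimes> F\<^sub>k\<close> and let \<open>\<phi>\<^sub>k\<close> be the function with Plancherel transform \<open>F\<^sub>k\<close>.
  For almost every \<open>x\<close> the field \<open>A(x, \<cdot>)\<close> is then the transform of \<open>\<Sum> f\<^sub>k(x) \<phi>\<^sub>k\<close>, which gives
  the last identity since the transform is isometric. Applying the isometry to this one function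
  avoids expanding the trace of \<open>A A\<^sup>*\<close>, whose mixed terms would have to be shown integrable.

  The inversion formula, on the other hand, is applied to each \<open>F\<^sub>k\<close> separately and summed by
  linearity of the trace: the exceptional set of \<open>z\<close>, the complement of \<open>G\<close>, then does not depend
  on \<open>x\<close>. The functions \<open>f\<close> and \<open>\<phi>\<close> obtained are Borel representatives.
\<close>

lemma symbol_fibre_identities:
  fixes \<mu> :: "'g::{topological_group_add, t2_space, second_countable_topology} measure"
    and \<nu> :: "('g, 'h::{chilbert_space, second_countable_topology}) rep set measure"
  assumes sf: "sigma_finite_measure \<mu>"
    and data: "plancherel_data \<mu> \<Delta> \<nu> H e \<pi> D S"
    and A: "A \<in> symbols \<mu> \<nu> H e S"
  shows "\<exists>(n::nat) f \<phi> G. (\<forall>k<n. f k \<in> L2 \<mu> \<and> \<phi> k \<in> L2 \<mu>) \<and> (AE z in \<mu>. G z) \<and>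
    (AE x in \<mu>. \<forall>z. G z \<longrightarrow>
       (\<integral>\<xi>. tr_pi (H \<xi>) (S \<xi>) (\<pi> \<xi>) (A x \<xi>) z \<partial>completion \<nu>) = (\<Sum>k<n. f k x * \<phi> k z)) \<and>
    (AE x in \<mu>. (\<integral>\<xi>. op_trace (H \<xi>) (A x \<xi> \<circ> adjoint_op (H \<xi>) (A x \<xi>)) \<partial>completion \<nu>) =
       complex_of_real (\<integral>z. (cmod (\<Sum>k<n. f k x * \<phi> k z))\<^sup>2 \<partial>\<mu>))"
proof -
  let ?M = "completion \<mu>" and ?N = "completion \<nu>"
  let ?tr = "\<lambda>F \<xi> z. tr_pi (H \<xi>) (S \<xi>) (\<pi> \<xi>) F z"
  note D = data[unfolded plancherel_data_def]
  have sets\<nu>: "sets \<nu> = sets mackey_borel"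
    using D by (elim conjE) assumption
  have sf\<nu>: "sigma_finite_measure \<nu>"
    using D by (elim conjE) assumption
  have mem: "(H \<xi>, \<pi> \<xi>) \<in> \<xi>" if "\<xi> \<in> unitary_dual" for \<xi>
    using D that by (elim conjE) blast
  have sqrt: "is_sqrt_op (H \<xi>) (D \<xi>) (S \<xi>)" if "\<xi> \<in> unitary_dual" for \<xi>
    using D that by (elim conjE) blast
  obtain P where P: "plancherel_transform ?M ?N H e \<pi> S P" "plancherel_inversion ?M ?N H e \<pi> S P"
    using D by (elim conjE exE) (rule that)
  have space\<nu>: "space \<nu> = unitary_dual"
    using sets_eq_imp_space_eq[OF sets\<nu>] space_mackey_borel by simp
  have fib: "hilbert_subspace (H \<xi>)" "unitary_op (H \<xi>) (H \<xi>) (\<pi> \<xi> z)"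
    "S \<xi> \<subseteq> H \<xi> \<times> H \<xi>" "H \<xi> \<subseteq> closure (Domain (S \<xi>))" if "\<xi> \<in> space \<nu>" for \<xi> z
  proof -
    have \<xi>: "\<xi> \<in> unitary_dual" using that space\<nu> by simp
    show "hilbert_subspace (H \<xi>)" "unitary_op (H \<xi>) (H \<xi>) (\<pi> \<xi> z)"
      using irreducible_rep_unitary[OF unitary_dual_member_irreducible[OF \<xi> mem[OF \<xi>]]] by blast+
    show "S \<xi> \<subseteq> H \<xi> \<times> H \<xi>" "H \<xi> \<subseteq> closure (Domain (S \<xi>))"
      using sqrt[OF \<xi>] by (simp_all add: is_sqrt_op_def pos_self_adjoint_def)
  qed
  interpret s\<mu>: sigma_finite_measure \<mu> by (rule sf)
  interpret s\<nu>: sigma_finite_measure \<nu> by (rule sf\<nu>)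
  interpret pair: pair_sigma_finite \<mu> \<nu> ..
  obtain n and f :: "nat \<Rightarrow> 'g \<Rightarrow> complex" and F where
    fF: "\<And>k. k < n \<Longrightarrow> f k \<in> L2 ?M" "\<And>k. k < n \<Longrightarrow> F k \<in> B1_space ?N H e S"
      "\<And>k. k < n \<Longrightarrow> F k \<in> B2_space ?N H e"
    and AE_A: "AE (x, \<xi>) in \<mu> \<Otimes>\<^sub>M \<nu>. \<forall>v\<in>H \<xi>. A x \<xi> v = (\<Sum>k<n. f k x *\<^sub>C F k \<xi> v)"
    using A unfolding symbols_def by auto
  have A_fib: "AE x in \<mu>. AE \<xi> in \<nu>. \<forall>v\<in>H \<xi>. A x \<xi> v = (\<Sum>k<n. f k x *\<^sub>C F k \<xi> v)"
    using pair.AE_pair[OF AE_A] by simp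
  note PT = P(1)[unfolded plancherel_transform_def]
  have P_B2: "P g \<in> B2_space ?N H e" if "g \<in> L2 ?M" for g
    using PT that by (elim conjE) blast
  have P_lin: "\<forall>f\<in>L2 ?M. \<forall>g\<in>L2 ?M. \<forall>a b. AE \<xi> in ?N. \<forall>v\<in>H \<xi>.
        P (\<lambda>x. a * f x + b * g x) \<xi> v = a *\<^sub>C P f \<xi> v + b *\<^sub>C P g \<xi> v"
    using PT by (elim conjE) assumption
  have P_inner: "B2_inner ?N H (P g) (P g) = L2_inner ?M g g" if "g \<in> L2 ?M" for g
    using PT that by (elim conjE) blast
  have P_surj: "\<forall>F\<in>B2_space ?N H e. \<exists>f\<in>L2 ?M. AE \<xi> in ?N. \<forall>v\<in>H \<xi>. P f \<xi> v = F \<xi> v"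
    using PT by (elim conjE) assumption
  have "\<exists>\<phi>. \<phi> \<in> L2 ?M \<and> (AE \<xi> in \<nu>. \<forall>v\<in>H \<xi>. P \<phi> \<xi> v = F k \<xi> v)" if "k < n" for k
    using P_surj[rule_format, OF fF(3)[OF that]] unfolding AE_completion_iff by blast
  from choice_below[OF this] obtain \<phi> where
    cP\<phi>: "(\<forall>k<n. \<phi> k \<in> L2 ?M) \<and> (\<forall>k<n. AE \<xi> in \<nu>. \<forall>v\<in>H \<xi>. P (\<phi> k) \<xi> v = F k \<xi> v)" ..
  note \<phi> = conjunct1[OF cP\<phi>, rule_format] and P\<phi> = conjunct2[OF cP\<phi>, THEN spec, THEN mp]
  have "\<exists>f'. f' \<in> L2 \<mu> \<and> (AE x in \<mu>. f k x = f' x)" if "k < n" for k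
    using L2_completion_representative[OF fF(1)[OF that]] by blast
  from choice_below[OF this] obtain f' where
    cff': "(\<forall>k<n. f' k \<in> L2 \<mu>) \<and> (\<forall>k<n. AE x in \<mu>. f k x = f' k x)" ..
  note f' = conjunct1[OF cff', rule_format] and ff' = conjunct2[OF cff', THEN spec, THEN mp]
  have "\<exists>\<phi>'. \<phi>' \<in> L2 \<mu> \<and> (AE x in \<mu>. \<phi> k x = \<phi>' x)" if "k < n" for k
    using L2_completion_representative[OF \<phi>[OF that]] by blast
  from choice_below[OF this] obtain \<phi>' where
    c\<phi>\<phi>': "(\<forall>k<n. \<phi>' k \<in> L2 \<mu>) \<and> (\<forall>k<n. AE x in \<mu>. \<phi> k x = \<phi>' k x)" ..
  note \<phi>' = conjunct1[OF c\<phi>\<phi>', rule_format] and \<phi>\<phi>' = conjunct2[OF c\<phi>\<phi>', THEN spec, THEN mp]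
  have ff'_all: "AE x in \<mu>. \<forall>k<n. f k x = f' k x"
    using ff' by (rule AE_below)
  have \<phi>\<phi>'_all: "AE x in \<mu>. \<forall>k<n. \<phi> k x = \<phi>' k x"
    using \<phi>\<phi>' by (rule AE_below)
  have P\<phi>_all: "AE \<xi> in \<nu>. \<forall>k<n. \<forall>v\<in>H \<xi>. P (\<phi> k) \<xi> v = F k \<xi> v"
    using P\<phi> by (rule AE_below)
  define G where "G z \<longleftrightarrow> (\<forall>k<n. \<phi> k z = \<phi>' k z \<and> integrable ?N (\<lambda>\<xi>. ?tr (F k \<xi>) \<xi> z) \<and>
      \<phi> k z = (\<integral>\<xi>. ?tr (F k \<xi>) \<xi> z \<partial>?N))" for z
  have inv: "AE z in \<mu>. integrable ?N (\<lambda>\<xi>. ?tr (F k \<xi>) \<xi> z) \<and> \<phi> k z = (\<integral>\<xi>. ?tr (F k \<xi>) \<xi> z \<partial>?N)"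
    if k: "k < n" for k
    using P(2)[unfolded plancherel_inversion_def, rule_format, OF IntI[OF fF(2,3)[OF k]] \<phi>[OF k]]
      P\<phi>[OF k] unfolding AE_completion_iff by blast
  then have "AE z in \<mu>. \<forall>k<n. integrable ?N (\<lambda>\<xi>. ?tr (F k \<xi>) \<xi> z) \<and> \<phi> k z = (\<integral>\<xi>. ?tr (F k \<xi>) \<xi> z \<partial>?N)"
    by (rule AE_below)
  then have AE_G: "AE z in \<mu>. G z"
    using \<phi>\<phi>'_all unfolding G_def by eventually_elim simp
  have tc: "AE \<xi> in \<nu>. \<forall>k<n. \<exists>T. trace_class (H \<xi>) T \<and> extends_prod T (F k \<xi>) (S \<xi>)"
    by (rule AE_below) (use fF(2) in \<open>simp add: B1_space_def AE_completion_iff\<close>)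
  have 1: "AE x in \<mu>. \<forall>z. G z \<longrightarrow> (\<integral>\<xi>. ?tr (A x \<xi>) \<xi> z \<partial>?N) = (\<Sum>k<n. f' k x * \<phi>' k z)"
    using A_fib ff'_all
  proof eventually_elim
    case (elim x)
    show ?case
    proof (intro allI impI)
      fix z assume G: "G z"
      have "AE \<xi> in \<nu>. ?tr (A x \<xi>) \<xi> z = (\<Sum>k<n. f k x * ?tr (F k \<xi>) \<xi> z)"
        using elim(1) tc AE_space
      proof eventually_elim
        case (elim \<xi>)
        show ?case
        proof (rule tr_pi_linear_comb)
          show "\<exists>T. trace_class (H \<xi>) T \<and> extends_prod T (F k \<xi>) (S \<xi>)" if "k < n" for k
            using elim(2) that by blast
          show "A x \<xi> v = (\<Sum>k<n. f k x *\<^sub>C F k \<xi> v)" if "v \<in> H \<xi>" for v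
            using elim(1) that by blast
        qed (use fib[OF elim(3)] in auto)
      qed
      then have "(\<integral>\<xi>. ?tr (A x \<xi>) \<xi> z \<partial>?N) = (\<integral>\<xi>. (\<Sum>k<n. f k x * ?tr (F k \<xi>) \<xi> z) \<partial>?N)"
        by (rule integral_completion_cong_AE)
      also have "\<dots> = (\<Sum>k<n. f k x * (\<integral>\<xi>. ?tr (F k \<xi>) \<xi> z \<partial>?N))"
        using G unfolding G_def
        by (subst Bochner_Integration.integral_sum) auto
      also have "\<dots> = (\<Sum>k<n. f' k x * \<phi>' k z)"
      proof (intro sum.cong refl)
        fix k assume "k \<in> {..<n}"
        then have k: "k < n" by simp
        note Gk = G[unfolded G_def, rule_format, OF k]
        from conjunct2[OF conjunct2[OF Gk]] conjunct1[OF Gk]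
        have "(\<integral>\<xi>. ?tr (F k \<xi>) \<xi> z \<partial>?N) = \<phi>' k z"
          by (rule trans[OF sym])
        then show "f k x * (\<integral>\<xi>. ?tr (F k \<xi>) \<xi> z \<partial>?N) = f' k x * \<phi>' k z"
          using elim(2) k by simp
      qed
      finally show "(\<integral>\<xi>. ?tr (A x \<xi>) \<xi> z \<partial>?N) = (\<Sum>k<n. f' k x * \<phi>' k z)" .
    qed
  qed
  have 2: "AE x in \<mu>. (\<integral>\<xi>. op_trace (H \<xi>) (A x \<xi> \<circ> adjoint_op (H \<xi>) (A x \<xi>)) \<partial>?N) =
       complex_of_real (\<integral>z. (cmod (\<Sum>k<n. f' k x * \<phi>' k z))\<^sup>2 \<partial>\<mu>)"
    using A_fib ff'_all
  proof eventually_elim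
    case (elim x)
    define \<Phi> where "\<Phi> = (\<lambda>z. \<Sum>k<n. f k x * \<phi> k z)"
    have \<Phi>: "\<Phi> \<in> L2 ?M" and P\<Phi>: "AE \<xi> in \<nu>. \<forall>v\<in>H \<xi>. P \<Phi> \<xi> v = (\<Sum>k<n. f k x *\<^sub>C P (\<phi> k) \<xi> v)"
      using plancherel_transform_linear_comb[OF P_lin \<phi>, where c = "\<lambda>k. f k x"]
      unfolding \<Phi>_def AE_completion_iff by auto
    have hs: "AE \<xi> in \<nu>. hilbert_schmidt (H \<xi>) (P \<Phi> \<xi>)"
      using P_B2[OF \<Phi>] unfolding B2_space_def AE_completion_iff by simp
    have "AE \<xi> in \<nu>. op_trace (H \<xi>) (A x \<xi> \<circ> adjoint_op (H \<xi>) (A x \<xi>)) =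
        op_trace (H \<xi>) (P \<Phi> \<xi> \<circ> adjoint_op (H \<xi>) (P \<Phi> \<xi>))"
      using elim(1) P\<Phi> P\<phi>_all hs AE_space
    proof eventually_elim
      case (elim \<xi>)
      show ?case
      proof (rule op_trace_self_adjoint_cong[OF fib(1)[OF elim(5)]])
        show "bounded_op (H \<xi>) (P \<Phi> \<xi>)" using elim(4) by (simp add: hilbert_schmidt_def)
        show "A x \<xi> v = P \<Phi> \<xi> v" if "v \<in> H \<xi>" for v
          using elim(1-3) that by simp
      qed
    qed
    then have "(\<integral>\<xi>. op_trace (H \<xi>) (A x \<xi> \<circ> adjoint_op (H \<xi>) (A x \<xi>)) \<partial>?N) = B2_inner ?N H (P \<Phi>) (P \<Phi>)"
      unfolding B2_inner_def by (rule integral_completion_cong_AE)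
    also have "\<dots> = complex_of_real (\<integral>z. (cmod (\<Phi> z))\<^sup>2 \<partial>?M)"
      unfolding P_inner[OF \<Phi>] by (rule L2_inner_self)
    also have "(\<integral>z. (cmod (\<Phi> z))\<^sup>2 \<partial>?M) = (\<integral>z. (cmod (\<Sum>k<n. f' k x * \<phi>' k z))\<^sup>2 \<partial>?M)"
    proof (rule integral_completion_cong_AE, use \<phi>\<phi>'_all in eventually_elim)
      case (elim z)
      then show ?case using \<open>\<forall>k<n. f k x = f' k x\<close> by (simp add: \<Phi>_def)
    qed
    also have "\<dots> = (\<integral>z. (cmod (\<Sum>k<n. f' k x * \<phi>' k z))\<^sup>2 \<partial>\<mu>)"
    proof (rule integral_completion)
      have [measurable]: "(\<lambda>z. \<Sum>k<n. f' k x * \<phi>' k z) \<in> borel_measurable \<mu>"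
        by (intro L2_measurable L2_sum L2_cmult \<phi>')
      show "(\<lambda>z. (cmod (\<Sum>k<n. f' k x * \<phi>' k z))\<^sup>2) \<in> borel_measurable \<mu>" by measurable
    qed
    finally show ?case .
  qed
  show ?thesis
    using f' \<phi>' AE_G 1 2 by (intro exI[of _ n] exI[of _ f'] exI[of _ \<phi>'] exI[of _ G]) simp
qed

section \<open>The Hilbert-Schmidt norm of the quantization\<close>

theorem mainTheorem1:
  fixes \<mu> :: "'g::{topological_group_add, t2_space, second_countable_topology} measure"
    and \<Delta> :: "'g \<Rightarrow> real"
    and \<nu> :: "('g, 'h::{chilbert_space, second_countable_topology}) rep set measure"
    and H :: "('g, 'h) rep set \<Rightarrow> 'h set"
    and e :: "nat \<Rightarrow> ('g, 'h) rep set \<Rightarrow> 'h"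
    and \<pi> :: "('g, 'h) rep set \<Rightarrow> 'g \<Rightarrow> 'h \<Rightarrow> 'h"
    and D sqrtD :: "('g, 'h) rep set \<Rightarrow> ('h \<times> 'h) set"
    and A :: "'g \<Rightarrow> ('g, 'h) rep set \<Rightarrow> 'h \<Rightarrow> 'h"
  assumes "locally_compact_space (euclidean :: 'g topology)"
    and "\<nexists>B :: 'h set. finite B \<and> span B = UNIV"
    and "type_I_group TYPE('g) TYPE('h)"
    and "left_haar_measure \<mu>"
    and "modular_function \<mu> \<Delta>"
    and "plancherel_data \<mu> \<Delta> \<nu> H e \<pi> D sqrtD"
    and "A \<in> symbols \<mu> \<nu> H e sqrtD"
  shows "ker_symbol \<Delta> \<nu> H \<pi> sqrtD A \<in> L2 (completion (\<mu> \<Otimes>\<^sub>M \<mu>)) \<and>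
         L2_hilbert_schmidt (completion \<mu>) (Op_symbol \<mu> \<Delta> \<nu> H \<pi> sqrtD A) \<and>
         has_integral_kernel (completion \<mu>) (Op_symbol \<mu> \<Delta> \<nu> H \<pi> sqrtD A)
           (ker_symbol \<Delta> \<nu> H \<pi> sqrtD A) \<and>
         hs_norm (L2 (completion \<mu>)) (L2_inner (completion \<mu>)) (Op_symbol \<mu> \<Delta> \<nu> H \<pi> sqrtD A) =
           symbol_norm \<mu> \<nu> H A"
proof -
  note sf = haar_sigma_finite[OF assms(1,4)]
  interpret haar_group \<mu> \<Delta> using sf assms(4,5) by (rule haar_group.intro)
  interpret s: sigma_finite_measure \<mu> by (rule sf)
  interpret pair: pair_sigma_finite \<mu> \<mu> ..
  let ?M = "completion \<mu>" and ?M2 = "completion (\<mu> \<Otimes>\<^sub>M \<mu>)"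
  let ?ker = "ker_symbol \<Delta> \<nu> H \<pi> sqrtD A" and ?Op = "Op_symbol \<mu> \<Delta> \<nu> H \<pi> sqrtD A"
  let ?I = "\<lambda>x z. \<integral>\<xi>. tr_pi (H \<xi>) (sqrtD \<xi>) (\<pi> \<xi>) (A x \<xi>) z \<partial>completion \<nu>"
  obtain n :: nat and f \<phi> G where fL: "\<forall>k<n. f k \<in> L2 \<mu> \<and> \<phi> k \<in> L2 \<mu>" and G: "AE z in \<mu>. G z"
    and I: "AE x in \<mu>. \<forall>z. G z \<longrightarrow> ?I x z = (\<Sum>k<n. f k x * \<phi> k z)"
    and tr: "AE x in \<mu>. (\<integral>\<xi>. op_trace (H \<xi>) (A x \<xi> \<circ> adjoint_op (H \<xi>) (A x \<xi>)) \<partial>completion \<nu>) =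
       complex_of_real (\<integral>z. (cmod (\<Sum>k<n. f k x * \<phi> k z))\<^sup>2 \<partial>\<mu>)"
    using symbol_fibre_identities[OF sf assms(6,7)] by (elim exE conjE) (rule that)
  define \<Phi> where "\<Phi> p = (\<Sum>k<n. f k (fst p) * \<phi> k (snd p))" for p
  have \<Phi>L2: "\<Phi> \<in> L2 (\<mu> \<Otimes>\<^sub>M \<mu>)"
    unfolding \<Phi>_def[abs_def] using fL by (intro L2_sum L2_tensor[OF sf]) auto
  note [measurable] = L2_measurable[OF \<Phi>L2]
  have \<Phi>_borel [measurable]: "\<Phi> \<in> borel_measurable (borel \<Otimes>\<^sub>M borel)"
    using L2_measurable[OF \<Phi>L2] by (simp cong: measurable_cong_sets sets_pair_measure_cong)
  define k where "k p = complex_of_real (\<Delta> (snd p) powr (- 1 / 2)) * \<Phi> (fst p, fst p - snd p)" for p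
  have k_meas: "k \<in> borel_measurable (\<mu> \<Otimes>\<^sub>M \<mu>)"
    unfolding k_def[abs_def] by measurable
  have k_sq: "(cmod (k (x, y)))\<^sup>2 = (1 / \<Delta> y) * (cmod (\<Phi> (x, x - y)))\<^sup>2" for x y
  proof -
    have "(\<Delta> y powr (- 1 / 2))\<^sup>2 = 1 / \<Delta> y"
      using modular_pos[of y] by (simp add: powr_minus_divide powr_half_sqrt power_divide less_imp_le)
    then show ?thesis
      unfolding k_def by (simp add: norm_mult power_mult_distrib)
  qed
  \<comment> \<open>the common value of the two squared norms\<close>
  define K where "K = (\<integral>p. (cmod (\<Phi> p))\<^sup>2 \<partial>(\<mu> \<Otimes>\<^sub>M \<mu>))"
  have "(\<integral>\<^sup>+x. \<integral>\<^sup>+y. ennreal ((cmod (k (x, y)))\<^sup>2) \<partial>\<mu> \<partial>\<mu>) = (\<integral>\<^sup>+x. \<integral>\<^sup>+y. ennreal ((cmod (\<Phi> (x, y)))\<^sup>2) \<partial>\<mu> \<partial>\<mu>)"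
  proof (rule nn_integral_cong)
    fix x
    have "(\<integral>\<^sup>+y. ennreal ((cmod (k (x, y)))\<^sup>2) \<partial>\<mu>) =
        (\<integral>\<^sup>+y. ennreal (1 / \<Delta> y) * ennreal ((cmod (\<Phi> (x, x - y)))\<^sup>2) \<partial>\<mu>)"
      unfolding k_sq using less_imp_le[OF modular_pos] by (subst ennreal_mult) simp_all
    also have "\<dots> = (\<integral>\<^sup>+y. ennreal ((cmod (\<Phi> (x, y)))\<^sup>2) \<partial>\<mu>)"
      by (rule nn_integral_reflect) measurable
    finally show "(\<integral>\<^sup>+y. ennreal ((cmod (k (x, y)))\<^sup>2) \<partial>\<mu>) = (\<integral>\<^sup>+y. ennreal ((cmod (\<Phi> (x, y)))\<^sup>2) \<partial>\<mu>)" .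
  qed
  also have "\<dots> = (\<integral>\<^sup>+p. ennreal ((cmod (\<Phi> p))\<^sup>2) \<partial>(\<mu> \<Otimes>\<^sub>M \<mu>))"
    by (rule s.nn_integral_fst) measurable
  also have "\<dots> = ennreal K" unfolding K_def by (rule L2_nn_integral[OF \<Phi>L2])
  finally have k_nn: "(\<integral>\<^sup>+x. \<integral>\<^sup>+y. ennreal ((cmod (k (x, y)))\<^sup>2) \<partial>\<mu> \<partial>\<mu>) = ennreal K" .
  have kL2: "k \<in> L2 (\<mu> \<Otimes>\<^sub>M \<mu>)"
  proof (rule L2I_nn[OF k_meas])
    note [measurable] = k_meas
    have "(\<integral>\<^sup>+p. ennreal ((cmod (k p))\<^sup>2) \<partial>(\<mu> \<Otimes>\<^sub>M \<mu>)) = ennreal K"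
      unfolding k_nn[symmetric] by (rule s.nn_integral_fst[symmetric]) measurable
    then show "(\<integral>\<^sup>+p. ennreal ((cmod (k p))\<^sup>2) \<partial>(\<mu> \<Otimes>\<^sub>M \<mu>)) < \<infinity>" by simp
  qed
  have ker_I: "?ker (x, y) = complex_of_real (\<Delta> y powr (- 1 / 2)) * ?I x (x - y)" for x y
    by (simp add: ker_symbol_def)
  have Op_ker: "?Op u x = (\<integral>y. ?ker (x, y) * u y \<partial>?M)" for u x
    unfolding Op_symbol_def ker_I by (simp add: mult_ac)
  have ker_k: "?ker (x, y) = k (x, y)"
    if "\<forall>z. G z \<longrightarrow> ?I x z = (\<Sum>k<n. f k x * \<phi> k z)" "G (x - y)" for x y
    using that by (simp add: ker_I k_def \<Phi>_def)
  have ker_fib: "AE x in \<mu>. AE y in \<mu>. ?ker (x, y) = k (x, y)"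
    using I
  proof eventually_elim
    case (elim x)
    show ?case using AE_reflect[OF G, of x] by eventually_elim (rule ker_k[OF elim])
  qed
  \<comment> \<open>measurable null sets of the group for the first variable and for the difference
     cover the exceptional set in the product\<close>
  have ker_AE: "AE p in \<mu> \<Otimes>\<^sub>M \<mu>. ?ker p = k p"
  proof -
    obtain X where X: "{x \<in> space \<mu>. \<not> (\<forall>z. G z \<longrightarrow> ?I x z = (\<Sum>k<n. f k x * \<phi> k z))} \<subseteq> X"
      "emeasure \<mu> X = 0" "X \<in> sets \<mu>"
      using I by (rule AE_E)
    obtain Z where Z: "{z \<in> space \<mu>. \<not> G z} \<subseteq> Z" "emeasure \<mu> Z = 0" "Z \<in> sets \<mu>"
      using G by (rule AE_E)
    have [measurable]: "X \<in> sets borel" "Z \<in> sets borel" using X(3) Z(3) by simp_all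
    have XZ: "AE x in \<mu>. x \<notin> X" "AE z in \<mu>. z \<notin> Z"
      using X Z by (auto intro!: AE_not_in simp: null_sets_def)
    have "AE p in \<mu> \<Otimes>\<^sub>M \<mu>. fst p \<notin> X \<and> fst p - snd p \<notin> Z"
    proof (rule pair.AE_pair_measure)
      show "{p \<in> space (\<mu> \<Otimes>\<^sub>M \<mu>). fst p \<notin> X \<and> fst p - snd p \<notin> Z} \<in> sets (\<mu> \<Otimes>\<^sub>M \<mu>)"
        by measurable
      show "AE x in \<mu>. AE y in \<mu>. fst (x, y) \<notin> X \<and> fst (x, y) - snd (x, y) \<notin> Z"
        using XZ(1)
      proof eventually_elim
        case (elim x)
        show ?case using AE_reflect[OF XZ(2), of x] by eventually_elim (use elim in simp)
      qed
    qed
    then show ?thesis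
    proof eventually_elim
      case (elim p)
      obtain x y where p: "p = (x, y)" by (cases p)
      have "\<forall>z. G z \<longrightarrow> ?I x z = (\<Sum>k<n. f k x * \<phi> k z)" using elim X(1) p by auto
      moreover have "G (x - y)" using elim Z(1) p by auto
      ultimately show ?case unfolding p by (rule ker_k)
    qed
  qed
  have ker_L2: "?ker \<in> L2 ?M2"
  proof (rule L2_cong_AE[OF L2_completion[OF kL2]])
    show "?ker \<in> borel_measurable ?M2"
      by (rule borel_measurable_completion_AE[OF measurable_completion[OF k_meas] ker_AE])
    show "AE p in ?M2. k p = ?ker p"
      using AE_completion[OF ker_AE] by eventually_elim simp
  qed
  interpret sk: square_integrable_kernel \<mu> k ?Op K
  proof
    show "0 \<le> K" unfolding K_def by simp
    show "AE x in \<mu>. ?Op u x = (\<integral>y. k (x, y) * u y \<partial>?M)" for u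
      using ker_fib
    proof eventually_elim
      case (elim x)
      then have "AE y in \<mu>. ?ker (x, y) * u y = k (x, y) * u y" by eventually_elim simp
      then show ?case unfolding Op_ker by (rule integral_completion_cong_AE)
    qed
    interpret ip: complete_inner_space "L2 ?M" "\<lambda>c f x. c * f x" "L2_inner ?M"
      by (rule complete_inner_space_L2)
    show "countable (onb (L2 ?M) (L2_inner ?M))"
      by (rule countable_orthonormal_L2[OF sf sets_haar ip.onb_orthonormal])
  qed (use k_meas k_nn in auto)
  have kernel: "has_integral_kernel ?M ?Op ?ker"
    unfolding has_integral_kernel_def
  proof
    fix u assume u: "u \<in> L2 ?M"
    show "AE x in ?M. integrable ?M (\<lambda>y. ?ker (x, y) * u y) \<and> ?Op u x = (\<integral>y. ?ker (x, y) * u y \<partial>?M)"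
    proof (rule AE_completion, use ker_fib sk.kernel_integrable[OF u] in eventually_elim)
      case (elim x)
      have "AE y in \<mu>. ?ker (x, y) * u y = k (x, y) * u y"
        using elim(1) by eventually_elim simp
      then show ?case using integrable_completion_cong_AE[OF elim(2)] Op_ker by simp
    qed
  qed
  have "symbol_inner \<mu> \<nu> H A A = (\<integral>x. complex_of_real (\<integral>z. (cmod (\<Phi> (x, z)))\<^sup>2 \<partial>\<mu>) \<partial>?M)"
    unfolding symbol_inner_def using tr by (intro integral_completion_cong_AE) (simp add: \<Phi>_def)
  also have "\<dots> = complex_of_real (\<integral>x. (\<integral>z. (cmod (\<Phi> (x, z)))\<^sup>2 \<partial>\<mu>) \<partial>?M)"
    by (rule integral_complex_of_real)
  also have "(\<integral>x. (\<integral>z. (cmod (\<Phi> (x, z)))\<^sup>2 \<partial>\<mu>) \<partial>?M) = (\<integral>x. (\<integral>z. (cmod (\<Phi> (x, z)))\<^sup>2 \<partial>\<mu>) \<partial>\<mu>)"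
    by (rule integral_completion) measurable
  also have "\<dots> = K"
    unfolding K_def by (rule pair.integral_fst'[OF L2_integrable[OF \<Phi>L2]])
  finally have "symbol_norm \<mu> \<nu> H A = sqrt K" by (simp add: symbol_norm_def)
  then show ?thesis
    using ker_L2 sk.T_hilbert_schmidt kernel sk.T_hs_norm by simp
qed

end
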